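(* Let $\kappa\ge1$ and $0<\gamma\le2$. Assume $u_0$ is $2\pi$-periodic, odd and bounded. Suppose $u$ is the solution to $$\partial_tu=-\kappa^2\Lambda^\gamma u+u-u^3,\quad (x,t)\in\mathbb{T}\times(0,\infty),\qquad u|_{t=0}=u_0.$$ If $\kappa>1$, then $$u(x,t)=e^{-(\kappa^2-1)t}\alpha_*\sin x+r(t),\qquad\forall\,t\ge1,$$ where the constant $\alpha_*$ depends on $u_0,\gamma$ and $\kappa$, and $\|r(t)\|_{H^{10}(\mathbb T)}=o(e^{-(\kappa^2-1)t})$ as $t\to+\infty$. If $\kappa=1$, then $$u(x,t)=t^{-\frac12}\beta_*\sin x+r_1(t),\qquad\forall\,t\ge1,$$ where the constant $\beta_*$ depends on $u_0,\gamma$, and $\|r_1(t)\|_{H^{10}(\mathbb T)}=o(t^{-\frac12})$ as $t\to+\infty$.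
   Context: $\mathbb{T}=[-\pi,\pi]$ is the periodic torus and functions are real-valued. $\Lambda^\gamma=(-\partial_{xx})^{\gamma/2}$ is the fractional Laplacian of order $\gamma$, i.e. the Fourier multiplier $|k|^\gamma$ on $2\pi$-periodic functions; for $\gamma=2$ it equals $-\partial_{xx}$. The solution for bounded initial data is the unique global bounded (mild) solution, which is smooth for $t>0$. The remainders $r(t)$, $r_1(t)$ are functions of $x$ for each $t$. *)

theory Defs
  imports "HOL-Analysis.Analysis" "HOL-Library.Landau_Symbols"
begin

text \<open>
  Functions on the torus are \<open>2\<pi>\<close>-periodic functions on the real line, and a function
  \<open>u\<close> of time and space is written \<open>u t x\<close>, so that \<open>u t\<close> is the profile at time \<open>t\<close>.
\<close>

definition torus_periodic :: "(real \<Rightarrow> real) \<Rightarrow> bool" where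
  "torus_periodic f \<longleftrightarrow> (\<forall>x. f (x + 2 * pi) = f x)"

definition fourier_coeff :: "(real \<Rightarrow> real) \<Rightarrow> int \<Rightarrow> complex" where
  "fourier_coeff f k =
     (1 / (2 * pi)) *\<^sub>R (LINT x|lebesgue_on {-pi..pi}. of_real (f x) * cis (- (of_int k * x)))"

text \<open>
  The operator with Fourier multiplier \<open>m\<close>.  Below \<open>m\<close> is real and even, so for real-valued
  \<open>f\<close> the series is real and taking the real part only changes the type.
\<close>

definition fourier_mult :: "(int \<Rightarrow> real) \<Rightarrow> (real \<Rightarrow> real) \<Rightarrow> real \<Rightarrow> real" where
  "fourier_mult m f x =
     Re (\<Sum>\<^sub>\<infinity>k\<in>UNIV. of_real (m k) * fourier_coeff f k * cis (of_int k * x))"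

text \<open>The symbol of the fractional Laplacian \<open>\<Lambda>\<^sup>\<gamma> = (-\<partial>\<^sub>x\<^sub>x)\<^sup>\<gamma>\<^sup>/\<^sup>2\<close>; note that \<open>0 powr \<gamma> = 0\<close>.\<close>

definition frac_laplacian_symbol :: "real \<Rightarrow> int \<Rightarrow> real" where
  "frac_laplacian_symbol \<gamma> k = \<bar>of_int k\<bar> powr \<gamma>"

text \<open>
  The semigroup generated by \<open>-\<nu> \<Lambda>\<^sup>\<gamma>\<close>.  For \<open>\<nu>, \<gamma>, t > 0\<close> and bounded \<open>f\<close> the series
  converges absolutely.
\<close>

definition frac_heat :: "real \<Rightarrow> real \<Rightarrow> real \<Rightarrow> (real \<Rightarrow> real) \<Rightarrow> real \<Rightarrow> real" where
  "frac_heat \<nu> \<gamma> t = fourier_mult (\<lambda>k. exp (- t * (\<nu> * frac_laplacian_symbol \<gamma> k)))"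

text \<open>
  Global bounded mild solutions of
  \<open>\<partial>\<^sub>t u = -\<kappa>\<^sup>2 \<Lambda>\<^sup>\<gamma> u + u - u\<^sup>3\<close> with \<open>u = u0\<close> at \<open>t = 0\<close>: the Duhamel formula
  holds at every \<open>x\<close>, which for \<open>t > 0\<close> selects the continuous representative of \<open>u t\<close>.
  The integral is over the open interval because the semigroup series need not converge
  at elapsed time \<open>t - s = 0\<close>.
\<close>

definition bounded_mild_solution ::
    "real \<Rightarrow> real \<Rightarrow> (real \<Rightarrow> real) \<Rightarrow> (real \<Rightarrow> real \<Rightarrow> real) \<Rightarrow> bool" where
  "bounded_mild_solution \<kappa> \<gamma> u0 u \<longleftrightarrow>
     (\<forall>x. u 0 x = u0 x) \<and>
     (\<forall>t\<ge>0. torus_periodic (u t)) \<and>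
     (\<lambda>(t, x). u t x) \<in> borel_measurable (restrict_space borel ({0<..} \<times> UNIV)) \<and>
     (\<exists>M. \<forall>t\<ge>0. \<forall>x. \<bar>u t x\<bar> \<le> M) \<and>
     (\<forall>t>0. \<forall>x.
        integrable (lebesgue_on {0<..<t})
          (\<lambda>s. frac_heat (\<kappa>\<^sup>2) \<gamma> (t - s) (\<lambda>y. u s y - (u s y) ^ 3) x) \<and>
        u t x = frac_heat (\<kappa>\<^sup>2) \<gamma> t u0 x
          + (LINT s|lebesgue_on {0<..<t}.
               frac_heat (\<kappa>\<^sup>2) \<gamma> (t - s) (\<lambda>y. u s y - (u s y) ^ 3) x))"

text \<open>
  The \<open>L\<^sup>2\<close> conditions in \<open>sobolev_space\<close> are needed because the Fourier coefficients of a
  non-integrable function are \<open>0\<close> by convention.  By Parseval the factor \<open>2\<pi>\<close> makes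
  \<open>sobolev_norm 0\<close> the \<open>L\<^sup>2\<close> norm on \<open>[-\<pi>, \<pi>]\<close>.
\<close>

definition sobolev_space :: "nat \<Rightarrow> (real \<Rightarrow> real) set" where
  "sobolev_space s = {f. torus_periodic f \<and> f \<in> borel_measurable lebesgue \<and>
     integrable (lebesgue_on {-pi..pi}) (\<lambda>x. (f x)\<^sup>2) \<and>
     (\<lambda>k. (1 + (of_int k)\<^sup>2) ^ s * (cmod (fourier_coeff f k))\<^sup>2 :: real) summable_on UNIV}"

definition sobolev_norm :: "nat \<Rightarrow> (real \<Rightarrow> real) \<Rightarrow> real" where
  "sobolev_norm s f =
     sqrt (2 * pi * (\<Sum>\<^sub>\<infinity>k\<in>UNIV. (1 + (of_int k)\<^sup>2) ^ s * (cmod (fourier_coeff f k))\<^sup>2))"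

end

theory Submission
  imports Defs
begin

text \<open>
  Write \<open>a t k\<close> for the Fourier coefficients of \<open>u t\<close>, \<open>\<nu> = \<kappa>\<^sup>2\<close> and \<open>lam k = \<nu> \<bar>k\<bar>\<^sup>\<gamma>\<close>.  The equation
  becomes \<open>a' = - (lam - 1) a - d\<close>, where \<open>d t k\<close> are the coefficients of \<open>u\<^sup>3\<close>.  An odd solution has
  no mean, so the slowest linear rate is \<open>\<nu> - 1\<close>, attained at \<open>\<bar>k\<bar> = 1\<close> only.  All other modes turn
  out to be of smaller order, which leaves one scalar equation for the first mode.

  Reaching the system of ordinary differential equations takes most of the work, because the solution
  is only a bounded mild one and \<open>\<gamma>\<close> may be small.

  \<^item> Pairing the Duhamel formula with a bounded function \<open>h\<close> and using Bessel's inequality to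
    interchange integrals gives \<open>1/(2\<pi>) \<integral> u h = \<Sum> a\<^sub>k h\<^sub>-\<^sub>k\<close> (\<open>u_pairing\<close>).  This identity contains the
    Duhamel formula for each coefficient, Parseval's identity for \<open>u t\<close>, and the convolution formula
    for products.

  \<^item> The even part of \<open>u\<close> satisfies a linear Gronwall inequality in \<open>L\<^sup>2\<close>, so it vanishes (\<open>Re_a_zero\<close>).

  \<^item> Cubing is Lipschitz on bounded functions, so it is bounded on \<open>H\<^sup>s\<close> for \<open>0 < s < 1\<close>; this is
    read off from the differences \<open>u(x + h) - u(x)\<close>.  Duhamel's formula gains \<open>\<gamma>/2\<close> derivatives in
    \<open>L\<^sup>2\<close>, hence finitely many steps lead beyond \<open>H\<^sup>1\<close> (\<open>energy_bounded_above_2\<close>).  The coefficients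
    are then bounded by a power \<open>\<bar>k\<bar>\<^sup>-\<^sup>\<sigma>\<close> with \<open>\<sigma> > 1\<close>, a bound that convolution preserves, and
    repeated use of Duhamel's formula gives all powers (\<open>coeff_decay_all\<close>).

  \<^item> The energy \<open>E = \<Sum> \<bar>a\<^sub>k\<bar>\<^sup>2\<close> satisfies \<open>E' \<le> - 2 (\<nu> - 1) E - 2 E\<^sup>2\<close>, so it is
    \<open>O(exp (- 2 (\<nu> - 1) t))\<close>, and \<open>O(1/t)\<close> if \<open>\<nu> = 1\<close>.  Since \<open>\<bar>d t k\<bar> \<le> sup \<bar>u\<bar> E\<close>, the forcing
    of each mode is of the order of the \<^emph>\<open>square\<close> of the solution.  The modes \<open>\<bar>k\<bar> \<ge> 2\<close>, whose linear
    rate is larger, therefore decay faster than these bounds on \<open>\<surd>E\<close> (\<open>high_mode_bound\<close>).  Interpolation with the bounds by powers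
    of \<open>\<bar>k\<bar>\<close> costs an arbitrarily small part of the rate and yields every Sobolev norm.

  \<^item> If \<open>\<kappa> > 1\<close>, then \<open>exp ((\<nu> - 1) t)\<close> times the first mode has an integrable derivative, so it
    converges (\<open>supercritical_expansion\<close>).  If \<open>\<kappa> = 1\<close>, the first mode \<open>a\<^sub>1 = \<i> y\<close> satisfies
    \<open>y' = - 3 y\<^sup>3 + O(t\<^sup>-\<^sup>1\<^sup>5\<^sup>/\<^sup>8)\<close>, and \<open>\<surd>t y\<close> converges for every solution of such an equation
    (\<open>cubic_ode_limit\<close>).
\<close>

section \<open>Fourier coefficients of bounded functions on the torus\<close>

definition torus :: "real measure" where
  "torus = restrict_space lborel {-pi..pi}"

abbreviation int_counting :: "int measure" where
  "int_counting \<equiv> count_space UNIV"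

abbreviation bracket :: "int \<Rightarrow> real"  ("\<langle>_\<rangle>") where
  "\<langle>k\<rangle> \<equiv> 1 + \<bar>real_of_int k\<bar>"

text \<open>
  The coefficients of complex functions: test functions such as \<open>u\<^sup>2 cis (- k x)\<close> are not real.  The
  measure is a restriction of \<open>lborel\<close>, not of \<open>lebesgue\<close>, so that Fubini's theorem applies to functions
  that are Borel in time and space.
\<close>

definition torus_coeff :: "(real \<Rightarrow> complex) \<Rightarrow> int \<Rightarrow> complex" where
  "torus_coeff h k = (1 / (2 * pi)) *\<^sub>R (LINT x|torus. h x * cis (- (of_int k * x)))"

definition bdd_borel :: "(real \<Rightarrow> complex) \<Rightarrow> bool" where
  "bdd_borel h \<longleftrightarrow> h \<in> borel_measurable borel \<and> (\<exists>B. \<forall>x. cmod (h x) \<le> B)"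

lemma space_torus [simp]: "space torus = {-pi..pi}"
  by (simp add: torus_def)

lemma borel_measurable_torus [measurable (raw)]:
  "f \<in> borel_measurable borel \<Longrightarrow> f \<in> borel_measurable torus"
  by (simp add: torus_def measurable_restrict_space1)

lemma emeasure_torus: "emeasure torus (space torus) = ennreal (2 * pi)"
  by (simp add: torus_def emeasure_restrict_space)

lemma finite_measure_torus: "finite_measure torus"
  by (rule finite_measureI) (simp only: emeasure_torus, simp)

interpretation torus: finite_measure torus
  by (rule finite_measure_torus)

lemma measure_torus [simp]: "measure torus {-pi..pi} = 2 * pi"
  using emeasure_torus by (simp add: measure_def)

lemma integrable_torus:
  fixes h :: "real \<Rightarrow> 'b :: {banach, second_countable_topology}"
  assumes "h \<in> borel_measurable borel" "\<And>x. norm (h x) \<le> B"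
  shows "integrable torus h"
  by (rule torus.integrable_const_bound[where B = B]) (use assms in auto)

lemma norm_integral_torus_le:
  fixes h :: "real \<Rightarrow> 'b :: {banach, second_countable_topology}"
  assumes "h \<in> borel_measurable borel" "\<And>x. norm (h x) \<le> B"
  shows "norm (LINT x|torus. h x) \<le> 2 * pi * B"
proof -
  have "norm (LINT x|torus. h x) \<le> (LINT x|torus. norm (h x))"
    by simp
  also have "\<dots> \<le> (LINT x|torus. B)"
    by (intro integral_mono integrable_norm integrable_torus[OF assms]) (use assms in auto)
  finally show ?thesis by simp
qed

text \<open>
  Passes from the completed measure to one for which product measures behave well.
\<close>

lemma integral_lebesgue_on_eq_lborel:
  fixes f :: "real \<Rightarrow> 'b :: {banach, second_countable_topology}"
  assumes [measurable]: "f \<in> borel_measurable borel" "S \<in> sets borel"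
  shows "(LINT x|lebesgue_on S. f x) = (LINT x|restrict_space lborel S. f x)"
    and "integrable (lebesgue_on S) f \<longleftrightarrow> integrable (restrict_space lborel S) f"
proof -
  have m: "(\<lambda>x. indicator S x *\<^sub>R f x) \<in> borel_measurable lborel" by simp
  show "(LINT x|lebesgue_on S. f x) = (LINT x|restrict_space lborel S. f x)"
    using integral_completion[OF m] by (simp add: integral_restrict_space)
  show "integrable (lebesgue_on S) f \<longleftrightarrow> integrable (restrict_space lborel S) f"
    using integrable_completion[OF m] by (simp add: integrable_restrict_space set_integrable_def)
qed

lemma cis_measurable [measurable]: "cis \<in> borel_measurable borel"
  by (intro borel_measurable_continuous_onI continuous_intros)

lemma cnj_measurable [measurable]: "cnj \<in> borel_measurable borel"
  by (intro borel_measurable_continuous_onI continuous_intros)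

lemma fourier_coeff_eq_torus_coeff:
  assumes [measurable]: "f \<in> borel_measurable borel"
  shows "fourier_coeff f k = torus_coeff (\<lambda>x. of_real (f x)) k"
  unfolding fourier_coeff_def torus_coeff_def torus_def
  by (subst integral_lebesgue_on_eq_lborel) auto

lemma integral_cis_torus:
  "(LINT x|torus. cis (of_int m * x)) = (if m = 0 then of_real (2 * pi) else 0)"
proof (cases "m = 0")
  case False
  have "((\<lambda>x. cis (of_int m * x)) has_integral
        cis (of_int m * pi) / (\<i> * of_int m) - cis (of_int m * (-pi)) / (\<i> * of_int m)) {-pi..pi}"
  proof (rule fundamental_theorem_of_calculus)
    fix x assume "x \<in> {-pi..pi}"
    have "((\<lambda>z. exp (\<i> * of_int m * z) / (\<i> * of_int m)) has_field_derivative
            exp (\<i> * of_int m * of_real x)) (at (of_real x))"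
      using False by (auto intro!: derivative_eq_intros)
    from has_vector_derivative_real_field[OF this]
    show "((\<lambda>x. cis (of_int m * x) / (\<i> * of_int m)) has_vector_derivative cis (of_int m * x))
                 (at x within {-pi..pi})"
      by (simp add: cis_conv_exp mult.assoc)
  qed simp
  moreover have "cis (of_int m * pi) = cis (of_int m * (-pi))"
    using sin_npi_int[of m] by (simp add: complex_eq_iff mult.commute)
  ultimately have 1: "((\<lambda>x. cis (of_int m * x)) has_integral 0) {-pi..pi}" by simp
  have "set_integrable lborel {-pi..pi} (\<lambda>x. cis (of_int m * x))"
    by (rule borel_integrable_atLeastAtMost') (intro continuous_intros)
  from set_borel_integral_eq_integral(2)[OF this] 1
  have "(LINT x:{-pi..pi}|lborel. cis (of_int m * x)) = 0"
    by (simp add: integral_unique)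
  then show ?thesis using False
    by (simp add: torus_def integral_restrict_space set_lebesgue_integral_def)
qed (simp add: scaleR_conv_of_real)

lemma torus_coeff_cis: "torus_coeff (\<lambda>x. cis (of_int m * x)) k = (if k = m then 1 else 0)"
proof -
  have "cis (of_int m * x) * cis (- (of_int k * x)) = cis (of_int (m - k) * x)" for x
    by (simp add: cis_mult algebra_simps)
  then show ?thesis
    using integral_cis_torus[of "m - k"] by (simp add: torus_coeff_def scaleR_conv_of_real)
qed

lemma torus_coeff_integrand:
  assumes "bdd_borel h"
  shows "integrable torus (\<lambda>x. h x * cis (- (of_int k * x)))"
  using assms unfolding bdd_borel_def by (auto intro!: integrable_torus simp: norm_mult)

lemma bdd_borel_mult:
  assumes "bdd_borel f" "bdd_borel g" shows "bdd_borel (\<lambda>x. f x * g x)"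
proof -
  from assms obtain A B where "\<forall>x. cmod (f x) \<le> A" "\<forall>x. cmod (g x) \<le> B"
    by (auto simp: bdd_borel_def)
  then have "\<forall>x. cmod (f x * g x) \<le> A * B"
    by (auto simp: norm_mult intro!: mult_mono order_trans[OF norm_ge_zero])
  then show ?thesis using assms by (auto simp: bdd_borel_def)
qed

lemma bdd_borel_add:
  assumes "bdd_borel f" "bdd_borel g" shows "bdd_borel (\<lambda>x. f x + g x)"
  using assms unfolding bdd_borel_def
  by (auto intro!: exI[of _ "_ + _"] order_trans[OF norm_triangle_ineq] add_mono)

lemma bdd_borel_const [simp]: "bdd_borel (\<lambda>x. c)"
  by (auto simp: bdd_borel_def)

lemma bdd_borel_diff:
  assumes "bdd_borel f" "bdd_borel g" shows "bdd_borel (\<lambda>x. f x - g x)"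
  using bdd_borel_add[OF assms(1) bdd_borel_mult[OF bdd_borel_const[of "-1"] assms(2)]] by simp

lemma bdd_borel_power: "bdd_borel f \<Longrightarrow> bdd_borel (\<lambda>x. f x ^ n)"
  by (induction n) (auto intro: bdd_borel_mult)

lemma bdd_borel_cis [simp]: "bdd_borel (\<lambda>x. cis (c * x))"
  by (auto simp: bdd_borel_def intro!: exI[of _ 1])

lemma bdd_borel_cis_minus [simp]: "bdd_borel (\<lambda>x. cis (- (c * x)))"
  using bdd_borel_cis[of "-c"] by simp

lemma bdd_borel_cnj: "bdd_borel f \<Longrightarrow> bdd_borel (\<lambda>x. cnj (f x))"
  by (auto simp: bdd_borel_def intro: measurable_compose[OF _ cnj_measurable])

lemma bdd_borel_sum: "(\<And>i. i \<in> I \<Longrightarrow> bdd_borel (f i)) \<Longrightarrow> bdd_borel (\<lambda>x. \<Sum>i\<in>I. f i x)"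
  by (induction I rule: infinite_finite_induct) (auto intro: bdd_borel_add)

lemma bdd_borel_of_real:
  "f \<in> borel_measurable borel \<Longrightarrow> (\<And>x. \<bar>f x\<bar> \<le> B) \<Longrightarrow> bdd_borel (\<lambda>x. of_real (f x))"
  by (auto simp: bdd_borel_def)

lemma bdd_borel_integrable: "bdd_borel h \<Longrightarrow> integrable torus h"
  by (auto simp: bdd_borel_def intro: integrable_torus)

lemma torus_coeff_add:
  assumes "bdd_borel f" "bdd_borel g"
  shows "torus_coeff (\<lambda>x. f x + g x) k = torus_coeff f k + torus_coeff g k"
  by (simp add: torus_coeff_def distrib_right Bochner_Integration.integral_add torus_coeff_integrand assms scaleR_add_right)

lemma torus_coeff_diff:
  assumes "bdd_borel f" "bdd_borel g"
  shows "torus_coeff (\<lambda>x. f x - g x) k = torus_coeff f k - torus_coeff g k"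
  by (simp add: torus_coeff_def left_diff_distrib Bochner_Integration.integral_diff torus_coeff_integrand assms scaleR_diff_right)

lemma torus_coeff_cmult: "torus_coeff (\<lambda>x. c * f x) k = c * torus_coeff f k"
  by (simp add: torus_coeff_def mult.assoc)

lemma torus_coeff_cnj: "torus_coeff (\<lambda>x. cnj (f x)) k = cnj (torus_coeff f (-k))"
proof -
  have "cnj (f x) * cis (- (of_int k * x)) = cnj (f x * cis (- (of_int (-k) * x)))" for x
    by (simp add: cis_cnj)
  then show ?thesis by (simp add: torus_coeff_def del: complex_cnj_mult)
qed

lemma torus_coeff_of_real_minus: "torus_coeff (\<lambda>x. of_real (f x)) (-k) = cnj (torus_coeff (\<lambda>x. of_real (f x)) k)"
  using torus_coeff_cnj[of "\<lambda>x. of_real (f x)" "-k"] by simp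

lemma torus_coeff_mult_cis:
  "torus_coeff (\<lambda>x. f x * cis (- (of_int k * x))) j = torus_coeff f (j + k)"
  by (simp add: torus_coeff_def mult.assoc cis_mult algebra_simps)

lemma norm_torus_coeff_le_L1:
  assumes "bdd_borel h"
  shows "cmod (torus_coeff h k) \<le> (1 / (2 * pi)) * (LINT x|torus. cmod (h x))"
proof -
  have "cmod (LINT x|torus. h x * cis (- (of_int k * x))) \<le> (LINT x|torus. cmod (h x * cis (- (of_int k * x))))"
    by simp
  then show ?thesis by (simp add: torus_coeff_def norm_mult divide_right_mono)
qed

lemma norm_torus_coeff_le:
  assumes "bdd_borel h" "\<And>x. cmod (h x) \<le> B"
  shows "cmod (torus_coeff h k) \<le> B"
proof -
  have "norm (LINT x|torus. h x * cis (- (of_int k * x))) \<le> 2 * pi * B"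
    by (rule norm_integral_torus_le) (use assms in \<open>auto simp: bdd_borel_def norm_mult\<close>)
  then show ?thesis by (simp add: torus_coeff_def field_simps)
qed

text \<open>
  The square of the distance of \<open>h\<close> to its partial sum \<open>P\<close> over \<open>F\<close> is nonnegative, and \<open>h\<close> and \<open>P\<close>
  have the same pairing with \<open>P\<close>.
\<close>

lemma bessel_finite:
  assumes h: "bdd_borel h" and F: "finite F"
  shows "(\<Sum>k\<in>F. (cmod (torus_coeff h k))\<^sup>2) \<le> (1 / (2 * pi)) * (LINT x|torus. (cmod (h x))\<^sup>2)"
proof -
  define P where "P x = (\<Sum>k\<in>F. torus_coeff h k * cis (of_int k * x))" for x
  have P: "bdd_borel P" unfolding P_def by (intro bdd_borel_sum bdd_borel_mult) auto
  have cP: "torus_coeff P k = (if k \<in> F then torus_coeff h k else 0)" for k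
  proof -
    have "torus_coeff P k = (\<Sum>j\<in>F. torus_coeff (\<lambda>x. torus_coeff h j * cis (of_int j * x)) k)"
      unfolding P_def torus_coeff_def
      by (simp add: sum_distrib_right scaleR_sum_right)
         (subst Bochner_Integration.integral_sum,
          auto intro!: torus_coeff_integrand bdd_borel_mult simp: scaleR_sum_right)
    also have "\<dots> = (\<Sum>j\<in>F. if j = k then torus_coeff h j else 0)"
      by (intro sum.cong) (auto simp: torus_coeff_cmult torus_coeff_cis)
    finally show ?thesis using F by simp
  qed
  \<comment> \<open>pairing any bounded function with the partial sum\<close>
  have pair: "(LINT x|torus. f x * cnj (P x)) = of_real (2 * pi) * (\<Sum>k\<in>F. torus_coeff f k * cnj (torus_coeff h k))"
    if f: "bdd_borel f" for f
  proof -
    have "(LINT x|torus. f x * cnj (P x))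
        = (LINT x|torus. (\<Sum>k\<in>F. cnj (torus_coeff h k) * (f x * cis (- (of_int k * x)))))"
      by (simp add: P_def sum_distrib_left mult_ac cis_cnj)
    also have "\<dots> = (\<Sum>k\<in>F. cnj (torus_coeff h k) * (LINT x|torus. f x * cis (- (of_int k * x))))"
      by (subst Bochner_Integration.integral_sum) (auto intro!: torus_coeff_integrand f)
    also have "\<dots> = of_real (2 * pi) * (\<Sum>k\<in>F. torus_coeff f k * cnj (torus_coeff h k))"
      by (simp add: torus_coeff_def sum_distrib_left mult_ac scaleR_conv_of_real)
    finally show ?thesis .
  qed
  define S where "S = (\<Sum>k\<in>F. (cmod (torus_coeff h k))\<^sup>2)"
  have hP: "(LINT x|torus. h x * cnj (P x)) = of_real (2 * pi * S)"
    by (simp add: pair[OF h] S_def complex_norm_square[symmetric])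
  have PP: "(LINT x|torus. P x * cnj (P x)) = of_real (2 * pi * S)"
  proof -
    have "(\<Sum>k\<in>F. torus_coeff P k * cnj (torus_coeff h k)) = (\<Sum>k\<in>F. of_real ((cmod (torus_coeff h k))\<^sup>2))"
      by (intro sum.cong) (auto simp: cP complex_norm_square[symmetric])
    then show ?thesis unfolding pair[OF P] S_def by simp
  qed
  have "(cmod (h x - P x))\<^sup>2 = (cmod (h x))\<^sup>2 - 2 * Re (h x * cnj (P x)) + Re (P x * cnj (P x))" for x
    by (simp add: cmod_power2) (simp add: algebra_simps power2_eq_square)
  then have "0 \<le> (LINT x|torus. (cmod (h x))\<^sup>2 - 2 * Re (h x * cnj (P x)) + Re (P x * cnj (P x)))"
    by (intro integral_nonneg_AE) (metis (mono_tags, lifting) AE_I2 zero_le_power2)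
  also have "\<dots> = (LINT x|torus. (cmod (h x))\<^sup>2) - 2 * (LINT x|torus. Re (h x * cnj (P x)))
                    + (LINT x|torus. Re (P x * cnj (P x)))"
  proof -
    have "integrable torus (\<lambda>x. (cmod (h x))\<^sup>2)"
      using bdd_borel_integrable[OF bdd_borel_mult[OF h bdd_borel_cnj[OF h]]]
      by (simp only: complex_norm_square[symmetric] complex_of_real_integrable_eq flip: of_real_power)
    moreover have "integrable torus (\<lambda>x. Re (h x * cnj (P x)))" "integrable torus (\<lambda>x. Re (P x * cnj (P x)))"
      by (intro integrable_Re bdd_borel_integrable bdd_borel_mult h P bdd_borel_cnj)+
    ultimately show ?thesis by (simp del: times_complex.sel)
  qed
  also have "\<dots> = (LINT x|torus. (cmod (h x))\<^sup>2) - 2 * pi * S"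
  proof -
    have "(LINT x|torus. Re (h x * cnj (P x))) = 2 * pi * S"
      by (subst integral_Re, intro bdd_borel_integrable bdd_borel_mult h P bdd_borel_cnj)
         (simp only: hP Re_complex_of_real)
    moreover have "(LINT x|torus. Re (P x * cnj (P x))) = 2 * pi * S"
      by (subst integral_Re, intro bdd_borel_integrable bdd_borel_mult h P bdd_borel_cnj)
         (simp only: PP Re_complex_of_real)
    ultimately show ?thesis by simp
  qed
  finally show ?thesis by (simp add: S_def field_simps)
qed

lemma nn_integral_int_le_iff_finite_sums:
  fixes f :: "int \<Rightarrow> ennreal"
  assumes "\<And>F. finite F \<Longrightarrow> (\<Sum>k\<in>F. f k) \<le> C"
  shows "(\<integral>\<^sup>+k. f k \<partial>int_counting) \<le> C"
proof -
  have "(\<integral>\<^sup>+k. f k \<partial>int_counting) = (\<integral>\<^sup>+n. f (int_decode n) \<partial>count_space UNIV)"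
    by (rule nn_integral_bij_count_space[symmetric]) (simp add: bij_int_decode)
  also have "\<dots> = (\<Sum>n. f (int_decode n))"
    by (rule nn_integral_count_space_nat)
  also have "\<dots> \<le> C"
  proof (rule suminf_le_const[OF summableI])
    fix n
    have "(\<Sum>i<n. f (int_decode i)) = sum f (int_decode ` {..<n})"
      by (subst sum.reindex) (auto intro: inj_on_subset[OF inj_int_decode])
    then show "(\<Sum>i<n. f (int_decode i)) \<le> C" using assms by simp
  qed
  finally show ?thesis .
qed

lemma bessel:
  assumes h: "bdd_borel h"
  shows "(\<integral>\<^sup>+k. ennreal ((cmod (torus_coeff h k))\<^sup>2) \<partial>int_counting)
           \<le> ennreal ((1 / (2 * pi)) * (LINT x|torus. (cmod (h x))\<^sup>2))"
  by (rule nn_integral_int_le_iff_finite_sums)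
     (use bessel_finite[OF h] in \<open>auto intro!: ennreal_leI simp: sum_ennreal\<close>)

text \<open>
  Sums over the integers are integrals with respect to the counting measure, which makes Fubini's and
  Tonelli's theorems available.  Splitting them by sign leads back to series over the natural numbers.
\<close>

lemma nn_integral_int_split:
  fixes f :: "int \<Rightarrow> ennreal"
  shows "(\<integral>\<^sup>+k. f k \<partial>int_counting) = f 0 + (\<Sum>n. f (int (Suc n)) + f (- int (Suc n)))"
proof -
  have half: "(\<integral>\<^sup>+k. f k * indicator (range g) k \<partial>int_counting) = (\<Sum>n. f (g n))"
    if "inj g" for g :: "nat \<Rightarrow> int"
    using nn_integral_bij_count_space[of g UNIV "range g" f] that
    by (simp add: nn_integral_count_space_indicator nn_integral_count_space_nat bij_betw_def)
  define p where "p n = int (Suc n)" for n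
  define m where "m n = - int (Suc n)" for n
  have inj: "inj p" "inj m" by (auto simp: inj_def p_def m_def)
  have pr: "k \<in> range p \<longleftrightarrow> k > 0" for k
    by (auto simp: p_def image_iff intro!: exI[of _ "nat (k - 1)"])
  have mr: "k \<in> range m \<longleftrightarrow> k < 0" for k
    by (auto simp: m_def image_iff intro!: exI[of _ "nat (-k - 1)"])
  have "f k = f k * indicator {0} k + f k * indicator (range p) k + f k * indicator (range m) k" for k
    by (cases k "0::int" rule: linorder_cases) (auto simp: indicator_def pr mr)
  then have "(\<integral>\<^sup>+k. f k \<partial>int_counting) = (\<integral>\<^sup>+k. (f k * indicator {0} k + f k * indicator (range p) k) + f k * indicator (range m) k \<partial>int_counting)"
    by (intro nn_integral_cong) simp
  also have "\<dots> = f 0 + (\<Sum>n. f (p n)) + (\<Sum>n. f (m n))"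
    by (simp add: nn_integral_add half inj nn_integral_indicator_singleton')
  also have "\<dots> = f 0 + (\<Sum>n. f (p n) + f (m n))"
    by (simp add: suminf_add[symmetric] add.assoc summableI)
  finally show ?thesis by (simp add: p_def m_def)
qed

lemma
  fixes F :: "int \<Rightarrow> 'a \<Rightarrow> complex"
  assumes M: "sigma_finite_measure M" and F [measurable]: "\<And>k. F k \<in> borel_measurable M"
    and fin: "(\<integral>\<^sup>+k. (\<integral>\<^sup>+x. ennreal (cmod (F k x)) \<partial>M) \<partial>int_counting) < \<infinity>"
  shows integral_int_sum_swap: "(LINT x|M. LINT k|int_counting. F k x) = (LINT k|int_counting. LINT x|M. F k x)"
    and integrable_int_sum_integral: "integrable int_counting (\<lambda>k. LINT x|M. F k x)"
    and integrable_integral_int_sum: "integrable M (\<lambda>x. LINT k|int_counting. F k x)"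
proof -
  interpret M: sigma_finite_measure M by fact
  interpret Z: sigma_finite_measure "int_counting" by (rule sigma_finite_measure_count_space)
  interpret P: pair_sigma_finite "int_counting" M ..
  have meas: "(\<lambda>(k, x). F k x) \<in> borel_measurable (int_counting \<Otimes>\<^sub>M M)"
    by (rule measurable_pair_measure_countable1) auto
  have int: "integrable (int_counting \<Otimes>\<^sub>M M) (\<lambda>(k, x). F k x)"
  proof (rule integrableI_bounded[OF meas])
    have "(\<integral>\<^sup>+p. ennreal (norm (case p of (k, x) \<Rightarrow> F k x)) \<partial>(int_counting \<Otimes>\<^sub>M M))
            = (\<integral>\<^sup>+k. \<integral>\<^sup>+x. ennreal (cmod (F k x)) \<partial>M \<partial>int_counting)"
      by (subst M.nn_integral_fst[symmetric]) (use meas in \<open>auto simp: case_prod_beta'\<close>)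
    then show "(\<integral>\<^sup>+p. ennreal (norm (case p of (k, x) \<Rightarrow> F k x)) \<partial>(int_counting \<Otimes>\<^sub>M M)) < \<infinity>"
      using fin by simp
  qed
  show "(LINT x|M. LINT k|int_counting. F k x) = (LINT k|int_counting. LINT x|M. F k x)"
    by (rule P.Fubini_integral[OF int])
  show "integrable int_counting (\<lambda>k. LINT x|M. F k x)"
    using P.integrable_fst[OF int] .
  show "integrable M (\<lambda>x. LINT k|int_counting. F k x)"
    using P.integrable_snd[OF int] .
qed

lemma integrable_int_summable:
  fixes c :: "int \<Rightarrow> 'b :: {banach, second_countable_topology}"
  assumes "integrable int_counting c"
  shows "infsum c UNIV = (LINT k|int_counting. c k)"
  using infsetsum_infsum[of c UNIV] assms
  by (simp add: Infinite_Set_Sum.abs_summable_on_def infsetsum_def)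

text \<open>
  The sum and the integral may be interchanged because the series converges absolutely, uniformly in \<open>x\<close>.
\<close>

lemma
  assumes c: "integrable int_counting c" and h: "bdd_borel h"
  shows series_pairing:
      "(LINT x|torus. (LINT k|int_counting. c k * cis (of_int k * x)) * h x)
         = 2 * pi * (LINT k|int_counting. c k * torus_coeff h (- k))"
    and series_pairing_integrable: "integrable int_counting (\<lambda>k. c k * torus_coeff h (- k))"
    and series_mult_integrable:
      "integrable torus (\<lambda>x. (LINT k|int_counting. c k * cis (of_int k * x)) * h x)"
proof -
  obtain B where B: "\<And>x. cmod (h x) \<le> B" using h by (auto simp: bdd_borel_def)
  have [measurable]: "h \<in> borel_measurable borel" using h by (simp add: bdd_borel_def)
  define F where "F k x = c k * cis (of_int k * x) * h x" for k x
  have Fm [measurable]: "F k \<in> borel_measurable torus" for k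
    unfolding F_def by (rule borel_measurable_torus) measurable
  have "B \<ge> 0" using B[of 0] norm_ge_zero order_trans by blast
  have "(\<integral>\<^sup>+k. (\<integral>\<^sup>+x. ennreal (cmod (F k x)) \<partial>torus) \<partial>int_counting)
          \<le> (\<integral>\<^sup>+k. (\<integral>\<^sup>+x. ennreal (cmod (c k)) * ennreal B \<partial>torus) \<partial>int_counting)"
    using B by (intro nn_integral_mono) (auto simp: F_def norm_mult ennreal_mult[symmetric] \<open>B \<ge> 0\<close> intro!: ennreal_leI mult_left_mono)
  also have "\<dots> = (\<integral>\<^sup>+k. ennreal (cmod (c k)) \<partial>int_counting) * (ennreal B * ennreal (2 * pi))"
    using emeasure_torus by (simp add: nn_integral_multc mult.assoc)
  also have "\<dots> < \<infinity>"
    using c unfolding integrable_iff_bounded by (auto simp: ennreal_mult_less_top)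
  finally have fin: "(\<integral>\<^sup>+k. (\<integral>\<^sup>+x. ennreal (cmod (F k x)) \<partial>torus) \<partial>int_counting) < \<infinity>" .
  have *: "(LINT x|torus. F k x) = 2 * pi * (c k * torus_coeff h (- k))" for k
  proof -
    have "(LINT x|torus. F k x) = (LINT x|torus. c k * (h x * cis (- (of_int (-k) * x))))"
      by (simp add: F_def mult_ac)
    then show ?thesis by (simp add: torus_coeff_def scaleR_conv_of_real)
  qed
  note sw = integral_int_sum_swap[OF torus.sigma_finite_measure_axioms Fm fin]
     integrable_int_sum_integral[OF torus.sigma_finite_measure_axioms Fm fin]
  show "integrable torus (\<lambda>x. (LINT k|int_counting. c k * cis (of_int k * x)) * h x)"
    using integrable_integral_int_sum[OF torus.sigma_finite_measure_axioms Fm fin] by (simp add: F_def)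
  show "integrable int_counting (\<lambda>k. c k * torus_coeff h (- k))"
    using integrable_mult_right[OF sw(2), of "1 / complex_of_real (2 * pi)"] unfolding * by simp
  show "(LINT x|torus. (LINT k|int_counting. c k * cis (of_int k * x)) * h x)
         = 2 * pi * (LINT k|int_counting. c k * torus_coeff h (- k))"
    using sw(1) unfolding * by (simp add: F_def)
qed

section \<open>The linear semigroup\<close>

lemma power_over_fact_le_exp:
  fixes x :: real
  assumes "x \<ge> 0"
  shows "x ^ n / fact n \<le> exp x"
proof -
  have "(\<Sum>i\<in>{n}. inverse (fact i) *\<^sub>R x ^ i) \<le> (\<Sum>i. inverse (fact i) *\<^sub>R x ^ i)"
    by (rule sum_le_suminf) (use assms summable_exp_generic[of x] in auto)
  then show ?thesis by (simp add: exp_def field_simps)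
qed

text \<open>
  The term of order \<open>n\<close> of the exponential series, with \<open>n \<gamma> \<ge> p\<close>, already dominates the power.
\<close>

lemma exp_powr_decay:
  assumes "\<tau> > 0" "\<gamma> > 0" "p \<ge> 0"
  shows "\<exists>C>0. \<forall>k::int. exp (- (\<tau> * \<bar>real_of_int k\<bar> powr \<gamma>)) \<le> C * \<langle>k\<rangle> powr (- p)"
proof -
  obtain n :: nat where "p / \<gamma> \<le> real n" using real_arch_simple by blast
  then have n: "p \<le> \<gamma> * real n" using assms by (simp add: field_simps)
  define C where "C = max 1 (fact n / \<tau> ^ n * 2 powr p)"
  have "exp (- (\<tau> * \<bar>real_of_int k\<bar> powr \<gamma>)) \<le> C * \<langle>k\<rangle> powr (- p)" for k :: int
  proof (cases "k = 0")
    case True then show ?thesis by (simp add: C_def)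
  next
    case False
    define x where "x = \<bar>real_of_int k\<bar>"
    have x1: "x \<ge> 1" using False unfolding x_def by linarith
    have "(\<tau> * x powr \<gamma>) ^ n / fact n \<le> exp (\<tau> * x powr \<gamma>)"
      by (rule power_over_fact_le_exp) (use assms in simp)
    then have "exp (- (\<tau> * x powr \<gamma>)) \<le> fact n / (\<tau> * x powr \<gamma>) ^ n"
      using assms x1 by (simp add: exp_minus field_simps)
    also have "\<dots> = fact n / \<tau> ^ n * x powr (- (\<gamma> * real n))"
      using assms x1 by (simp add: power_mult_distrib powr_power powr_minus field_simps)
    also have "\<dots> \<le> fact n / \<tau> ^ n * x powr (- p)"
      using n x1 assms by (intro mult_left_mono powr_mono) auto
    also have "\<dots> \<le> fact n / \<tau> ^ n * ((1 + x) / 2) powr (- p)"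
      using x1 assms by (intro mult_left_mono powr_mono2') auto
    also have "((1 + x) / 2) powr (- p) = 2 powr p * (1 + x) powr (- p)"
      using x1 by (simp add: powr_divide powr_minus field_simps)
    finally have "exp (- (\<tau> * x powr \<gamma>)) \<le> fact n / \<tau> ^ n * 2 powr p * (1 + x) powr (- p)"
      using assms by (simp add: mult.assoc)
    also have "\<dots> \<le> C * (1 + x) powr (- p)"
      unfolding C_def by (intro mult_right_mono) auto
    finally show ?thesis by (simp add: x_def)
  qed
  moreover have "C > 0" by (simp add: C_def)
  ultimately show ?thesis by blast
qed

lemma nn_integral_int_powr_finite:
  assumes "\<sigma> > 1"
  shows "(\<integral>\<^sup>+k. ennreal (\<langle>k\<rangle> powr (- \<sigma>)) \<partial>int_counting) < \<infinity>"
proof -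
  have "summable (\<lambda>n. real (n + 2) powr (- \<sigma>))"
    using summable_ignore_initial_segment[of "\<lambda>n. real n powr (- \<sigma>)" 2] assms
    by (simp add: summable_real_powr_iff)
  then have s: "summable (\<lambda>n. 2 * real (n + 2) powr (- \<sigma>))" by (rule summable_mult)
  have "(\<integral>\<^sup>+k. ennreal (\<langle>k\<rangle> powr (- \<sigma>)) \<partial>int_counting)
          = 1 + (\<Sum>n. ennreal (2 * real (n + 2) powr (- \<sigma>)))"
    by (subst nn_integral_int_split) (simp add: add_ac flip: ennreal_plus)
  also have "\<dots> = 1 + ennreal (\<Sum>n. 2 * real (n + 2) powr (- \<sigma>))"
    by (subst suminf_ennreal2[OF _ s]) auto
  also have "\<dots> < \<infinity>" by simp
  finally show ?thesis .
qed

lemma integrable_int_powr: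
  assumes "\<sigma> > 1"
  shows "integrable int_counting (\<lambda>k. \<langle>k\<rangle> powr (- \<sigma>))"
  using nn_integral_int_powr_finite[OF assms] by (intro integrableI_bounded) auto

lemma integrable_int_bound:
  fixes f :: "int \<Rightarrow> 'b :: {banach, second_countable_topology}"
  assumes "\<sigma> > 1" "\<And>k. norm (f k) \<le> C * \<langle>k\<rangle> powr (- \<sigma>)"
  shows "integrable int_counting f"
  by (rule Bochner_Integration.integrable_bound[OF integrable_mult_right[OF integrable_int_powr[OF assms(1)], of C]])
     (use assms(2) in \<open>auto intro: order_trans[OF _ abs_ge_self]\<close>)

definition heat_symbol :: "real \<Rightarrow> real \<Rightarrow> real \<Rightarrow> int \<Rightarrow> real" where
  "heat_symbol \<nu> \<gamma> \<tau> k = exp (- \<tau> * (\<nu> * frac_laplacian_symbol \<gamma> k))"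

lemma heat_symbol_pos: "heat_symbol \<nu> \<gamma> \<tau> k > 0"
  by (simp add: heat_symbol_def)

lemma heat_symbol_minus [simp]: "heat_symbol \<nu> \<gamma> \<tau> (- k) = heat_symbol \<nu> \<gamma> \<tau> k"
  by (simp add: heat_symbol_def frac_laplacian_symbol_def)

lemma heat_symbol_le_1:
  assumes "\<nu> \<ge> 0" "\<tau> \<ge> 0" shows "heat_symbol \<nu> \<gamma> \<tau> k \<le> 1"
  using assms by (simp add: heat_symbol_def frac_laplacian_symbol_def)

lemma integrable_heat_symbol:
  assumes "\<nu> > 0" "\<tau> > 0" "\<gamma> > 0" and c: "\<And>k. cmod (c k) \<le> B"
  shows "integrable int_counting (\<lambda>k. of_real (heat_symbol \<nu> \<gamma> \<tau> k) * c k)"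
proof -
  obtain C where C: "\<And>k::int. exp (- (\<tau> * \<nu> * \<bar>real_of_int k\<bar> powr \<gamma>)) \<le> C * \<langle>k\<rangle> powr (- 2)"
    using exp_powr_decay[of "\<tau> * \<nu>" \<gamma> 2] assms by auto
  have "B \<ge> 0" using c[of 0] norm_ge_zero order_trans by blast
  have "cmod (of_real (heat_symbol \<nu> \<gamma> \<tau> k) * c k) \<le> (C * B) * \<langle>k\<rangle> powr (- 2)" for k
  proof -
    have "heat_symbol \<nu> \<gamma> \<tau> k * cmod (c k) \<le> (C * \<langle>k\<rangle> powr (- 2)) * B"
      using C[of k] by (intro mult_mono c) (auto simp: heat_symbol_def frac_laplacian_symbol_def mult.assoc intro: order_trans[OF _ C[of k]])
    then show ?thesis by (simp add: norm_mult heat_symbol_pos[THEN less_imp_le] mult_ac)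
  qed
  then show ?thesis by (intro integrable_int_bound[of 2]) auto
qed

lemma fourier_coeff_minus: "fourier_coeff f (- k) = cnj (fourier_coeff f k)"
proof -
  have "complex_of_real (f x) * cis (- (of_int (- k) * x)) = cnj (of_real (f x) * cis (- (of_int k * x)))" for x
    by (simp add: cis_cnj)
  then show ?thesis by (simp add: fourier_coeff_def del: complex_cnj_mult)
qed

lemma norm_fourier_coeff_le:
  assumes "\<And>x. \<bar>f x\<bar> \<le> B"
  shows "cmod (fourier_coeff f k) \<le> B"
proof -
  have "cmod (LINT x|lebesgue_on {-pi..pi}. of_real (f x) * cis (- (of_int k * x)))
          \<le> (LINT x|lebesgue_on {-pi..pi}. cmod (of_real (f x) * cis (- (of_int k * x))))"
    by simp
  also have "\<dots> \<le> (LINT x|lebesgue_on {-pi..pi}. B)"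
    by (rule integral_mono') (use assms order_trans[OF abs_ge_zero assms[of 0]] in \<open>auto simp: norm_mult lmeasurable_cbox intro!: integrable_const_ivl\<close>)
  also have "\<dots> = 2 * pi * B"
    by (simp add: measure_restrict_space)
  finally show ?thesis by (simp add: fourier_coeff_def field_simps)
qed

text \<open>
  The series is real because the symbol is even and the coefficients of a real function are conjugate
  under \<open>k \<mapsto> - k\<close>; so the real part in the definition of \<open>fourier_mult\<close> loses nothing.
\<close>

lemma frac_heat_eq_integral:
  assumes "\<nu> > 0" "\<tau> > 0" "\<gamma> > 0" and f: "\<And>x. \<bar>f x\<bar> \<le> B"
  shows "of_real (frac_heat \<nu> \<gamma> \<tau> f x)
          = (LINT k|int_counting. of_real (heat_symbol \<nu> \<gamma> \<tau> k) * fourier_coeff f k * cis (of_int k * x))"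
proof -
  define F where "F k = of_real (heat_symbol \<nu> \<gamma> \<tau> k) * fourier_coeff f k * cis (of_int k * x)" for k
  have int: "integrable int_counting F"
    using integrable_heat_symbol[OF assms(1-3), of "\<lambda>k. fourier_coeff f k * cis (of_int k * x)" B]
    by (simp add: F_def[abs_def] norm_mult norm_fourier_coeff_le[OF f] mult.assoc)
  have "(LINT k|int_counting. F k) = (LINT k|int_counting. F (- k))"
    using integral_bij_count_space[of uminus UNIV UNIV F] by (simp add: bij_uminus)
  also have "\<dots> = cnj (LINT k|int_counting. F k)"
    by (subst Bochner_Integration.integral_cnj[symmetric]) (simp add: F_def fourier_coeff_minus cis_cnj)
  finally have "of_real (Re (LINT k|int_counting. F k)) = (LINT k|int_counting. F k)"
    by (metis Reals_cnj_iff complex_is_Real_iff of_real_Re)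
  moreover have "frac_heat \<nu> \<gamma> \<tau> f x = Re (infsum F UNIV)"
    by (simp add: frac_heat_def fourier_mult_def F_def[abs_def] heat_symbol_def)
  ultimately show ?thesis
    by (simp add: integrable_int_summable[OF int] F_def)
qed

section \<open>Mild solutions on the Fourier side\<close>

lemma ident_torus_measurable: "(\<lambda>x. x) \<in> measurable torus borel"
  by (rule borel_measurable_torus) simp

lemma torus_coeff_parametric_measurable:
  assumes [measurable]: "(\<lambda>(s, x). F s x) \<in> borel_measurable (borel \<Otimes>\<^sub>M borel)"
  shows "(\<lambda>s. torus_coeff (\<lambda>x. complex_of_real (F s x)) k) \<in> borel_measurable borel"
proof -
  have [measurable]: "(\<lambda>p. (fst p, snd p)) \<in> measurable (borel \<Otimes>\<^sub>M torus) (borel \<Otimes>\<^sub>M borel)"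
    by (intro measurable_Pair measurable_fst measurable_compose[OF measurable_snd ident_torus_measurable])
  have "(\<lambda>p. case (fst p, snd p) of (s, x) \<Rightarrow> F s x) \<in> borel_measurable (borel \<Otimes>\<^sub>M torus)"
    by measurable
  moreover have [measurable]: "snd \<in> measurable (borel \<Otimes>\<^sub>M torus) borel"
    by (rule measurable_compose[OF measurable_snd ident_torus_measurable])
  ultimately have "(\<lambda>(s, x). of_real (F s x) * cis (- (of_int k * x))) \<in> borel_measurable (borel \<Otimes>\<^sub>M torus)"
    by (simp add: case_prod_beta')
  then show ?thesis
    unfolding torus_coeff_def by (intro borel_measurable_scaleR borel_measurable_const torus.borel_measurable_lebesgue_integral)
qed

lemma mult_le_half_squares: "x * y \<le> (x\<^sup>2 + y\<^sup>2) / (2::real)"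
  using sum_squares_bound[of x y] by simp

text \<open>
  The arithmetic-geometric inequality and Bessel's inequality.  The multiplier \<open>c\<close> stands for the
  heat symbol, and the bound does not depend on it: it is uniform down to elapsed time \<open>0\<close>, where the
  series of the semigroup need not converge.
\<close>

lemma sum_coeff_products_le:
  assumes f: "bdd_borel f" "\<And>x. cmod (f x) \<le> A" and h: "bdd_borel h" "\<And>x. cmod (h x) \<le> B"
    and c: "\<And>k. 0 \<le> c k" "\<And>k. c k \<le> 1"
  shows "(\<integral>\<^sup>+k. ennreal (c k * cmod (torus_coeff f k) * cmod (torus_coeff h (- k))) \<partial>int_counting) \<le> ennreal ((A\<^sup>2 + B\<^sup>2) / 2)"
proof -
  have sq: "(\<integral>\<^sup>+k. ennreal ((cmod (torus_coeff f k))\<^sup>2) \<partial>int_counting) \<le> ennreal (A\<^sup>2)"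
    if f: "bdd_borel f" "\<And>x. cmod (f x) \<le> A" for f A
  proof -
    have [measurable]: "f \<in> borel_measurable borel" using f by (simp add: bdd_borel_def)
    have "(LINT x|torus. (cmod (f x))\<^sup>2) \<le> 2 * pi * A\<^sup>2"
      using norm_integral_torus_le[of "\<lambda>x. (cmod (f x))\<^sup>2" "A\<^sup>2"]
      by (simp add: power_mono[OF f(2) norm_ge_zero])
    then show ?thesis
      by (intro order_trans[OF bessel[OF f(1)]] ennreal_leI) (simp add: field_simps)
  qed
  have half: "ennreal (1/2) * ennreal (z\<^sup>2) = ennreal (z\<^sup>2 / 2)" for z :: real
      by (subst ennreal_mult[symmetric]) auto
  have bij: "(\<integral>\<^sup>+k. ennreal ((cmod (torus_coeff h (- k)))\<^sup>2) \<partial>int_counting) = (\<integral>\<^sup>+k. ennreal ((cmod (torus_coeff h k))\<^sup>2) \<partial>int_counting)"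
    using nn_integral_bij_count_space[of uminus UNIV UNIV "\<lambda>k. ennreal ((cmod (torus_coeff h k))\<^sup>2)"] by (simp add: bij_uminus)
  have "c k * cmod (torus_coeff f k) * cmod (torus_coeff h (- k)) \<le> ((cmod (torus_coeff f k))\<^sup>2 + (cmod (torus_coeff h (- k)))\<^sup>2) / 2" for k
  proof -
    have "c k * (cmod (torus_coeff f k) * cmod (torus_coeff h (- k))) \<le> 1 * (cmod (torus_coeff f k) * cmod (torus_coeff h (- k)))"
      by (intro mult_right_mono c) auto
    then show ?thesis using mult_le_half_squares[of "cmod (torus_coeff f k)" "cmod (torus_coeff h (- k))"] by (simp add: mult.assoc)
  qed
  then have "(\<integral>\<^sup>+k. ennreal (c k * cmod (torus_coeff f k) * cmod (torus_coeff h (- k))) \<partial>int_counting)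
     \<le> (\<integral>\<^sup>+k. ennreal (1/2) * ennreal ((cmod (torus_coeff f k))\<^sup>2) + ennreal (1/2) * ennreal ((cmod (torus_coeff h (- k)))\<^sup>2) \<partial>int_counting)"
  proof (intro nn_integral_mono)
    fix k :: int
    assume le: "\<And>k. c k * cmod (torus_coeff f k) * cmod (torus_coeff h (- k)) \<le> ((cmod (torus_coeff f k))\<^sup>2 + (cmod (torus_coeff h (- k)))\<^sup>2) / 2"
    show "ennreal (c k * cmod (torus_coeff f k) * cmod (torus_coeff h (- k)))
        \<le> ennreal (1/2) * ennreal ((cmod (torus_coeff f k))\<^sup>2) + ennreal (1/2) * ennreal ((cmod (torus_coeff h (- k)))\<^sup>2)"
      unfolding half using le[of k]
      by (subst ennreal_plus[symmetric]) (auto intro!: ennreal_leI simp: add_divide_distrib simp del: ennreal_plus)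
  qed
  also have "\<dots> \<le> ennreal (1/2) * ennreal (A\<^sup>2) + ennreal (1/2) * ennreal (B\<^sup>2)"
    by (simp add: nn_integral_add nn_integral_cmult bij) (intro add_mono mult_left_mono sq f h; simp)
  also have "\<dots> = ennreal ((A\<^sup>2 + B\<^sup>2) / 2)"
    unfolding half by (simp add: add_divide_distrib flip: ennreal_plus)
  finally show ?thesis .
qed

definition time_interval :: "real \<Rightarrow> real measure" where
  "time_interval t = restrict_space lborel {0<..<t}"

lemma space_time_interval [simp]: "space (time_interval t) = {0<..<t}"
  by (simp add: time_interval_def)

lemma finite_measure_time_interval: "finite_measure (time_interval t)"
proof (rule finite_measureI)
  have "emeasure (time_interval t) (space (time_interval t)) = ennreal (max 0 t)"
    by (cases "0 \<le> t") (auto simp: time_interval_def emeasure_restrict_space)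
  then show "emeasure (time_interval t) (space (time_interval t)) \<noteq> \<infinity>" by simp
qed

lemma measure_time_interval [simp]: "t \<ge> 0 \<Longrightarrow> measure (time_interval t) {0<..<t} = t"
  by (simp add: time_interval_def measure_restrict_space)

lemma borel_measurable_time_interval [measurable (raw)]:
  "f \<in> borel_measurable borel \<Longrightarrow> f \<in> borel_measurable (time_interval t)"
  by (simp add: time_interval_def measurable_restrict_space1)

locale bounded_mild =
  fixes \<kappa> \<gamma> :: real and u0 :: "real \<Rightarrow> real" and u :: "real \<Rightarrow> real \<Rightarrow> real"
  assumes \<kappa>_ge_1: "\<kappa> \<ge> 1" and \<gamma>_pos: "0 < \<gamma>" and \<gamma>_le_2: "\<gamma> \<le> 2"
    and u0_odd: "\<And>x. u0 (- x) = - u0 x"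
    and mild: "bounded_mild_solution \<kappa> \<gamma> u0 u"
begin

text \<open>
  Any bound for the solution serves; choosing one makes it a constant of the locale.
\<close>

definition sup_u :: real where
  "sup_u = (SOME M. \<forall>t\<ge>0. \<forall>x. \<bar>u t x\<bar> \<le> M)"

lemma u_le: "t \<ge> 0 \<Longrightarrow> \<bar>u t x\<bar> \<le> sup_u"
proof -
  have "\<exists>M. \<forall>t\<ge>0. \<forall>x. \<bar>u t x\<bar> \<le> M"
    using mild by (simp add: bounded_mild_solution_def)
  from someI_ex[OF this] show "t \<ge> 0 \<Longrightarrow> \<bar>u t x\<bar> \<le> sup_u"
    by (simp add: sup_u_def)
qed

lemma sup_u_nonneg: "sup_u \<ge> 0"
  using u_le[of 0 0] by simp

abbreviation \<nu> :: real where "\<nu> \<equiv> \<kappa>\<^sup>2"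

lemma \<nu>_ge_1: "\<nu> \<ge> 1" using \<kappa>_ge_1 by simp

lemma \<nu>_pos: "\<nu> > 0" using \<nu>_ge_1 by linarith

text \<open>
  The source term of the Duhamel formula, extended by \<open>0\<close> to nonpositive times so that it is Borel on
  the whole plane.
\<close>

definition g :: "real \<Rightarrow> real \<Rightarrow> real" where
  "g s x = (if s > 0 then u s x - (u s x) ^ 3 else 0)"

definition sup_g :: real where "sup_g = sup_u + sup_u ^ 3"

lemma g_le: "\<bar>g s x\<bar> \<le> sup_g"
proof (cases "s > 0")
  case True
  then have "\<bar>u s x\<bar> \<le> sup_u" "\<bar>u s x\<bar> ^ 3 \<le> sup_u ^ 3"
    using u_le[of s x] by (auto intro: power_mono)
  then show ?thesis using True by (simp add: g_def sup_g_def power_abs[symmetric])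
next
  case False
  then show ?thesis using sup_u_nonneg by (simp add: g_def sup_g_def)
qed

lemma u_pair_measurable [measurable]:
  "(\<lambda>(s, x). if s > 0 then u s x else 0) \<in> borel_measurable (borel \<Otimes>\<^sub>M borel)"
proof -
  have "(\<lambda>(t, x). u t x) \<in> borel_measurable (restrict_space borel ({0<..} \<times> UNIV))"
    using mild by (simp add: bounded_mild_solution_def)
  then have "(\<lambda>p. (case p of (t, x) \<Rightarrow> u t x) * indicator ({0<..} \<times> UNIV) p) \<in> borel_measurable borel"
    by (subst (asm) borel_measurable_restrict_space_iff) (auto intro!: borel_Times simp: mult.commute)
  moreover have "(\<lambda>p. (case p of (t, x) \<Rightarrow> u t x) * indicator ({0<..} \<times> UNIV) p)
      = (\<lambda>(s, x). if s > 0 then u s x else 0)"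
    by (auto simp: fun_eq_iff indicator_def)
  ultimately show ?thesis by (simp add: borel_prod)
qed

lemma g_pair_measurable [measurable]: "(\<lambda>(s, x). g s x) \<in> borel_measurable (borel \<Otimes>\<^sub>M borel)"
proof -
  have "(\<lambda>(s, x). g s x) = (\<lambda>p. (case p of (s, x) \<Rightarrow> if s > 0 then u s x else 0)
            - (case p of (s, x) \<Rightarrow> if s > 0 then u s x else 0) ^ 3)"
    by (auto simp: fun_eq_iff g_def)
  also have "\<dots> \<in> borel_measurable (borel \<Otimes>\<^sub>M borel)" by measurable
  finally show ?thesis .
qed

lemma g_measurable [measurable]: "g s \<in> borel_measurable borel"
  using measurable_compose[OF measurable_Pair1'[of s borel borel] g_pair_measurable] by simp

lemma u_measurable: 
  assumes "s > 0" shows "u s \<in> borel_measurable borel"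
  using measurable_compose[OF measurable_Pair1'[of s borel borel] u_pair_measurable] assms by simp

text \<open>
  In all that follows \<open>a\<close>, \<open>q\<close> and \<open>d\<close> are the Fourier coefficients of \<open>u\<close>, \<open>u - u\<^sup>3\<close> and \<open>u\<^sup>3\<close>.
\<close>

definition a :: "real \<Rightarrow> int \<Rightarrow> complex" where
  "a t k = torus_coeff (\<lambda>x. of_real (u t x)) k"

definition q :: "real \<Rightarrow> int \<Rightarrow> complex" where
  "q s k = torus_coeff (\<lambda>x. of_real (g s x)) k"

lemma bdd_borel_u: "t > 0 \<Longrightarrow> bdd_borel (\<lambda>x. of_real (u t x))"
  by (rule bdd_borel_of_real[where B = sup_u]) (auto simp: u_measurable u_le)

lemma bdd_borel_g: "bdd_borel (\<lambda>x. of_real (g t x))"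
  by (rule bdd_borel_of_real[where B = sup_g]) (auto simp: g_le)

lemma norm_q_le: "cmod (q s k) \<le> sup_g"
  unfolding q_def by (rule norm_torus_coeff_le[OF bdd_borel_g]) (simp add: g_le)

lemma norm_a_le: "t > 0 \<Longrightarrow> cmod (a t k) \<le> sup_u"
  unfolding a_def by (rule norm_torus_coeff_le[OF bdd_borel_u]) (auto simp: u_le)

lemma fourier_coeff_g: "fourier_coeff (g s) k = q s k"
  by (simp add: q_def fourier_coeff_eq_torus_coeff)

lemma q_measurable [measurable]: "(\<lambda>s. q s k) \<in> borel_measurable borel"
  unfolding q_def by (rule torus_coeff_parametric_measurable) (rule g_pair_measurable)

text \<open>
  The integrand of Duhamel's formula at time \<open>s\<close> and elapsed time \<open>\<tau>\<close>, with complex values so that it can be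
  paired with complex functions.
\<close>

definition propagated :: "real \<Rightarrow> real \<Rightarrow> real \<Rightarrow> complex" where
  "propagated \<tau> s x = (LINT k|int_counting. of_real (heat_symbol \<nu> \<gamma> \<tau> k) * q s k * cis (of_int k * x))"

lemma heat_symbol_measurable [measurable]: "(\<lambda>\<tau>. heat_symbol \<nu> \<gamma> \<tau> k) \<in> borel_measurable borel"
  unfolding heat_symbol_def by measurable

lemma propagated_pair_measurable [measurable]:
  "(\<lambda>(s, x). propagated (t - s) s x) \<in> borel_measurable (borel \<Otimes>\<^sub>M borel)"
proof -
  interpret Z: sigma_finite_measure int_counting by (rule sigma_finite_measure_count_space)
  have "(\<lambda>p. (\<lambda>k p. of_real (heat_symbol \<nu> \<gamma> (t - fst (fst p)) k) * q (fst (fst p)) k * cis (of_int k * snd (fst p))) (snd p) p)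
         \<in> borel_measurable ((borel \<Otimes>\<^sub>M borel) \<Otimes>\<^sub>M int_counting)"
    by (rule measurable_compose_countable) measurable
  then have "(\<lambda>p. LINT k|int_counting. of_real (heat_symbol \<nu> \<gamma> (t - fst p) k) * q (fst p) k * cis (of_int k * snd p))
         \<in> borel_measurable (borel \<Otimes>\<^sub>M borel)"
    by (intro Z.borel_measurable_lebesgue_integral) (simp add: case_prod_beta')
  then show ?thesis by (simp add: propagated_def case_prod_beta')
qed

lemma propagated_measurable [measurable]:
  "propagated \<tau> s \<in> borel_measurable borel"
  using measurable_compose[OF measurable_Pair1'[of s borel borel] propagated_pair_measurable[of "\<tau> + s"]] by simp

lemma of_real_frac_heat_g:
  assumes "s < t"
  shows "of_real (frac_heat \<nu> \<gamma> (t - s) (g s) x) = propagated (t - s) s x"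
  unfolding propagated_def
  using frac_heat_eq_integral[of \<nu> "t - s" \<gamma> "g s" sup_g x] \<nu>_pos \<gamma>_pos assms g_le
  by (simp add: fourier_coeff_g)

lemma integrable_heat_symbol_q:
  "\<tau> > 0 \<Longrightarrow> integrable int_counting (\<lambda>k. of_real (heat_symbol \<nu> \<gamma> \<tau> k) * q s k)"
  by (rule integrable_heat_symbol[OF \<nu>_pos _ \<gamma>_pos norm_q_le])

text \<open>
  The \<open>L\<^sup>1\<close> norm is a pairing with a bounded function, to which Bessel's inequality applies.  The bound is
  uniform in \<open>\<tau>\<close>, which makes Fubini's theorem available in Duhamel's formula.
\<close>

lemma propagated_L1_bound:
  assumes "\<tau> > 0" and h: "bdd_borel h" "\<And>x. cmod (h x) \<le> B"
  shows "(LINT x|torus. cmod (propagated \<tau> s x * h x)) \<le> 2 * pi * ((sup_g\<^sup>2 + B\<^sup>2) / 2)"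
proof -
  \<comment> \<open>multiplying by a unimodular factor turns the absolute value into a pairing\<close>
  define w where "w x = cnj (sgn (propagated \<tau> s x * h x))" for x
  have [measurable]: "h \<in> borel_measurable borel" using h by (simp add: bdd_borel_def)
  have wm: "w \<in> borel_measurable borel" unfolding w_def sgn_div_norm by measurable
  have w1: "cmod (w x) \<le> 1" for x by (simp add: w_def norm_sgn)
  have w: "bdd_borel w" using wm w1 by (auto simp: bdd_borel_def)
  have hw: "bdd_borel (\<lambda>x. h x * w x)" by (rule bdd_borel_mult[OF h(1) w])
  have hwB: "cmod (h x * w x) \<le> B" for x
    using mult_mono[OF h(2)[of x] w1[of x]] order_trans[OF norm_ge_zero h(2)[of x]] by (simp add: norm_mult)
  have z: "z * cnj (sgn z) = of_real (cmod z)" for z :: complex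
  proof (cases "z = 0")
    case False
    have "z * cnj (sgn z) = z * cnj z / of_real (cmod z)" by (simp add: sgn_eq)
    also have "\<dots> = of_real (cmod z)" using False
      by (simp add: complex_norm_square[symmetric] power2_eq_square)
    finally show ?thesis .
  qed simp
  have pw: "of_real (cmod (propagated \<tau> s x * h x)) = propagated \<tau> s x * (h x * w x)" for x
    using z[of "propagated \<tau> s x * h x"] by (simp add: w_def mult.assoc)
  have "of_real (LINT x|torus. cmod (propagated \<tau> s x * h x))
      = (LINT x|torus. complex_of_real (cmod (propagated \<tau> s x * h x)))" by simp
  also have "\<dots> = (LINT x|torus. propagated \<tau> s x * (h x * w x))" unfolding pw ..
  also have "\<dots> = 2 * pi * (LINT k|int_counting. (of_real (heat_symbol \<nu> \<gamma> \<tau> k) * q s k) * torus_coeff (\<lambda>x. h x * w x) (- k))"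
    using series_pairing[OF integrable_heat_symbol_q[OF assms(1)] hw, of s] by (simp add: propagated_def)
  finally have eq: "complex_of_real (LINT x|torus. cmod (propagated \<tau> s x * h x)) = \<dots>" .
  have int: "integrable int_counting (\<lambda>k. (of_real (heat_symbol \<nu> \<gamma> \<tau> k) * q s k) * torus_coeff (\<lambda>x. h x * w x) (- k))"
    by (rule series_pairing_integrable[OF integrable_heat_symbol_q[OF assms(1)] hw])
  have "ennreal (cmod (LINT k|int_counting. (of_real (heat_symbol \<nu> \<gamma> \<tau> k) * q s k) * torus_coeff (\<lambda>x. h x * w x) (- k)))
     \<le> (\<integral>\<^sup>+k. ennreal (heat_symbol \<nu> \<gamma> \<tau> k * cmod (torus_coeff (\<lambda>x. of_real (g s x)) k) * cmod (torus_coeff (\<lambda>x. h x * w x) (- k))) \<partial>int_counting)"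
    by (rule order_trans[OF integral_norm_bound_ennreal[OF int]])
       (simp add: norm_mult heat_symbol_pos[THEN less_imp_le] q_def)
  also have "\<dots> \<le> ennreal ((sup_g\<^sup>2 + B\<^sup>2) / 2)"
    by (rule sum_coeff_products_le[OF bdd_borel_g _ hw])
       (use hwB g_le \<nu>_pos assms in \<open>auto simp: heat_symbol_pos[THEN less_imp_le] intro!: heat_symbol_le_1\<close>)
  finally have "cmod (LINT k|int_counting. (of_real (heat_symbol \<nu> \<gamma> \<tau> k) * q s k) * torus_coeff (\<lambda>x. h x * w x) (- k)) \<le> (sup_g\<^sup>2 + B\<^sup>2) / 2"
    by (subst (asm) ennreal_le_iff) auto
  then have "cmod (complex_of_real (LINT x|torus. cmod (propagated \<tau> s x * h x))) \<le> 2 * pi * ((sup_g\<^sup>2 + B\<^sup>2) / 2)"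
    unfolding eq by (simp add: norm_mult)
  then show ?thesis by (simp only: norm_of_real)
qed

definition u0_coeff :: "int \<Rightarrow> complex" where "u0_coeff k = fourier_coeff u0 k"

lemma u0_le: "\<bar>u0 x\<bar> \<le> sup_u"
  using u_le[of 0 x] mild by (simp add: bounded_mild_solution_def)

lemma norm_u0_coeff_le: "cmod (u0_coeff k) \<le> sup_u"
  unfolding u0_coeff_def by (rule norm_fourier_coeff_le[OF u0_le])

lemma duhamel_pointwise:
  assumes "t > 0"
  shows "of_real (u t x) = (LINT k|int_counting. of_real (heat_symbol \<nu> \<gamma> t k) * u0_coeff k * cis (of_int k * x))
           + (LINT s|time_interval t. propagated (t - s) s x)"
proof -
  have gg: "frac_heat \<nu> \<gamma> (t - s) (\<lambda>y. u s y - (u s y) ^ 3) = frac_heat \<nu> \<gamma> (t - s) (g s)" if "s > 0" for s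
    using that by (simp add: g_def[abs_def])
  have "u t x = frac_heat \<nu> \<gamma> t u0 x
          + (LINT s|lebesgue_on {0<..<t}. frac_heat \<nu> \<gamma> (t - s) (\<lambda>y. u s y - (u s y) ^ 3) x)"
    using mild assms by (simp add: bounded_mild_solution_def)
  also have "(LINT s|lebesgue_on {0<..<t}. frac_heat \<nu> \<gamma> (t - s) (\<lambda>y. u s y - (u s y) ^ 3) x)
      = (LINT s|lebesgue_on {0<..<t}. Re (propagated (t - s) s x))"
    by (intro Bochner_Integration.integral_cong refl)
       (auto simp: gg of_real_frac_heat_g[symmetric])
  also have "\<dots> = (LINT s|time_interval t. Re (propagated (t - s) s x))"
    unfolding time_interval_def
  proof (rule integral_lebesgue_on_eq_lborel)
    show "(\<lambda>s. Re (propagated (t - s) s x)) \<in> borel_measurable borel"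
      using measurable_compose[OF measurable_Pair2'[of x borel borel] propagated_pair_measurable[of t]] by simp
  qed simp
  finally have "of_real (u t x) = of_real (frac_heat \<nu> \<gamma> t u0 x)
          + (LINT s|time_interval t. complex_of_real (Re (propagated (t - s) s x)))"
    by simp
  also have "(LINT s|time_interval t. complex_of_real (Re (propagated (t - s) s x)))
     = (LINT s|time_interval t. propagated (t - s) s x)"
    by (intro Bochner_Integration.integral_cong refl)
       (auto simp: of_real_frac_heat_g[symmetric])
  also have "of_real (frac_heat \<nu> \<gamma> t u0 x)
      = (LINT k|int_counting. of_real (heat_symbol \<nu> \<gamma> t k) * u0_coeff k * cis (of_int k * x))"
    using frac_heat_eq_integral[OF \<nu>_pos assms \<gamma>_pos u0_le] by (simp add: u0_coeff_def)
  finally show ?thesis .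
qed

text \<open>
  The right-hand side of Duhamel's formula for one mode; it equals \<open>a t k\<close> by the lemma \<open>duhamel\<close>.
\<close>

definition duhamel_coeff :: "real \<Rightarrow> int \<Rightarrow> complex" where
  "duhamel_coeff t k = of_real (heat_symbol \<nu> \<gamma> t k) * u0_coeff k
     + (LINT s|time_interval t. of_real (heat_symbol \<nu> \<gamma> (t - s) k) * q s k)"

lemma propagated_pairing:
  assumes "\<tau> > 0" "bdd_borel h"
  shows "(LINT x|torus. propagated \<tau> s x * h x)
    = 2 * pi * (LINT k|int_counting. of_real (heat_symbol \<nu> \<gamma> \<tau> k) * q s k * torus_coeff h (- k))"
  using series_pairing[OF integrable_heat_symbol_q[OF assms(1)] assms(2)] by (simp add: propagated_def)

text \<open>
  Fubini's theorem is applied twice, first to time and space and then to time and frequency.  The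
  triple sum over time, space and frequency need not converge absolutely if \<open>\<gamma> \<le> 1\<close>.
\<close>

lemma
  assumes t: "t > 0" and h: "bdd_borel h"
  shows duhamel_pairing: "(1 / (2 * pi)) *\<^sub>R (LINT x|torus. of_real (u t x) * h x)
           = (LINT k|int_counting. duhamel_coeff t k * torus_coeff h (- k))"
    and duhamel_pairing_integrable: "integrable int_counting (\<lambda>k. duhamel_coeff t k * torus_coeff h (- k))"
proof -
  obtain B where B: "\<And>x. cmod (h x) \<le> B" using h by (auto simp: bdd_borel_def)
  have hm [measurable]: "h \<in> borel_measurable borel" using h by (simp add: bdd_borel_def)
  interpret T: finite_measure "time_interval t" by (rule finite_measure_time_interval)
  interpret P: pair_sigma_finite "time_interval t" torus ..
  define C where "C = 2 * pi * ((sup_g\<^sup>2 + B\<^sup>2) / 2)"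
  define F where "F s x = propagated (t - s) s x * h x" for s x
  have id: "(\<lambda>p. (fst p, snd p)) \<in> measurable (time_interval t \<Otimes>\<^sub>M torus) (borel \<Otimes>\<^sub>M borel)"
    by (intro measurable_Pair measurable_compose[OF measurable_fst] measurable_compose[OF measurable_snd ident_torus_measurable]
        borel_measurable_time_interval) simp
  have "(\<lambda>(s, x). F s x) \<in> borel_measurable (borel \<Otimes>\<^sub>M borel)"
    unfolding F_def case_prod_beta' using propagated_pair_measurable[of t] by (simp add: case_prod_beta')
  from measurable_compose[OF id this]
  have Fm [measurable]: "(\<lambda>(s, x). F s x) \<in> borel_measurable (time_interval t \<Otimes>\<^sub>M torus)"
    by (simp add: case_prod_beta')
  have Fint: "integrable (time_interval t \<Otimes>\<^sub>M torus) (\<lambda>(s, x). F s x)"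
  proof (rule P.Fubini_integrable[OF Fm])
    have "(\<lambda>s. LINT x|torus. norm (F s x)) \<in> borel_measurable (time_interval t)"
      by (rule torus.borel_measurable_lebesgue_integral) (use Fm in measurable)
    moreover have "AE s in time_interval t. norm (LINT x|torus. norm (F s x)) \<le> C"
      using propagated_L1_bound[OF _ h B] by (auto simp: F_def C_def)
    ultimately have "integrable (time_interval t) (\<lambda>s. LINT x|torus. norm (F s x))"
      by (intro T.integrable_const_bound)
    then show "integrable (time_interval t) (\<lambda>s. LINT x|torus. norm (case (s, x) of (s, x) \<Rightarrow> F s x))"
      by simp
    show "AE s in time_interval t. integrable torus (\<lambda>x. case (s, x) of (s, x) \<Rightarrow> F s x)"
      using series_mult_integrable[OF integrable_heat_symbol_q h] by (auto simp: F_def propagated_def)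
  qed
  define c where "c k = of_real (heat_symbol \<nu> \<gamma> t k) * u0_coeff k" for k
  have cint: "integrable int_counting c"
    unfolding c_def by (rule integrable_heat_symbol[OF \<nu>_pos t \<gamma>_pos norm_u0_coeff_le])
  define G where "G k s = of_real (heat_symbol \<nu> \<gamma> (t - s) k) * q s k * torus_coeff h (- k)" for k s
  have Gm: "G k \<in> borel_measurable (time_interval t)" for k
    unfolding G_def by (rule borel_measurable_time_interval) measurable
  have Gfin: "(\<integral>\<^sup>+k. (\<integral>\<^sup>+s. ennreal (cmod (G k s)) \<partial>time_interval t) \<partial>int_counting) < \<infinity>"
  proof -
    have "(\<integral>\<^sup>+k. (\<integral>\<^sup>+s. ennreal (cmod (G k s)) \<partial>time_interval t) \<partial>int_counting)
       = (\<integral>\<^sup>+s. (\<integral>\<^sup>+k. ennreal (cmod (G k s)) \<partial>int_counting) \<partial>time_interval t)"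
      using Gm by (intro nn_integral_count_space_nn_integral[symmetric]) auto
    also have "\<dots> \<le> (\<integral>\<^sup>+s. ennreal ((sup_g\<^sup>2 + B\<^sup>2) / 2) \<partial>time_interval t)"
    proof (rule nn_integral_mono)
      fix s assume s: "s \<in> space (time_interval t)"
      show "(\<integral>\<^sup>+k. ennreal (cmod (G k s)) \<partial>int_counting) \<le> ennreal ((sup_g\<^sup>2 + B\<^sup>2) / 2)"
        using sum_coeff_products_le[OF bdd_borel_g _ h B, of s sup_g "heat_symbol \<nu> \<gamma> (t - s)"] s \<nu>_pos g_le
          heat_symbol_pos[THEN less_imp_le] heat_symbol_le_1[of \<nu> "t - s" \<gamma>]
        by (simp add: G_def norm_mult q_def)
    qed
    also have "\<dots> < \<infinity>"
    proof -
      have "emeasure (time_interval t) {0<..<t} < top"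
        unfolding less_top[symmetric] using T.emeasure_finite[of "{0<..<t}"] by simp
      then show ?thesis
        unfolding nn_integral_const space_time_interval infinity_ennreal_def
        by (simp only: ennreal_mult_less_top ennreal_less_top simp_thms)
    qed
    finally show ?thesis .
  qed
  note sw = integral_int_sum_swap[OF T.sigma_finite_measure_axioms Gm Gfin]
     integrable_int_sum_integral[OF T.sigma_finite_measure_axioms Gm Gfin]
  have coeff: "c k * torus_coeff h (- k) + (LINT s|time_interval t. G k s) = duhamel_coeff t k * torus_coeff h (- k)" for k
    by (simp add: G_def c_def duhamel_coeff_def distrib_right)
  show "integrable int_counting (\<lambda>k. duhamel_coeff t k * torus_coeff h (- k))"
    using Bochner_Integration.integrable_add[OF series_pairing_integrable[OF cint h] sw(2)] unfolding coeff .
  have "(LINT x|torus. of_real (u t x) * h x)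
      = (LINT x|torus. (LINT k|int_counting. c k * cis (of_int k * x)) * h x + (LINT s|time_interval t. F s x))"
    by (simp add: duhamel_pointwise[OF t] distrib_right F_def c_def)
  also have "\<dots> = (LINT x|torus. (LINT k|int_counting. c k * cis (of_int k * x)) * h x)
               + (LINT x|torus. LINT s|time_interval t. F s x)"
    by (rule Bochner_Integration.integral_add[OF series_mult_integrable[OF cint h] P.integrable_snd[OF Fint]])
  also have "(LINT x|torus. LINT s|time_interval t. F s x) = (LINT s|time_interval t. LINT x|torus. F s x)"
    by (rule P.Fubini_integral[OF Fint])
  also have "\<dots> = (LINT s|time_interval t. of_real (2 * pi) * (LINT k|int_counting. G k s))"
    by (intro Bochner_Integration.integral_cong refl) (simp add: F_def G_def propagated_pairing[OF _ h])
  also have "\<dots> = of_real (2 * pi) * (LINT k|int_counting. LINT s|time_interval t. G k s)"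
    by (simp add: sw(1))
  also have "(LINT x|torus. (LINT k|int_counting. c k * cis (of_int k * x)) * h x)
     = of_real (2 * pi) * (LINT k|int_counting. c k * torus_coeff h (- k))"
    using series_pairing[OF cint h] by simp
  finally show "(1 / (2 * pi)) *\<^sub>R (LINT x|torus. of_real (u t x) * h x)
           = (LINT k|int_counting. duhamel_coeff t k * torus_coeff h (- k))"
    unfolding coeff[symmetric]
    by (subst Bochner_Integration.integral_add[OF series_pairing_integrable[OF cint h] sw(2)])
       (simp add: scaleR_conv_of_real field_simps)
qed

text \<open>
  The pairing with \<open>h = cis (- k x)\<close> selects one summand.
\<close>

lemma duhamel:
  assumes "t > 0"
  shows "a t k = of_real (heat_symbol \<nu> \<gamma> t k) * u0_coeff k
     + (LINT s|time_interval t. of_real (heat_symbol \<nu> \<gamma> (t - s) k) * q s k)"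
proof -
  have "a t k = (LINT j|int_counting. duhamel_coeff t j * torus_coeff (\<lambda>x. cis (- (of_int k * x))) (- j))"
    using duhamel_pairing[OF assms bdd_borel_cis_minus[of "of_int k"]] by (simp add: a_def torus_coeff_def)
  also have "\<dots> = (LINT j|int_counting. (if j = k then duhamel_coeff t k else 0))"
    using torus_coeff_cis[of "-k"] by (intro Bochner_Integration.integral_cong refl) auto
  also have "\<dots> = duhamel_coeff t k"
    by (subst lebesgue_integral_count_space_finite_support) auto
  finally show ?thesis by (simp add: duhamel_coeff_def)
qed

text \<open>
  The central identity: it expresses that \<open>u t\<close> is the limit of its Fourier series in the weak sense
  and is used with many different \<open>h\<close> below.
\<close>

lemma
  assumes t: "t > 0" and h: "bdd_borel h"
  shows u_pairing: "(1 / (2 * pi)) *\<^sub>R (LINT x|torus. of_real (u t x) * h x)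
           = (LINT k|int_counting. a t k * torus_coeff h (- k))"
    and u_pairing_integrable: "integrable int_counting (\<lambda>k. a t k * torus_coeff h (- k))"
  using duhamel_pairing[OF assms] duhamel_pairing_integrable[OF assms]
  by (simp_all add: duhamel[OF t] duhamel_coeff_def)

end

section \<open>Translations and the Gagliardo integral\<close>

lemma set_integrable_Ico_bounded:
  fixes f :: "real \<Rightarrow> 'b :: {banach, second_countable_topology}"
  assumes [measurable]: "f \<in> borel_measurable borel" and B: "\<And>x. norm (f x) \<le> B"
  shows "set_integrable lborel {c..<d} f"
proof -
  have "emeasure lborel {c..<d} < \<infinity>" by (cases "c \<le> d") auto
  then have "integrable lborel (\<lambda>x. indicator {c..<d} x * B)" by simp
  then show ?thesis
    unfolding set_integrable_def
    by (rule Bochner_Integration.integrable_bound)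
       (auto simp: indicator_def intro!: order_trans[OF B])
qed

text \<open>
  For shifts by less than a period the two intervals differ by \<open>[a, b)\<close> and its translate by one period.
\<close>

lemma integral_period_shift_aux:
  fixes f :: "real \<Rightarrow> complex"
  assumes f: "bdd_borel f" and per: "\<And>x. f (x + 2 * pi) = f x" and ab: "a \<le> b" "b \<le> a + 2 * pi"
  shows "(LINT x:{a..<a + 2 * pi}|lborel. f x) = (LINT x:{b..<b + 2 * pi}|lborel. f x)"
proof -
  obtain B where B: "\<And>x. cmod (f x) \<le> B" using f by (auto simp: bdd_borel_def)
  have [measurable]: "f \<in> borel_measurable borel" using f by (simp add: bdd_borel_def)
  have int: "set_integrable lborel {c..<d} f" for c d
    by (rule set_integrable_Ico_bounded[OF _ B]) simp
  have split: "(LINT x:{c..<e}|lborel. f x) = (LINT x:{c..<d}|lborel. f x) + (LINT x:{d..<e}|lborel. f x)"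
    if "c \<le> d" "d \<le> e" for c d e
    using set_integral_Un[OF _ int int, of c d d e] that by (simp add: ivl_disj_un)
  have "(LINT x:{a + 2 * pi..<b + 2 * pi}|lborel. f x) = (LINT x:{a..<b}|lborel. f x)"
    unfolding set_lebesgue_integral_def
    by (subst lborel_integral_real_affine[where c = 1 and t = "2 * pi"])
       (auto simp: add.commute[of "2 * pi"] per indicator_def intro!: Bochner_Integration.integral_cong)
  then show ?thesis using split[of a b "a + 2 * pi"] split[of b "a + 2 * pi" "b + 2 * pi"] ab by simp
qed

lemma integral_period_shift:
  fixes f :: "real \<Rightarrow> complex"
  assumes f: "bdd_borel f" and per: "\<And>x. f (x + 2 * pi) = f x" and h: "h \<ge> 0"
  shows "(LINT x|torus. f (x + h)) = (LINT x|torus. f x)"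
proof -
  have [measurable]: "f \<in> borel_measurable borel" using f by (simp add: bdd_borel_def)
  define J where "J a = (LINT x:{a..<a + 2 * pi}|lborel. f x)" for a
  have J: "J (a + h) = J a" if "0 \<le> h" "h \<le> 2 * pi * real n" for a h n
    using that
  proof (induction n arbitrary: h)
    case (Suc n)
    have "J (a + h) = J (a + max 0 (h - 2 * pi))"
      unfolding J_def using Suc.prems
      by (intro integral_period_shift_aux[OF f per, symmetric]) (auto simp: max_def)
    also have "\<dots> = J a"
      by (rule Suc.IH) (use Suc.prems in \<open>auto simp: max_def algebra_simps\<close>)
    finally show ?case .
  qed auto
  obtain n where "h / (2 * pi) \<le> real n" using real_arch_simple by blast
  then have "h \<le> 2 * pi * real n" by (simp add: field_simps)
  then have Jh: "J (- pi + h) = J (- pi)" using J h by blast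
  have "AE x in lborel. x \<noteq> pi" "AE x in lborel. x \<noteq> pi + h" by (rule AE_lborel_singleton)+
  have "(LINT x|torus. f (x + h)) = (LINT x|lborel. indicator {-pi..pi} x *\<^sub>R f (x + h))"
    by (simp add: torus_def integral_restrict_space)
  also have "\<dots> = (LINT x|lborel. indicator {-pi + h..pi + h} x *\<^sub>R f x)"
    by (subst (2) lborel_integral_real_affine[where c = 1 and t = "h"])
       (auto simp: add.commute indicator_def intro!: Bochner_Integration.integral_cong)
  also have "\<dots> = J (- pi + h)"
    unfolding J_def set_lebesgue_integral_def
    by (rule integral_cong_AE)
       (use \<open>AE x in lborel. x \<noteq> pi + h\<close> in \<open>auto simp: indicator_def elim!: eventually_mono\<close>)
  also have "\<dots> = (LINT x|lborel. indicator {-pi..pi} x *\<^sub>R f x)"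
    unfolding Jh unfolding J_def set_lebesgue_integral_def
    by (rule integral_cong_AE)
       (use \<open>AE x in lborel. x \<noteq> pi\<close> in \<open>auto simp: indicator_def elim!: eventually_mono\<close>)
  also have "\<dots> = (LINT x|torus. f x)"
    by (simp add: torus_def integral_restrict_space)
  finally show ?thesis .
qed

lemma integral_reflect:
  fixes f :: "real \<Rightarrow> complex"
  shows "(LINT x|torus. f (- x)) = (LINT x|torus. f x)"
proof -
  have "(LINT x|torus. f x) = (LINT x|lborel. indicator {-pi..pi} x *\<^sub>R f x)"
    by (simp add: torus_def integral_restrict_space)
  also have "\<dots> = (LINT x|lborel. indicator {-pi..pi} x *\<^sub>R f (- x))"
    by (subst lborel_integral_real_affine[where c = "-1" and t = 0])
       (auto simp: indicator_def intro!: Bochner_Integration.integral_cong)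
  also have "\<dots> = (LINT x|torus. f (- x))"
    by (simp add: torus_def integral_restrict_space)
  finally show ?thesis ..
qed

lemma torus_coeff_reflect: "torus_coeff (\<lambda>x. f (- x)) k = torus_coeff f (- k)"
  using integral_reflect[of "\<lambda>x. f x * cis (of_int k * x)"] by (simp add: torus_coeff_def)

lemma bdd_borel_shift: "bdd_borel f \<Longrightarrow> bdd_borel (\<lambda>x. f (x + h))"
  by (auto simp: bdd_borel_def)

lemma bdd_borel_reflect: "bdd_borel f \<Longrightarrow> bdd_borel (\<lambda>x. f (- x))"
  by (auto simp: bdd_borel_def)

lemma cis_periodic: "cis (of_int k * (x + 2 * pi)) = cis (of_int k * x)"
proof -
  have "cis (of_int k * (2 * pi)) = 1" using cis_multiple_2pi[of "of_int k"] by (simp add: mult_ac)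
  then show ?thesis by (simp add: distrib_left flip: cis_mult)
qed

lemma torus_coeff_shift:
  assumes f: "bdd_borel f" and per: "\<And>x. f (x + 2 * pi) = f x" and h: "h \<ge> 0"
  shows "torus_coeff (\<lambda>x. f (x + h)) k = cis (of_int k * h) * torus_coeff f k"
proof -
  define F where "F x = f x * cis (- (of_int k * x)) * cis (of_int k * h)" for x
  have "F (x + 2 * pi) = F x" for x
    using cis_periodic[of "-k" x] by (simp add: F_def per)
  moreover have "bdd_borel F" unfolding F_def by (intro bdd_borel_mult f) auto
  ultimately have "(LINT x|torus. F (x + h)) = (LINT x|torus. F x)"
    using h by (intro integral_period_shift)
  moreover have "F (x + h) = f (x + h) * cis (- (of_int k * x))" for x
    by (simp add: F_def mult.assoc cis_mult algebra_simps)
  moreover have "(LINT x|torus. F x) = cis (of_int k * h) * (LINT x|torus. f x * cis (- (of_int k * x)))"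
    unfolding F_def by (simp add: mult.commute)
  ultimately show ?thesis by (simp add: torus_coeff_def)
qed

text \<open>
  The constant relating \<open>\<bar>k\<bar>\<^sup>\<rho>\<close> to the weighted integral of \<open>\<bar>cis (k h) - 1\<bar>\<^sup>2\<close> over \<open>h > 0\<close>.
\<close>

definition gagliardo_constant :: "real \<Rightarrow> ennreal" where
  "gagliardo_constant \<rho> = (\<integral>\<^sup>+h. ennreal (h powr (- 1 - \<rho>) * (cmod (cis h - 1))\<^sup>2) * indicator {0<..} h \<partial>lborel)"

lemma norm_cis_minus_1_le: "cmod (cis h - 1) \<le> \<bar>h\<bar>"
proof -
  have "(cmod (cis h - 1))\<^sup>2 = 4 * (sin (h / 2))\<^sup>2"
  proof -
    have "(cmod (cis h - 1))\<^sup>2 = 2 - 2 * cos h"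
      by (simp add: cmod_power2 power2_diff cos_squared_eq)
    then show ?thesis using cos_double_sin[of "h / 2"] by simp
  qed
  also have "\<dots> \<le> 4 * (h / 2)\<^sup>2"
    using iffD1[OF abs_le_square_iff abs_sin_x_le_abs_x[of "h / 2"]] by simp
  also have "\<dots> = \<bar>h\<bar>\<^sup>2" by (simp add: power2_eq_square)
  finally show ?thesis by (rule power2_le_imp_le) simp
qed

text \<open>
  Near \<open>0\<close> the integrand is of order \<open>h\<^sup>1\<^sup>-\<^sup>\<rho>\<close>, near infinity of order \<open>h\<^sup>-\<^sup>1\<^sup>-\<^sup>\<rho>\<close>.
\<close>

lemma gagliardo_constant_finite:
  assumes "0 < \<rho>" "\<rho> < 2"
  shows "gagliardo_constant \<rho> < \<infinity>"
proof -
  have "ennreal (h powr (- 1 - \<rho>) * (cmod (cis h - 1))\<^sup>2) * indicator {0<..} h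
     \<le> ennreal (indicator {0..1} h * h powr (1 - \<rho>)) + ennreal (indicator {1..} h * (4 * h powr (- 1 - \<rho>)))" for h
  proof (cases "h > 0")
    case True
    show ?thesis
    proof (cases "h \<le> 1")
      case le: True
      have "h powr (- 1 - \<rho>) * (cmod (cis h - 1))\<^sup>2 \<le> h powr (- 1 - \<rho>) * h powr 2"
        using norm_cis_minus_1_le[of h] True by (intro mult_left_mono) (auto simp: power_mono)
      also have "\<dots> = h powr (1 - \<rho>)" by (simp only: powr_add[symmetric]) simp
      finally have "ennreal (h powr (- 1 - \<rho>) * (cmod (cis h - 1))\<^sup>2) * indicator {0<..} h
          \<le> ennreal (indicator {0..1} h * h powr (1 - \<rho>))"
        using True le by (simp add: ennreal_leI)
      then show ?thesis by (rule order_trans) (rule add_increasing2[OF zero_le order_refl])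
    next
      case False
      have "cmod (cis h - 1) \<le> 2" using norm_triangle_ineq4[of "cis h" 1] by simp
      then have "(cmod (cis h - 1))\<^sup>2 \<le> 4" using power_mono[of "cmod (cis h - 1)" 2 2] by simp
      then have "h powr (- 1 - \<rho>) * (cmod (cis h - 1))\<^sup>2 \<le> h powr (- 1 - \<rho>) * 4"
        by (intro mult_left_mono) auto
      then have "ennreal (h powr (- 1 - \<rho>) * (cmod (cis h - 1))\<^sup>2) * indicator {0<..} h
          \<le> ennreal (indicator {1..} h * (4 * h powr (- 1 - \<rho>)))"
        using True False by (simp add: ennreal_leI mult.commute)
      then show ?thesis by (rule order_trans) (rule add_increasing[OF zero_le order_refl])
    qed
  qed simp
  then have "gagliardo_constant \<rho> \<le> (\<integral>\<^sup>+h. ennreal (indicator {0..1} h * h powr (1 - \<rho>)) + ennreal (indicator {1..} h * (4 * h powr (- 1 - \<rho>))) \<partial>lborel)"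
    unfolding gagliardo_constant_def by (rule nn_integral_mono)
  also have "\<dots> = (\<integral>\<^sup>+h. ennreal (indicator {0..1} h * h powr (1 - \<rho>)) \<partial>lborel) + (\<integral>\<^sup>+h. ennreal (indicator {1..} h * (4 * h powr (- 1 - \<rho>))) \<partial>lborel)"
    by (rule nn_integral_add) measurable
  also have "\<dots> < \<infinity>"
  proof -
    have "((\<lambda>h. h powr (1 - \<rho>)) has_integral (1 powr (1 - \<rho> + 1) / (1 - \<rho> + 1))) {0..1}"
      using assms by (intro has_integral_powr_from_0) auto
    then have "(\<integral>\<^sup>+h. ennreal (indicator {0..1} h * h powr (1 - \<rho>)) \<partial>lborel) < \<infinity>"
      by (subst nn_integral_has_integral_lebesgue) auto
    moreover have "((\<lambda>h. h powr (- 1 - \<rho>)) has_integral - (1 powr (- 1 - \<rho> + 1)) / (- 1 - \<rho> + 1)) {1..}"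
      using assms by (intro has_integral_powr_to_inf) auto
    from has_integral_mult_right[OF this, of 4]
    have "(\<integral>\<^sup>+h. ennreal (indicator {1..} h * (4 * h powr (- 1 - \<rho>))) \<partial>lborel) < \<infinity>"
      by (subst nn_integral_has_integral_lebesgue) auto
    ultimately show ?thesis by simp
  qed
  finally show ?thesis .
qed

lemma gagliardo_constant_pos:
  "gagliardo_constant \<rho> > 0"
proof -
  define c where "c = 2 * min (1 powr (- 1 - \<rho>)) (pi powr (- 1 - \<rho>))"
  have "c > 0" by (simp add: c_def)
  have "ennreal c * indicator {pi/2..pi} h \<le> ennreal (h powr (- 1 - \<rho>) * (cmod (cis h - 1))\<^sup>2) * indicator {0<..} h" for h
  proof (cases "h \<in> {pi/2..pi}")
    case True
    then have h: "h > 0" "h \<ge> 1" "h \<le> pi" using pi_gt3 by auto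
    have "cos h \<le> cos (pi / 2)" using True by (intro cos_monotone_0_pi_le) auto
    then have "(cmod (cis h - 1))\<^sup>2 \<ge> 2"
      by (simp add: cmod_power2 power2_diff cos_squared_eq)
    moreover have "h powr (- 1 - \<rho>) \<ge> min (1 powr (- 1 - \<rho>)) (pi powr (- 1 - \<rho>))"
    proof (cases "- 1 - \<rho> \<ge> 0")
      case True then show ?thesis using h by (intro min.coboundedI1 powr_mono2) auto
    next
      case False then show ?thesis using h by (intro min.coboundedI2 powr_mono2') auto
    qed
    ultimately have "min (1 powr (- 1 - \<rho>)) (pi powr (- 1 - \<rho>)) * 2 \<le> h powr (- 1 - \<rho>) * (cmod (cis h - 1))\<^sup>2"
      by (intro mult_mono) auto
    then show ?thesis using True h by (simp add: c_def mult.commute ennreal_leI)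
  qed simp
  then have "(\<integral>\<^sup>+h. ennreal c * indicator {pi/2..pi} h \<partial>lborel) \<le> gagliardo_constant \<rho>"
    unfolding gagliardo_constant_def by (rule nn_integral_mono)
  moreover have "(\<integral>\<^sup>+h. ennreal c * indicator {pi/2..pi} h \<partial>lborel) = ennreal (c * (pi / 2))"
    using \<open>c > 0\<close> by (simp add: nn_integral_cmult_indicator flip: ennreal_mult)
  moreover have "ennreal (c * (pi / 2)) > 0" using \<open>c > 0\<close> by simp
  ultimately show ?thesis by order
qed

text \<open>Scaling the variable of integration by \<open>\<bar>k\<bar>\<close>.\<close>

lemma gagliardo_scaling:
  "(\<integral>\<^sup>+h. ennreal (h powr (- 1 - \<rho>) * (cmod (cis (of_int k * h) - 1))\<^sup>2) * indicator {0<..} h \<partial>lborel)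
     = gagliardo_constant \<rho> * ennreal (\<bar>real_of_int k\<bar> powr \<rho>)"
proof (cases "k = 0")
  case False
  define m where "m = \<bar>real_of_int k\<bar>"
  have m: "m > 0" using False by (simp add: m_def)
  have sym: "cmod (cis (of_int k * h) - 1) = cmod (cis (m * h) - 1)" for h
  proof (cases "k > 0")
    case False
    have "cmod (cis (- x) - 1) = cmod (cis x - 1)" for x
      using complex_mod_cnj[of "cis x - 1"] by (simp add: cis_cnj)
    then show ?thesis using False by (simp add: m_def)
  qed (simp add: m_def)
  have [measurable]: "(\<lambda>h. ennreal (h powr (- 1 - \<rho>) * (cmod (cis h - 1))\<^sup>2) * indicator {0<..} h) \<in> borel_measurable borel"
    by measurable
  have "gagliardo_constant \<rho> * ennreal (m powr \<rho>)
     = (ennreal m * (\<integral>\<^sup>+h. ennreal ((m * h) powr (- 1 - \<rho>) * (cmod (cis (m * h) - 1))\<^sup>2) * indicator {0<..} (m * h) \<partial>lborel)) * ennreal (m powr \<rho>)"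
    unfolding gagliardo_constant_def
    by (subst nn_integral_real_affine[where c = m and t = 0]) (use m in auto)
  also have "\<dots> = ennreal (m powr (1 + \<rho>)) * (\<integral>\<^sup>+h. ennreal ((m * h) powr (- 1 - \<rho>) * (cmod (cis (m * h) - 1))\<^sup>2) * indicator {0<..} (m * h) \<partial>lborel)"
    using m by (simp add: mult_ac ennreal_mult[symmetric] powr_add)
      (simp add: mult.assoc[symmetric] ennreal_mult[symmetric])
  also have "\<dots> = (\<integral>\<^sup>+h. ennreal (m powr (1 + \<rho>)) * (ennreal ((m * h) powr (- 1 - \<rho>) * (cmod (cis (m * h) - 1))\<^sup>2) * indicator {0<..} (m * h)) \<partial>lborel)"
    by (rule nn_integral_cmult[symmetric]) measurable
  also have "\<dots> = (\<integral>\<^sup>+h. ennreal (h powr (- 1 - \<rho>) * (cmod (cis (of_int k * h) - 1))\<^sup>2) * indicator {0<..} h \<partial>lborel)"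
  proof (rule nn_integral_cong)
    fix h :: real
    show "ennreal (m powr (1 + \<rho>)) * (ennreal ((m * h) powr (- 1 - \<rho>) * (cmod (cis (m * h) - 1))\<^sup>2) * indicator {0<..} (m * h))
      = ennreal (h powr (- 1 - \<rho>) * (cmod (cis (of_int k * h) - 1))\<^sup>2) * indicator {0<..} h"
    proof (cases "h > 0")
      case True
      have "m powr (1 + \<rho>) * (m * h) powr (- 1 - \<rho>) = h powr (- 1 - \<rho>)"
        using m True by (simp add: powr_mult mult.assoc[symmetric] powr_add[symmetric])
      then show ?thesis using m True by (simp add: sym ennreal_mult[symmetric] mult.assoc[symmetric])
    qed (use m in \<open>simp add: zero_less_mult_iff\<close>)
  qed
  finally show ?thesis by (simp add: m_def)
qed simp

section \<open>Parseval's identity and the fractional energy of the nonlinearity\<close>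

lemma integrable_torus_cmod_sq:
  assumes "bdd_borel f" shows "integrable torus (\<lambda>x. (cmod (f x))\<^sup>2)"
proof -
  have "integrable torus (\<lambda>x. complex_of_real ((cmod (f x))\<^sup>2))"
    using bdd_borel_integrable[OF bdd_borel_mult[OF assms bdd_borel_cnj[OF assms]]]
    by (simp only: complex_norm_square[symmetric] flip: of_real_power)
  then show ?thesis by (simp only: complex_of_real_integrable_eq)
qed

text \<open>
  Pairings give complex identities; Tonelli's theorem and comparison use extended nonnegative reals.
\<close>

lemma nn_integral_of_complex_parseval:
  assumes int: "integrable int_counting (\<lambda>k. complex_of_real (c k))" and c: "\<And>k. c k \<ge> 0"
    and eq: "(1 / (2 * pi)) *\<^sub>R (LINT x|torus. complex_of_real (D x) * complex_of_real (D x)) = (LINT k|int_counting. complex_of_real (c k))"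
  shows "(\<integral>\<^sup>+k. ennreal (c k) \<partial>int_counting) = ennreal ((1 / (2 * pi)) * (LINT x|torus. (D x)\<^sup>2))"
proof -
  have "integrable int_counting c" using int by (simp only: complex_of_real_integrable_eq)
  then have 1: "(\<integral>\<^sup>+k. ennreal (c k) \<partial>int_counting) = ennreal (LINT k|int_counting. c k)"
    using c by (intro nn_integral_eq_integral) auto
  have "complex_of_real ((1 / (2 * pi)) * (LINT x|torus. (D x)\<^sup>2)) = complex_of_real (LINT k|int_counting. c k)"
    using eq by (simp add: scaleR_conv_of_real power2_eq_square flip: of_real_mult)
  then have "(1 / (2 * pi)) * (LINT x|torus. (D x)\<^sup>2) = (LINT k|int_counting. c k)"
    by (simp only: of_real_eq_iff)
  then show ?thesis using 1 by simp
qed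

text \<open>
  With the weight \<open>exp (- 2 K t)\<close> the integral operator has norm at most \<open>1/2\<close>, so the weighted
  supremum \<open>S\<close> satisfies \<open>S \<le> S/2\<close>; being finite it is \<open>0\<close>.
\<close>

lemma gronwall_zero:
  fixes y :: "real \<Rightarrow> ennreal"
  assumes K: "K > 0" and bdd: "\<And>t. 0 < t \<Longrightarrow> t \<le> T \<Longrightarrow> y t \<le> ennreal B"
    and le: "\<And>t. 0 < t \<Longrightarrow> t \<le> T \<Longrightarrow> y t \<le> ennreal K * (\<integral>\<^sup>+s. y s * indicator {0<..<t} s \<partial>lborel)"
    and t: "0 < t" "t \<le> T"
  shows "y t = 0"
proof -
  define S where "S = (SUP t\<in>{0<..T}. ennreal (exp (- 2 * K * t)) * y t)"
  have yS: "y t \<le> ennreal (exp (2 * K * t)) * S" if "0 < t" "t \<le> T" for t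
  proof -
    have "ennreal (exp (2 * K * t)) * (ennreal (exp (- 2 * K * t)) * y t) \<le> ennreal (exp (2 * K * t)) * S"
      unfolding S_def using that by (intro mult_left_mono SUP_upper) auto
    then show ?thesis by (simp add: mult.assoc[symmetric] ennreal_mult[symmetric] exp_add[symmetric])
  qed
  have half: "ennreal (exp (- 2 * K * t)) * y t \<le> ennreal (1 / 2) * S" if t: "0 < t" "t \<le> T" for t
  proof -
    have "(\<integral>\<^sup>+s. y s * indicator {0<..<t} s \<partial>lborel) \<le> (\<integral>\<^sup>+s. S * (ennreal (exp (2 * K * s)) * indicator {0..t} s) \<partial>lborel)"
      using yS t by (intro nn_integral_mono) (auto simp: indicator_def mult.commute)
    also have "\<dots> = S * (\<integral>\<^sup>+s. ennreal (exp (2 * K * s)) * indicator {0..t} s \<partial>lborel)"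
      by (rule nn_integral_cmult) measurable
    also have "(\<integral>\<^sup>+s. ennreal (exp (2 * K * s)) * indicator {0..t} s \<partial>lborel) = ennreal (exp (2 * K * t) / (2 * K) - exp (2 * K * 0) / (2 * K))"
      using t K by (intro nn_integral_FTC_Icc) (auto intro!: derivative_eq_intros)
    also have "\<dots> \<le> ennreal (exp (2 * K * t) / (2 * K))"
      using K by (intro ennreal_leI) simp
    finally have "(\<integral>\<^sup>+s. y s * indicator {0<..<t} s \<partial>lborel) \<le> S * ennreal (exp (2 * K * t) / (2 * K))"
      by (simp add: mult_left_mono)
    then have "y t \<le> ennreal K * (S * ennreal (exp (2 * K * t) / (2 * K)))"
      by (intro order_trans[OF le[OF t]] mult_left_mono) auto
    then have "ennreal (exp (- 2 * K * t)) * y t \<le> ennreal (exp (- 2 * K * t)) * (ennreal K * (S * ennreal (exp (2 * K * t) / (2 * K))))"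
      by (intro mult_left_mono) auto
    also have "\<dots> = (ennreal (exp (- 2 * K * t)) * ennreal K * ennreal (exp (2 * K * t) / (2 * K))) * S"
      by (simp only: mult_ac)
    also have "ennreal (exp (- 2 * K * t)) * ennreal K * ennreal (exp (2 * K * t) / (2 * K)) = ennreal (1 / 2)"
      using K by (simp add: exp_minus field_simps flip: ennreal_mult)
    finally show ?thesis .
  qed
  have "S \<le> ennreal (1 / 2) * S"
    unfolding S_def[of ] by (rule SUP_least) (use half in \<open>auto simp: S_def\<close>)
  moreover have "S < \<infinity>"
  proof -
    have "S \<le> ennreal B" unfolding S_def
    proof (rule SUP_least)
      fix t assume "t \<in> {0<..T}"
      then have "ennreal (exp (- 2 * K * t)) * y t \<le> 1 * ennreal B"
        using K by (intro mult_mono bdd) (auto intro: ennreal_leI simp flip: ennreal_1)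
      then show "ennreal (exp (- 2 * K * t)) * y t \<le> ennreal B" by simp
    qed
    then show ?thesis using le_less_trans[of S "ennreal B" top] by simp
  qed
  ultimately have "S = 0"
  proof (cases S)
    case (real r)
    assume "S \<le> ennreal (1 / 2) * S"
    then have "ennreal r \<le> ennreal (1 / 2 * r)" using real by (simp only: ennreal_mult[symmetric])
    then show ?thesis using real by (simp add: ennreal_le_iff)
  qed simp
  then show "y t = 0" using yS[OF t] by simp
qed

text \<open>
  Since \<open>0 powr \<rho> = 0\<close>, even for \<open>\<rho> = 0\<close>, the zero mode never contributes.
\<close>

definition sobolev_energy :: "real \<Rightarrow> (int \<Rightarrow> complex) \<Rightarrow> ennreal" where
  "sobolev_energy \<rho> c = (\<integral>\<^sup>+k. ennreal (\<bar>real_of_int k\<bar> powr \<rho> * (cmod (c k))\<^sup>2) \<partial>int_counting)"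

text \<open>
  Fractional energies are averages of squared differences over all shifts \<open>h\<close>; in this form they can be
  compared for a function and its image under a Lipschitz map.
\<close>

lemma gagliardo_identity:
  "gagliardo_constant \<rho> * sobolev_energy \<rho> c
     = (\<integral>\<^sup>+h. ennreal (h powr (- 1 - \<rho>)) * indicator {0<..} h *
          (\<integral>\<^sup>+k. ennreal ((cmod (cis (of_int k * h) - 1))\<^sup>2 * (cmod (c k))\<^sup>2) \<partial>int_counting) \<partial>lborel)"
proof -
  have m: "(\<lambda>h. ennreal (h powr (- 1 - \<rho>) * (cmod (cis (of_int k * h) - 1))\<^sup>2) * indicator {0<..} h) \<in> borel_measurable lborel" for k :: int
    by measurable
  have "gagliardo_constant \<rho> * sobolev_energy \<rho> c
      = (\<integral>\<^sup>+k. gagliardo_constant \<rho> * ennreal (\<bar>real_of_int k\<bar> powr \<rho>) * ennreal ((cmod (c k))\<^sup>2) \<partial>int_counting)"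
    unfolding sobolev_energy_def by (subst nn_integral_cmult[symmetric]) (auto simp: ennreal_mult mult.assoc)
  also have "\<dots> = (\<integral>\<^sup>+k. (\<integral>\<^sup>+h. ennreal (h powr (- 1 - \<rho>) * (cmod (cis (of_int k * h) - 1))\<^sup>2) * indicator {0<..} h * ennreal ((cmod (c k))\<^sup>2) \<partial>lborel) \<partial>int_counting)"
    by (simp only: gagliardo_scaling[symmetric] nn_integral_multc[OF m])
  also have "\<dots> = (\<integral>\<^sup>+h. (\<integral>\<^sup>+k. ennreal (h powr (- 1 - \<rho>) * (cmod (cis (of_int k * h) - 1))\<^sup>2) * indicator {0<..} h * ennreal ((cmod (c k))\<^sup>2) \<partial>int_counting) \<partial>lborel)"
    by (rule nn_integral_count_space_nn_integral[symmetric]) (auto intro!: borel_measurable_times m[unfolded measurable_lborel1])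
  also have "\<dots> = (\<integral>\<^sup>+h. ennreal (h powr (- 1 - \<rho>)) * indicator {0<..} h *
          (\<integral>\<^sup>+k. ennreal ((cmod (cis (of_int k * h) - 1))\<^sup>2 * (cmod (c k))\<^sup>2) \<partial>int_counting) \<partial>lborel)"
    by (intro nn_integral_cong, subst nn_integral_cmult[symmetric]) (auto simp: ennreal_mult mult_ac)
  finally show ?thesis .
qed

context bounded_mild
begin

lemma u_periodic: "t \<ge> 0 \<Longrightarrow> u t (x + 2 * pi) = u t x"
  using mild by (simp add: bounded_mild_solution_def torus_periodic_def)

lemma g_periodic: "g s (x + 2 * pi) = g s x"
  by (simp add: g_def u_periodic)

definition lip_g :: real where "lip_g = 1 + 3 * sup_u\<^sup>2"

lemma lip_g_pos: "lip_g > 0"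
  by (simp add: lip_g_def add_pos_nonneg)

lemma cubic_lipschitz:
  assumes "\<bar>v\<bar> \<le> sup_u" "\<bar>w\<bar> \<le> sup_u"
  shows "\<bar>(v - v ^ 3) - (w - w ^ 3)\<bar> \<le> lip_g * \<bar>v - w\<bar>"
proof -
  have "\<bar>v\<^sup>2 + v * w + w\<^sup>2\<bar> \<le> \<bar>v\<bar>\<^sup>2 + \<bar>v\<bar> * \<bar>w\<bar> + \<bar>w\<bar>\<^sup>2"
    by (simp add: abs_mult[symmetric] abs_le_iff) (smt (verit) abs_ge_self abs_ge_minus_self sum_power2_ge_zero mult_minus_right)
  also have "\<dots> \<le> sup_u\<^sup>2 + sup_u * sup_u + sup_u\<^sup>2"
    using assms sup_u_nonneg by (intro add_mono power_mono mult_mono) auto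
  also have "\<dots> = 3 * sup_u\<^sup>2" by (simp add: power2_eq_square)
  finally have "\<bar>1 - (v\<^sup>2 + v * w + w\<^sup>2)\<bar> \<le> lip_g" by (simp add: lip_g_def)
  moreover have "(v - v ^ 3) - (w - w ^ 3) = (1 - (v\<^sup>2 + v * w + w\<^sup>2)) * (v - w)"
    by (simp add: power2_eq_square power3_eq_cube algebra_simps)
  ultimately show ?thesis by (simp add: abs_mult mult_right_mono)
qed

lemma cubic_lipschitz_odd:
  assumes "\<bar>v\<bar> \<le> sup_u" "\<bar>w\<bar> \<le> sup_u"
  shows "\<bar>(v - v ^ 3) + (w - w ^ 3)\<bar> \<le> lip_g * \<bar>v + w\<bar>"
  using cubic_lipschitz[of v "-w"] assms by simp

lemma a_minus: "a t (- k) = cnj (a t k)"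
  by (simp add: a_def torus_coeff_of_real_minus)

lemma q_minus: "q t (- k) = cnj (q t k)"
  by (simp add: q_def torus_coeff_of_real_minus)

lemma parseval_u:
  assumes "t > 0"
  shows "(\<integral>\<^sup>+k. ennreal ((cmod (a t k))\<^sup>2) \<partial>int_counting) = ennreal ((1 / (2 * pi)) * (LINT x|torus. (u t x)\<^sup>2))"
proof (rule nn_integral_of_complex_parseval)
  have *: "a t k * torus_coeff (\<lambda>x. of_real (u t x)) (- k) = of_real ((cmod (a t k))\<^sup>2)" for k
  proof -
    have "torus_coeff (\<lambda>x. of_real (u t x)) (- k) = cnj (a t k)"
      using a_minus[of t k] by (simp add: a_def)
    then show ?thesis by (simp only: complex_norm_square)
  qed
  show "integrable int_counting (\<lambda>k. complex_of_real ((cmod (a t k))\<^sup>2))"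
    using u_pairing_integrable[OF assms bdd_borel_u[OF assms]] by (simp only: *)
  show "(1 / (2 * pi)) *\<^sub>R (LINT x|torus. complex_of_real (u t x) * complex_of_real (u t x))
     = (LINT k|int_counting. complex_of_real ((cmod (a t k))\<^sup>2))"
    using u_pairing[OF assms bdd_borel_u[OF assms]] by (simp only: *)
qed simp

text \<open>
  The pairing identity with the difference \<open>D\<close> itself as test function, and with \<open>D\<close> shifted back for the
  translated copy of \<open>u\<close>.
\<close>

lemma parseval_difference:
  assumes t: "t > 0" and h: "h \<ge> 0"
  shows "(\<integral>\<^sup>+k. ennreal ((cmod (cis (of_int k * h) - 1))\<^sup>2 * (cmod (a t k))\<^sup>2) \<partial>int_counting)
           = ennreal ((1 / (2 * pi)) * (LINT x|torus. (u t (x + h) - u t x)\<^sup>2))"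
proof -
  define D where "D x = complex_of_real (u t (x + h) - u t x)" for x
  define E where "E x = D (x - h)" for x
  note bu = bdd_borel_u[OF t]
  have bD: "bdd_borel D"
    using bdd_borel_diff[OF bdd_borel_shift[OF bu, of h] bu] by (simp add: D_def[abs_def])
  have bE: "bdd_borel E" using bdd_borel_shift[OF bD, of "-h"] by (simp add: E_def[abs_def])
  have pu: "complex_of_real (u t (x + 2 * pi)) = complex_of_real (u t x)" for x
    using t by (simp add: u_periodic)
  have pD: "D (x + 2 * pi) = D x" for x
    using t u_periodic[of t "x + h"] by (simp add: D_def u_periodic add_ac)
  have pE: "E (x + 2 * pi) = E x" for x
    using pD[of "x - h"] by (simp add: E_def algebra_simps)
  have cD: "torus_coeff D k = (cis (of_int k * h) - 1) * a t k" for k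
    using torus_coeff_diff[OF bdd_borel_shift[OF bu, of h] bu, of k] torus_coeff_shift[OF bu pu h, of k]
    by (simp add: D_def[abs_def] a_def algebra_simps)
  have cE: "torus_coeff E (- k) = cis (of_int k * h) * torus_coeff D (- k)" for k
  proof -
    have "(\<lambda>x. E (x + h)) = D" by (simp add: E_def fun_eq_iff)
    then have "torus_coeff D (- k) = cis (- (of_int k * h)) * torus_coeff E (- k)"
      using torus_coeff_shift[OF bE pE h, of "-k"] by simp
    then have "cis (of_int k * h) * torus_coeff D (- k) = cis (of_int k * h) * cis (- (of_int k * h)) * torus_coeff E (- k)"
      by simp
    then show ?thesis by (simp only: cis_mult) simp
  qed
  have cDm: "torus_coeff D (- k) = cnj (torus_coeff D k)" for k
    unfolding D_def by (rule torus_coeff_of_real_minus)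
  have summand: "a t k * torus_coeff E (- k) - a t k * torus_coeff D (- k) = complex_of_real ((cmod (cis (of_int k * h) - 1))\<^sup>2 * (cmod (a t k))\<^sup>2)" for k
  proof -
    have "a t k * torus_coeff E (- k) - a t k * torus_coeff D (- k) = torus_coeff D k * cnj (torus_coeff D k)"
    proof -
      have "a t k * torus_coeff E (- k) - a t k * torus_coeff D (- k) = ((cis (of_int k * h) - 1) * a t k) * torus_coeff D (- k)"
        unfolding cE by (simp only: left_diff_distrib right_diff_distrib mult_ac mult_1)
      then show ?thesis by (simp only: cD[symmetric] cDm)
    qed
    also have "\<dots> = complex_of_real ((cmod (torus_coeff D k))\<^sup>2)" by (simp only: complex_norm_square[symmetric] of_real_power)
    finally show ?thesis by (simp add: cD norm_mult power_mult_distrib)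
  qed
  note iE = u_pairing_integrable[OF t bE] and iD = u_pairing_integrable[OF t bD]
  have int: "integrable int_counting (\<lambda>k. complex_of_real ((cmod (cis (of_int k * h) - 1))\<^sup>2 * (cmod (a t k))\<^sup>2))"
    using Bochner_Integration.integrable_diff[OF iE iD] by (simp only: summand)
  have shift: "(LINT x|torus. complex_of_real (u t (x + h)) * D x) = (LINT x|torus. complex_of_real (u t x) * E x)"
    using integral_period_shift[of "\<lambda>x. complex_of_real (u t x) * E x" h] h t
    by (simp add: bdd_borel_mult bu bE pE u_periodic) (simp add: E_def)
  have "(LINT x|torus. D x * D x) = (LINT x|torus. complex_of_real (u t (x + h)) * D x - complex_of_real (u t x) * D x)"
    by (simp add: D_def algebra_simps)
  also have "\<dots> = (LINT x|torus. complex_of_real (u t (x + h)) * D x) - (LINT x|torus. complex_of_real (u t x) * D x)"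
    by (intro Bochner_Integration.integral_diff bdd_borel_integrable bdd_borel_mult bD bu bdd_borel_shift[OF bu])
  finally have "(1 / (2 * pi)) *\<^sub>R (LINT x|torus. D x * D x)
      = (LINT k|int_counting. a t k * torus_coeff E (- k)) - (LINT k|int_counting. a t k * torus_coeff D (- k))"
    by (simp add: shift scaleR_diff_right u_pairing[OF t bE, symmetric] u_pairing[OF t bD, symmetric])
  also have "\<dots> = (LINT k|int_counting. complex_of_real ((cmod (cis (of_int k * h) - 1))\<^sup>2 * (cmod (a t k))\<^sup>2))"
    by (simp only: Bochner_Integration.integral_diff[OF iE iD, symmetric] summand)
  finally have eq: "(1 / (2 * pi)) *\<^sub>R (LINT x|torus. complex_of_real (u t (x + h) - u t x) * complex_of_real (u t (x + h) - u t x))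
     = (LINT k|int_counting. complex_of_real ((cmod (cis (of_int k * h) - 1))\<^sup>2 * (cmod (a t k))\<^sup>2))"
    by (simp only: D_def)
  show ?thesis by (rule nn_integral_of_complex_parseval[OF int _ eq]) simp
qed

text \<open>
  Bessel's inequality bounds the left-hand side by the differences of \<open>u - u\<^sup>3\<close> in \<open>L\<^sup>2\<close>, and the Lipschitz
  bound leads to those of \<open>u\<close>, which are the right-hand side by Parseval's identity.
\<close>

lemma nonlinear_difference_bound:
  assumes s: "s > 0" and h: "h \<ge> 0"
  shows "(\<integral>\<^sup>+k. ennreal ((cmod (cis (of_int k * h) - 1))\<^sup>2 * (cmod (q s k))\<^sup>2) \<partial>int_counting)
     \<le> ennreal (lip_g\<^sup>2) * (\<integral>\<^sup>+k. ennreal ((cmod (cis (of_int k * h) - 1))\<^sup>2 * (cmod (a s k))\<^sup>2) \<partial>int_counting)"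
proof -
  define D where "D x = complex_of_real (g s (x + h) - g s x)" for x
  note bg = bdd_borel_g[of s] and bu = bdd_borel_u[OF s]
  have pg: "complex_of_real (g s (x + 2 * pi)) = complex_of_real (g s x)" for x
    by (simp add: g_periodic)
  have bD: "bdd_borel D"
    using bdd_borel_diff[OF bdd_borel_shift[OF bg, of h] bg] by (simp add: D_def[abs_def])
  have cD: "torus_coeff D k = (cis (of_int k * h) - 1) * q s k" for k
    using torus_coeff_diff[OF bdd_borel_shift[OF bg, of h] bg, of k] torus_coeff_shift[OF bg pg h, of k]
    by (simp add: D_def[abs_def] q_def algebra_simps)
  have bU: "bdd_borel (\<lambda>x. complex_of_real (u s (x + h) - u s x))"
    using bdd_borel_diff[OF bdd_borel_shift[OF bu, of h] bu] by simp
  have intU: "integrable torus (\<lambda>x. (u s (x + h) - u s x)\<^sup>2)"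
    using integrable_torus_cmod_sq[OF bU] by (simp only: norm_of_real power2_abs)
  have "(\<integral>\<^sup>+k. ennreal ((cmod (cis (of_int k * h) - 1))\<^sup>2 * (cmod (q s k))\<^sup>2) \<partial>int_counting)
       = (\<integral>\<^sup>+k. ennreal ((cmod (torus_coeff D k))\<^sup>2) \<partial>int_counting)"
    by (simp add: cD norm_mult power_mult_distrib)
  also have "\<dots> \<le> ennreal ((1 / (2 * pi)) * (LINT x|torus. (cmod (D x))\<^sup>2))"
    by (rule bessel[OF bD])
  also have "\<dots> \<le> ennreal ((1 / (2 * pi)) * (LINT x|torus. lip_g\<^sup>2 * (u s (x + h) - u s x)\<^sup>2))"
  proof (intro ennreal_leI mult_left_mono integral_mono integrable_torus_cmod_sq[OF bD] integrable_mult_right intU)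
    fix x
    have "\<bar>g s (x + h) - g s x\<bar> \<le> lip_g * \<bar>u s (x + h) - u s x\<bar>"
      using cubic_lipschitz[OF u_le u_le, of s s] s by (simp add: g_def)
    then have "\<bar>g s (x + h) - g s x\<bar>\<^sup>2 \<le> (lip_g * \<bar>u s (x + h) - u s x\<bar>)\<^sup>2"
      by (intro power_mono) auto
    then show "(cmod (D x))\<^sup>2 \<le> lip_g\<^sup>2 * (u s (x + h) - u s x)\<^sup>2"
      unfolding D_def norm_of_real by (simp add: power_mult_distrib)
  qed simp
  also have "\<dots> = ennreal (lip_g\<^sup>2) * ennreal ((1 / (2 * pi)) * (LINT x|torus. (u s (x + h) - u s x)\<^sup>2))"
    by (simp add: mult_ac flip: ennreal_mult)
  finally show ?thesis by (simp only: parseval_difference[OF s h])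
qed

lemma sobolev_energy_nonlinear:
  assumes s: "s > 0" and \<rho>: "0 < \<rho>" "\<rho> < 2"
  shows "sobolev_energy \<rho> (q s) \<le> ennreal (lip_g\<^sup>2) * sobolev_energy \<rho> (a s)"
proof -
  have m: "(\<lambda>h. ennreal (h powr (- 1 - \<rho>)) * indicator {0<..} h * (\<integral>\<^sup>+k. ennreal ((cmod (cis (of_int k * h) - 1))\<^sup>2 * (cmod (a s k))\<^sup>2) \<partial>int_counting)) \<in> borel_measurable lborel"
  proof -
    interpret Z: sigma_finite_measure int_counting by (rule sigma_finite_measure_count_space)
    have "(\<lambda>p. (\<lambda>k p. ennreal ((cmod (cis (of_int k * fst p) - 1))\<^sup>2 * (cmod (a s k))\<^sup>2)) (snd p) p) \<in> borel_measurable (borel \<Otimes>\<^sub>M int_counting)"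
      by (rule measurable_compose_countable) measurable
    then have [measurable]: "(\<lambda>h. \<integral>\<^sup>+k. ennreal ((cmod (cis (of_int k * h) - 1))\<^sup>2 * (cmod (a s k))\<^sup>2) \<partial>int_counting) \<in> borel_measurable borel"
      using Z.borel_measurable_nn_integral_fst[of "\<lambda>p. ennreal ((cmod (cis (of_int (snd p) * fst p) - 1))\<^sup>2 * (cmod (a s (snd p)))\<^sup>2)" borel] by simp
    show ?thesis by measurable
  qed
  have "gagliardo_constant \<rho> * sobolev_energy \<rho> (q s) \<le> (\<integral>\<^sup>+h. ennreal (lip_g\<^sup>2) * (ennreal (h powr (- 1 - \<rho>)) * indicator {0<..} h *
          (\<integral>\<^sup>+k. ennreal ((cmod (cis (of_int k * h) - 1))\<^sup>2 * (cmod (a s k))\<^sup>2) \<partial>int_counting)) \<partial>lborel)"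
    unfolding gagliardo_identity
  proof (rule nn_integral_mono)
    fix h :: real
    show "ennreal (h powr (- 1 - \<rho>)) * indicator {0<..} h * (\<integral>\<^sup>+k. ennreal ((cmod (cis (of_int k * h) - 1))\<^sup>2 * (cmod (q s k))\<^sup>2) \<partial>int_counting)
      \<le> ennreal (lip_g\<^sup>2) * (ennreal (h powr (- 1 - \<rho>)) * indicator {0<..} h * (\<integral>\<^sup>+k. ennreal ((cmod (cis (of_int k * h) - 1))\<^sup>2 * (cmod (a s k))\<^sup>2) \<partial>int_counting))"
    proof (cases "h > 0")
      case True
      then show ?thesis
        using mult_left_mono[OF nonlinear_difference_bound[OF s, of h], of "ennreal (h powr (- 1 - \<rho>))"]
        by (simp add: mult_ac)
    qed simp
  qed
  also have "\<dots> = ennreal (lip_g\<^sup>2) * (gagliardo_constant \<rho> * sobolev_energy \<rho> (a s))"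
    unfolding gagliardo_identity by (rule nn_integral_cmult[OF m])
  finally have "gagliardo_constant \<rho> * sobolev_energy \<rho> (q s) \<le> gagliardo_constant \<rho> * (ennreal (lip_g\<^sup>2) * sobolev_energy \<rho> (a s))"
    by (simp add: mult_ac)
  then show ?thesis
    using gagliardo_constant_pos[of \<rho>] gagliardo_constant_finite[OF \<rho>]
    by (subst (asm) ennreal_mult_le_mult_iff) auto
qed

end

section \<open>Preservation of oddness\<close>

lemma nn_integral_int_measurable:
  fixes F :: "int \<Rightarrow> real \<Rightarrow> ennreal"
  assumes "\<And>k. F k \<in> borel_measurable borel"
  shows "(\<lambda>r. \<integral>\<^sup>+k. F k r \<partial>int_counting) \<in> borel_measurable borel"
proof -
  interpret Z: sigma_finite_measure int_counting by (rule sigma_finite_measure_count_space)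
  have "(\<lambda>p. (\<lambda>k p. F k (fst p)) (snd p) p) \<in> borel_measurable (borel \<Otimes>\<^sub>M int_counting)"
    by (rule measurable_compose_countable) (use assms in measurable)
  then show ?thesis
    using Z.borel_measurable_nn_integral_fst[of "\<lambda>p. F (snd p) (fst p)" borel] by simp
qed

lemma bounded_integrable_time:
  fixes f :: "real \<Rightarrow> 'b :: {banach, second_countable_topology}"
  assumes "f \<in> borel_measurable borel" "\<And>s. s \<in> {0<..<t} \<Longrightarrow> norm (f s) \<le> B"
  shows "integrable (time_interval t) f"
proof -
  interpret T: finite_measure "time_interval t" by (rule finite_measure_time_interval)
  show ?thesis by (rule T.integrable_const_bound[where B = B]) (use assms in auto)
qed

context bounded_mild
begin

lemma Re_u0_coeff: "Re (u0_coeff k) = 0"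
proof -
  define f where "f x = complex_of_real (u0 x) * cis (- (of_int k * x))" for x
  have "cnj (u0_coeff k) = fourier_coeff u0 (- k)"
    by (simp add: u0_coeff_def fourier_coeff_minus)
  also have "\<dots> = - (1 / (2 * pi)) *\<^sub>R (LINT x|lebesgue_on {-pi..pi}. f (- x))"
    by (simp add: fourier_coeff_def f_def u0_odd)
  also have "(LINT x|lebesgue_on {-pi..pi}. f (- x)) = (LINT x|lebesgue_on {-pi..pi}. f x)"
    using Equivalence_Lebesgue_Henstock_Integration.integral_reflect_real[of pi "-pi" f] by simp
  finally have "cnj (u0_coeff k) = - u0_coeff k"
    by (simp add: u0_coeff_def fourier_coeff_def f_def[abs_def])
  then show ?thesis by (simp add: complex_eq_iff)
qed

text \<open>
  \<open>Re (a s k)\<close> is half the coefficient of \<open>u(x) + u(- x)\<close>, and \<open>v - v\<^sup>3\<close> is an odd Lipschitz function, so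
  the same Bessel--Parseval argument applies as for differences.
\<close>

lemma even_part_bound:
  assumes s: "s > 0"
  shows "(\<integral>\<^sup>+k. ennreal ((Re (q s k))\<^sup>2) \<partial>int_counting) \<le> ennreal (lip_g\<^sup>2) * (\<integral>\<^sup>+k. ennreal ((Re (a s k))\<^sup>2) \<partial>int_counting)"
proof -
  define W where "W x = complex_of_real (u s x + u s (- x))" for x
  define G where "G x = complex_of_real (g s x + g s (- x))" for x
  note bg = bdd_borel_g[of s] and bu = bdd_borel_u[OF s]
  have bW: "bdd_borel W" using bdd_borel_add[OF bu bdd_borel_reflect[OF bu]] by (simp add: W_def[abs_def])
  have bG: "bdd_borel G" using bdd_borel_add[OF bg bdd_borel_reflect[OF bg]] by (simp add: G_def[abs_def])
  have cnj2: "z + cnj z = complex_of_real (2 * Re z)" for z by (simp add: complex_eq_iff)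
  have cW: "torus_coeff W k = complex_of_real (2 * Re (a s k))" for k
  proof -
    have "torus_coeff W k = a s k + a s (- k)"
      using torus_coeff_add[OF bu bdd_borel_reflect[OF bu], of k] torus_coeff_reflect[of "\<lambda>x. complex_of_real (u s x)" k]
      by (simp add: W_def[abs_def] a_def)
    then show ?thesis by (simp only: a_minus cnj2)
  qed
  have cWm: "torus_coeff W (- k) = complex_of_real (2 * Re (a s k))" for k
    unfolding cW a_minus by simp
  have cG: "torus_coeff G k = complex_of_real (2 * Re (q s k))" for k
  proof -
    have "torus_coeff G k = q s k + q s (- k)"
      using torus_coeff_add[OF bg bdd_borel_reflect[OF bg], of k] torus_coeff_reflect[of "\<lambda>x. complex_of_real (g s x)" k]
      by (simp add: G_def[abs_def] q_def)
    then show ?thesis by (simp only: q_minus cnj2)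
  qed
  note iW = u_pairing_integrable[OF s bW]
  have pt: "Re (a s k * torus_coeff W (- k)) = 2 * (Re (a s k))\<^sup>2" for k
    unfolding cWm by (simp add: power2_eq_square)
  have refl: "(LINT x|torus. complex_of_real (u s (- x)) * W x) = (LINT x|torus. complex_of_real (u s x) * W x)"
    using integral_reflect[of "\<lambda>x. complex_of_real (u s x) * W x"] by (simp add: W_def add.commute)
  have "(LINT x|torus. W x * W x) = (LINT x|torus. complex_of_real (u s x) * W x + complex_of_real (u s (- x)) * W x)"
    by (simp add: W_def algebra_simps)
  also have "\<dots> = (LINT x|torus. complex_of_real (u s x) * W x) + (LINT x|torus. complex_of_real (u s (- x)) * W x)"
    by (intro Bochner_Integration.integral_add bdd_borel_integrable bdd_borel_mult bW bu bdd_borel_reflect[OF bu])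
  finally have "(1 / (2 * pi)) *\<^sub>R (LINT x|torus. W x * W x) = 2 * (LINT k|int_counting. a s k * torus_coeff W (- k))"
    by (simp add: refl u_pairing[OF s bW, symmetric] scaleR_conv_of_real)
  then have "(1 / (2 * pi)) * Re (LINT x|torus. W x * W x) = 2 * Re (LINT k|int_counting. a s k * torus_coeff W (- k))"
    by (metis Re_complex_of_real scaleR_complex.sel(1) mult_2 plus_complex.sel(1))
  also have "Re (LINT k|int_counting. a s k * torus_coeff W (- k)) = (LINT k|int_counting. 2 * (Re (a s k))\<^sup>2)"
    unfolding integral_Re[OF iW, symmetric] by (simp only: pt)
  finally have ReW: "(1 / (2 * pi)) * Re (LINT x|torus. W x * W x) = 4 * (LINT k|int_counting. (Re (a s k))\<^sup>2)"
    by simp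
  have "integrable int_counting (\<lambda>k. 2 * (Re (a s k))\<^sup>2)"
    using integrable_Re[OF iW] by (simp only: pt)
  from integrable_mult_right[OF this, of "1/2"]
  have iRe: "integrable int_counting (\<lambda>k. (Re (a s k))\<^sup>2)" by simp
  have W2: "W x * W x = complex_of_real ((cmod (W x))\<^sup>2)" for x
    unfolding W_def norm_of_real power2_abs by (simp only: power2_eq_square of_real_mult)
  have "(LINT x|torus. W x * W x) = complex_of_real (LINT x|torus. (cmod (W x))\<^sup>2)"
    unfolding W2 by (rule integral_complex_of_real)
  then have normW: "(1 / (2 * pi)) * (LINT x|torus. (cmod (W x))\<^sup>2) = 4 * (LINT k|int_counting. (Re (a s k))\<^sup>2)"
    using ReW by simp
  have "ennreal 4 * (\<integral>\<^sup>+k. ennreal ((Re (q s k))\<^sup>2) \<partial>int_counting) = (\<integral>\<^sup>+k. ennreal ((cmod (torus_coeff G k))\<^sup>2) \<partial>int_counting)"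
    by (subst nn_integral_cmult[symmetric]) (auto simp: cG norm_mult power_mult_distrib ennreal_mult)
  also have "\<dots> \<le> ennreal ((1 / (2 * pi)) * (LINT x|torus. (cmod (G x))\<^sup>2))"
    by (rule bessel[OF bG])
  also have "\<dots> \<le> ennreal ((1 / (2 * pi)) * (LINT x|torus. lip_g\<^sup>2 * (cmod (W x))\<^sup>2))"
  proof (intro ennreal_leI mult_left_mono integral_mono integrable_torus_cmod_sq[OF bG] integrable_mult_right integrable_torus_cmod_sq[OF bW])
    fix x
    have "\<bar>g s x + g s (- x)\<bar> \<le> lip_g * \<bar>u s x + u s (- x)\<bar>"
      using cubic_lipschitz_odd[OF u_le u_le, of s s] s by (simp add: g_def)
    then have "\<bar>g s x + g s (- x)\<bar>\<^sup>2 \<le> (lip_g * \<bar>u s x + u s (- x)\<bar>)\<^sup>2"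
      by (intro power_mono) auto
    then show "(cmod (G x))\<^sup>2 \<le> lip_g\<^sup>2 * (cmod (W x))\<^sup>2"
      unfolding G_def W_def norm_of_real by (simp add: power_mult_distrib)
  qed simp
  also have "\<dots> = ennreal (lip_g\<^sup>2 * (4 * (LINT k|int_counting. (Re (a s k))\<^sup>2)))"
    unfolding normW[symmetric] by simp
  also have "\<dots> = ennreal 4 * (ennreal (lip_g\<^sup>2) * ennreal (LINT k|int_counting. (Re (a s k))\<^sup>2))"
    by (simp add: ennreal_mult mult_ac)
  also have "ennreal (LINT k|int_counting. (Re (a s k))\<^sup>2) = (\<integral>\<^sup>+k. ennreal ((Re (a s k))\<^sup>2) \<partial>int_counting)"
    by (rule nn_integral_eq_integral[symmetric, OF iRe]) simp
  finally show ?thesis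
    by (subst (asm) ennreal_mult_le_mult_iff) auto
qed

text \<open>
  The real parts of the coefficients vanish initially, and by Duhamel's formula the sum of their squares
  is bounded by a multiple of its own time integral.
\<close>

lemma Re_a_zero:
  assumes "t > 0" shows "Re (a t k) = 0"
proof -
  define y where "y s = (\<integral>\<^sup>+k. ennreal ((Re (a s k))\<^sup>2) \<partial>int_counting)" for s
  have bound: "y s \<le> ennreal (sup_u\<^sup>2)" if s: "s > 0" for s
  proof -
    have "y s \<le> (\<integral>\<^sup>+k. ennreal ((cmod (a s k))\<^sup>2) \<partial>int_counting)"
      unfolding y_def by (intro nn_integral_mono ennreal_leI) (simp add: cmod_power2)
    also have "\<dots> \<le> ennreal ((1 / (2 * pi)) * (2 * pi * sup_u\<^sup>2))"
      unfolding parseval_u[OF s]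
    proof (intro ennreal_leI mult_left_mono)
      have [measurable]: "u s \<in> borel_measurable borel" by (rule u_measurable[OF s])
      have "\<bar>u s x\<bar>\<^sup>2 \<le> sup_u\<^sup>2" for x using u_le[of s x] s by (intro power_mono) auto
      then show "(LINT x|torus. (u s x)\<^sup>2) \<le> 2 * pi * sup_u\<^sup>2"
        using norm_integral_torus_le[of "\<lambda>x. (u s x)\<^sup>2" "sup_u\<^sup>2"] by simp
    qed simp
    finally show ?thesis by simp
  qed
  have step: "y s \<le> ennreal (t * lip_g\<^sup>2) * (\<integral>\<^sup>+r. y r * indicator {0<..<s} r \<partial>lborel)" if s: "0 < s" "s \<le> t" for s
  proof -
    interpret T: finite_measure "time_interval s" by (rule finite_measure_time_interval)
    have "ennreal ((Re (a s k))\<^sup>2) \<le> ennreal s * (\<integral>\<^sup>+r. ennreal ((Re (q r k))\<^sup>2) \<partial>time_interval s)" for k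
    proof -
      define f where "f r = heat_symbol \<nu> \<gamma> (s - r) k * Re (q r k)" for r
      have fm [measurable]: "f \<in> borel_measurable borel" unfolding f_def by measurable
      have heat: "heat_symbol \<nu> \<gamma> (s - r) k \<le> 1" if "r < s" for r
        using that \<nu>_pos by (intro heat_symbol_le_1) auto
      have fle: "\<bar>f r\<bar> \<le> \<bar>Re (q r k)\<bar>" if "r < s" for r
        using mult_right_mono[OF heat[OF that] abs_ge_zero[of "Re (q r k)"]] heat_symbol_pos[of \<nu> \<gamma> "s - r" k]
        by (simp add: f_def abs_mult)
      have int: "integrable (time_interval s) (\<lambda>r. of_real (heat_symbol \<nu> \<gamma> (s - r) k) * q r k)"
      proof (rule bounded_integrable_time[where B = sup_g])
        fix r assume "r \<in> {0<..<s}"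
        then have "heat_symbol \<nu> \<gamma> (s - r) k * cmod (q r k) \<le> 1 * sup_g"
          by (intro mult_mono heat norm_q_le) auto
        then show "cmod (of_real (heat_symbol \<nu> \<gamma> (s - r) k) * q r k) \<le> sup_g"
          using heat_symbol_pos[of \<nu> \<gamma> "s - r" k] by (simp add: norm_mult)
      qed measurable
      have "Re (a s k) = (LINT r|time_interval s. f r)"
        unfolding duhamel[OF s(1)] using integral_Re[OF int] by (simp add: f_def Re_u0_coeff)
      moreover have "integrable (time_interval s) f"
        using integrable_Re[OF int] by (simp add: f_def[abs_def])
      ultimately have "ennreal \<bar>Re (a s k)\<bar> \<le> (\<integral>\<^sup>+r. ennreal \<bar>f r\<bar> \<partial>time_interval s)"
        using integral_norm_bound_ennreal[of "time_interval s" f] by simp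
      also have "\<dots> \<le> (\<integral>\<^sup>+r. 1 * ennreal \<bar>Re (q r k)\<bar> \<partial>time_interval s)"
        by (intro nn_integral_mono) (auto intro!: ennreal_leI fle)
      finally have "(ennreal \<bar>Re (a s k)\<bar>)\<^sup>2 \<le> (\<integral>\<^sup>+r. 1 * ennreal \<bar>Re (q r k)\<bar> \<partial>time_interval s)\<^sup>2"
        by (intro power_mono) auto
      also have "\<dots> \<le> (\<integral>\<^sup>+r. 1\<^sup>2 \<partial>time_interval s) * (\<integral>\<^sup>+r. (ennreal \<bar>Re (q r k)\<bar>)\<^sup>2 \<partial>time_interval s)"
        by (rule Cauchy_Schwarz_nn_integral) (auto intro!: borel_measurable_time_interval)
      also have "(\<integral>\<^sup>+r. 1\<^sup>2 \<partial>time_interval s) = ennreal s"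
        using s T.emeasure_eq_measure[of "{0<..<s}"] by simp
      finally show ?thesis by (simp add: ennreal_power)
    qed
    then have "y s \<le> (\<integral>\<^sup>+k. ennreal s * (\<integral>\<^sup>+r. ennreal ((Re (q r k))\<^sup>2) \<partial>time_interval s) \<partial>int_counting)"
      unfolding y_def by (intro nn_integral_mono) auto
    also have "\<dots> = ennreal s * (\<integral>\<^sup>+k. (\<integral>\<^sup>+r. ennreal ((Re (q r k))\<^sup>2) \<partial>time_interval s) \<partial>int_counting)"
      by (rule nn_integral_cmult) simp
    also have "(\<integral>\<^sup>+k. (\<integral>\<^sup>+r. ennreal ((Re (q r k))\<^sup>2) \<partial>time_interval s) \<partial>int_counting)
        = (\<integral>\<^sup>+r. (\<integral>\<^sup>+k. ennreal ((Re (q r k))\<^sup>2) \<partial>int_counting) \<partial>time_interval s)"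
      by (rule nn_integral_count_space_nn_integral[symmetric]) (auto intro!: borel_measurable_time_interval)
    also have "\<dots> \<le> (\<integral>\<^sup>+r. ennreal (lip_g\<^sup>2) * y r \<partial>time_interval s)"
      unfolding y_def by (intro nn_integral_mono even_part_bound) auto
    also have "\<dots> = ennreal (lip_g\<^sup>2) * (\<integral>\<^sup>+r. y r \<partial>time_interval s)"
    proof (rule nn_integral_cmult)
      have am [measurable]: "(\<lambda>r. torus_coeff (\<lambda>x. of_real (if r > 0 then u r x else 0)) k) \<in> borel_measurable borel" for k
        by (rule torus_coeff_parametric_measurable[OF u_pair_measurable])
      have "(\<lambda>r. \<integral>\<^sup>+k. ennreal ((Re (torus_coeff (\<lambda>x. of_real (if r > 0 then u r x else 0)) k))\<^sup>2) \<partial>int_counting) \<in> borel_measurable borel"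
        by (rule nn_integral_int_measurable) measurable
      then have "(\<lambda>r. \<integral>\<^sup>+k. ennreal ((Re (torus_coeff (\<lambda>x. of_real (if r > 0 then u r x else 0)) k))\<^sup>2) \<partial>int_counting) \<in> borel_measurable (time_interval s)"
        by (rule borel_measurable_time_interval)
      then show "y \<in> borel_measurable (time_interval s)"
        by (subst measurable_cong[where g = "\<lambda>r. \<integral>\<^sup>+k. ennreal ((Re (torus_coeff (\<lambda>x. of_real (if r > 0 then u r x else 0)) k))\<^sup>2) \<partial>int_counting"])
           (auto simp: y_def a_def)
    qed
    also have "(\<integral>\<^sup>+r. y r \<partial>time_interval s) = (\<integral>\<^sup>+r. y r * indicator {0<..<s} r \<partial>lborel)"
      by (simp add: time_interval_def nn_integral_restrict_space)
    finally have "y s \<le> ennreal s * (ennreal (lip_g\<^sup>2) * (\<integral>\<^sup>+r. y r * indicator {0<..<s} r \<partial>lborel))"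
      by (simp add: mult_left_mono)
    also have "\<dots> = ennreal (s * lip_g\<^sup>2) * (\<integral>\<^sup>+r. y r * indicator {0<..<s} r \<partial>lborel)"
      using s by (simp add: ennreal_mult mult.assoc)
    also have "\<dots> \<le> ennreal (t * lip_g\<^sup>2) * (\<integral>\<^sup>+r. y r * indicator {0<..<s} r \<partial>lborel)"
      using s by (intro mult_right_mono ennreal_leI) auto
    finally show ?thesis .
  qed
  have "y t = 0"
    by (rule gronwall_zero[where T = t, OF _ bound step]) (use assms lip_g_pos in auto)
  then show ?thesis
    by (auto simp: y_def nn_integral_0_iff_AE AE_count_space)
qed

lemma norm_a_eq: "t > 0 \<Longrightarrow> cmod (a t k) = \<bar>Im (a t k)\<bar>"
  using Re_a_zero[of t k] by (simp add: cmod_def)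

end

section \<open>Smoothing past one derivative\<close>

lemma abs_int_ge_1: "k \<noteq> 0 \<Longrightarrow> \<bar>real_of_int k\<bar> \<ge> 1"
  by linarith

lemma nn_integral_exp_decay_le:
  assumes "l > 0" "t0 \<le> t"
  shows "(\<integral>\<^sup>+s. ennreal (exp (- (l * (t - s)))) * indicator {t0..<t} s \<partial>lborel) \<le> ennreal (1 / l)"
proof -
  have "(\<integral>\<^sup>+s. ennreal (exp (- (l * (t - s)))) * indicator {t0..<t} s \<partial>lborel)
      \<le> (\<integral>\<^sup>+s. ennreal (exp (- (l * (t - s)))) * indicator {t0..t} s \<partial>lborel)"
    by (intro nn_integral_mono) (auto simp: indicator_def)
  also have "\<dots> = ennreal (exp (- (l * (t - t))) / l - exp (- (l * (t - t0))) / l)"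
    using assms by (intro nn_integral_FTC_Icc) (auto intro!: derivative_eq_intros)
  also have "\<dots> \<le> ennreal (1 / l)"
    using assms by (intro ennreal_leI) simp
  finally show ?thesis .
qed

lemma square_sum_le: "(x + y)\<^sup>2 \<le> 2 * x\<^sup>2 + 2 * (y::real)\<^sup>2"
  using sum_squares_bound[of x y] by (simp add: power2_sum)

context bounded_mild
begin

text \<open>
  The linear damping rate of the mode \<open>k\<close>, without the growth rate \<open>1\<close>.
\<close>

definition lam :: "int \<Rightarrow> real" where
  "lam k = \<nu> * \<bar>real_of_int k\<bar> powr \<gamma>"

lemma heat_symbol_lam: "heat_symbol \<nu> \<gamma> \<tau> k = exp (- (lam k * \<tau>))"
  by (simp add: heat_symbol_def lam_def frac_laplacian_symbol_def mult_ac)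

lemma lam_ge: "\<bar>real_of_int k\<bar> powr \<gamma> \<le> lam k"
  using mult_right_mono[OF \<nu>_ge_1, of "\<bar>real_of_int k\<bar> powr \<gamma>"] by (simp add: lam_def)

lemma lam_ge_1: "k \<noteq> 0 \<Longrightarrow> lam k \<ge> 1"
  using lam_ge[of k] ge_one_powr_ge_zero[of "\<bar>real_of_int k\<bar>" \<gamma>] abs_int_ge_1[of k] \<gamma>_pos by simp

lemma heat_q_set_integrable:
  assumes "t0 \<le> t"
  shows "set_integrable lborel {t0..<t} (\<lambda>s. of_real (heat_symbol \<nu> \<gamma> (t - s) k) * q s k)"
proof -
  define f where "f s = of_real (heat_symbol \<nu> \<gamma> (t - min s t) k) * q s k" for s
  have fm: "f \<in> borel_measurable borel" unfolding f_def by measurable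
  have "set_integrable lborel {t0..<t} f"
  proof (rule set_integrable_Ico_bounded[where B = sup_g, OF fm])
    fix s
    have "heat_symbol \<nu> \<gamma> (t - min s t) k * cmod (q s k) \<le> 1 * sup_g"
      using \<nu>_pos by (intro mult_mono heat_symbol_le_1 norm_q_le) auto
    then show "cmod (f s) \<le> sup_g"
      using heat_symbol_pos[of \<nu> \<gamma> "t - min s t" k] by (simp add: norm_mult f_def)
  qed
  then show ?thesis
    by (rule set_integrable_cong[THEN iffD1, rotated -1]) (auto simp: f_def)
qed

lemma duhamel_restart:
  assumes "0 < t0" "t0 \<le> t"
  shows "a t k = of_real (heat_symbol \<nu> \<gamma> (t - t0) k) * a t0 k
     + (LINT s:{t0..<t}|lborel. of_real (heat_symbol \<nu> \<gamma> (t - s) k) * q s k)"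
proof -
  have ti: "(LINT s|time_interval r. f s) = (LINT s:{0<..<r}|lborel. f s)" for r and f :: "real \<Rightarrow> complex"
    by (simp add: time_interval_def integral_restrict_space set_lebesgue_integral_def)
  have mult: "heat_symbol \<nu> \<gamma> (t - t0) k * heat_symbol \<nu> \<gamma> (t0 - s) k = heat_symbol \<nu> \<gamma> (t - s) k" for s
    by (simp add: heat_symbol_lam algebra_simps flip: exp_add)
  define f where "f s = of_real (heat_symbol \<nu> \<gamma> (t - s) k) * q s k" for s
  have fs: "of_real (heat_symbol \<nu> \<gamma> (t - s) k) * q s k
      = of_real (heat_symbol \<nu> \<gamma> (t - t0) k) * (of_real (heat_symbol \<nu> \<gamma> (t0 - s) k) * q s k)" for s
    by (simp only: mult of_real_mult[symmetric] mult.assoc[symmetric])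
  have i1: "set_integrable lborel {0<..<t0} f"
    by (rule set_integrable_subset[of _ "{0..<t}"]) (use heat_q_set_integrable[of 0 t k] assms in \<open>auto simp: f_def[abs_def]\<close>)
  have i2: "set_integrable lborel {t0..<t} f"
    using heat_q_set_integrable[of t0 t k] assms by (simp add: f_def[abs_def])
  have un: "{0<..<t} = {0<..<t0} \<union> {t0..<t}" using assms by auto
  have "a t k = of_real (heat_symbol \<nu> \<gamma> t k) * u0_coeff k + (LINT s:{0<..<t}|lborel. f s)"
    using duhamel[of t k] assms by (simp add: ti f_def)
  also have "(LINT s:{0<..<t}|lborel. f s) = (LINT s:{0<..<t0}|lborel. f s) + (LINT s:{t0..<t}|lborel. f s)"
    unfolding un by (rule set_integral_Un) (use i1 i2 in auto)
  also have "(LINT s:{0<..<t0}|lborel. f s)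
      = (LINT s:{0<..<t0}|lborel. of_real (heat_symbol \<nu> \<gamma> (t - t0) k) * (of_real (heat_symbol \<nu> \<gamma> (t0 - s) k) * q s k))"
    by (simp only: f_def fs)
  also have "\<dots> = of_real (heat_symbol \<nu> \<gamma> (t - t0) k) * (LINT s:{0<..<t0}|lborel. of_real (heat_symbol \<nu> \<gamma> (t0 - s) k) * q s k)"
    by simp
  also have "of_real (heat_symbol \<nu> \<gamma> t k) * u0_coeff k + (\<dots> + (LINT s:{t0..<t}|lborel. f s))
      = of_real (heat_symbol \<nu> \<gamma> (t - t0) k) * a t0 k + (LINT s:{t0..<t}|lborel. f s)"
    using duhamel[of t0 k] assms mult[of 0] by (simp add: ti distrib_left mult.assoc[symmetric] flip: of_real_mult)
  finally show ?thesis by (simp add: f_def)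
qed

text \<open>Cauchy--Schwarz in time, with the exponential kernel as weight.\<close>

lemma duhamel_square_bound:
  assumes "0 < t0" "t0 \<le> t" "k \<noteq> 0"
  shows "ennreal ((cmod (a t k))\<^sup>2) \<le> ennreal (2 * (exp (- (lam k * (t - t0))))\<^sup>2 * sup_u\<^sup>2)
     + ennreal (2 / lam k) * (\<integral>\<^sup>+s. ennreal (exp (- (lam k * (t - s))) * (cmod (q s k))\<^sup>2) * indicator {t0..<t} s \<partial>lborel)"
proof -
  have lam: "lam k > 0" using lam_ge_1[OF assms(3)] by simp
  define f where "f s = of_real (heat_symbol \<nu> \<gamma> (t - s) k) * q s k" for s
  define e where "e s = exp (- (lam k * (t - s)))" for s
  define I where "I = (LINT s:{t0..<t}|lborel. f s)"
  have int: "integrable lborel (\<lambda>s. indicator {t0..<t} s *\<^sub>R f s)"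
    using heat_q_set_integrable[OF assms(2), of k] by (simp add: f_def[abs_def] set_integrable_def)
  have "ennreal (cmod I) \<le> (\<integral>\<^sup>+s. ennreal (cmod (indicator {t0..<t} s *\<^sub>R f s)) \<partial>lborel)"
    using integral_norm_bound_ennreal[OF int] by (simp add: I_def set_lebesgue_integral_def)
  also have "\<dots> = (\<integral>\<^sup>+s. (ennreal (sqrt (e s)) * indicator {t0..<t} s) * (ennreal (sqrt (e s) * cmod (q s k)) * indicator {t0..<t} s) \<partial>lborel)"
    by (intro nn_integral_cong)
       (auto simp: indicator_def f_def norm_mult heat_symbol_lam e_def mult.assoc[symmetric] simp flip: ennreal_mult)
  finally have "(ennreal (cmod I))\<^sup>2 \<le> (\<integral>\<^sup>+s. (ennreal (sqrt (e s)) * indicator {t0..<t} s) * (ennreal (sqrt (e s) * cmod (q s k)) * indicator {t0..<t} s) \<partial>lborel)\<^sup>2"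
    by (intro power_mono) auto
  also have "\<dots> \<le> (\<integral>\<^sup>+s. (ennreal (sqrt (e s)) * indicator {t0..<t} s)\<^sup>2 \<partial>lborel) * (\<integral>\<^sup>+s. (ennreal (sqrt (e s) * cmod (q s k)) * indicator {t0..<t} s)\<^sup>2 \<partial>lborel)"
    by (rule Cauchy_Schwarz_nn_integral) (auto simp: e_def)
  also have "(\<integral>\<^sup>+s. (ennreal (sqrt (e s)) * indicator {t0..<t} s)\<^sup>2 \<partial>lborel) = (\<integral>\<^sup>+s. ennreal (e s) * indicator {t0..<t} s \<partial>lborel)"
    by (intro nn_integral_cong) (auto simp: indicator_def ennreal_power e_def)
  also have "(\<integral>\<^sup>+s. (ennreal (sqrt (e s) * cmod (q s k)) * indicator {t0..<t} s)\<^sup>2 \<partial>lborel) = (\<integral>\<^sup>+s. ennreal (e s * (cmod (q s k))\<^sup>2) * indicator {t0..<t} s \<partial>lborel)"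
    by (intro nn_integral_cong) (auto simp: indicator_def ennreal_power e_def power_mult_distrib)
  also have "(\<integral>\<^sup>+s. ennreal (e s) * indicator {t0..<t} s \<partial>lborel) * (\<integral>\<^sup>+s. ennreal (e s * (cmod (q s k))\<^sup>2) * indicator {t0..<t} s \<partial>lborel)
       \<le> ennreal (1 / lam k) * (\<integral>\<^sup>+s. ennreal (e s * (cmod (q s k))\<^sup>2) * indicator {t0..<t} s \<partial>lborel)"
    unfolding e_def by (intro mult_right_mono nn_integral_exp_decay_le lam assms) simp
  finally have I2: "ennreal ((cmod I)\<^sup>2) \<le> ennreal (1 / lam k) * (\<integral>\<^sup>+s. ennreal (e s * (cmod (q s k))\<^sup>2) * indicator {t0..<t} s \<partial>lborel)"
    by (simp add: ennreal_power)
  have "cmod (a t k) \<le> exp (- (lam k * (t - t0))) * sup_u + cmod I"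
  proof -
    have "cmod (a t k) \<le> cmod (of_real (heat_symbol \<nu> \<gamma> (t - t0) k) * a t0 k) + cmod I"
      unfolding duhamel_restart[OF assms(1,2)] I_def f_def by (rule norm_triangle_ineq)
    also have "cmod (of_real (heat_symbol \<nu> \<gamma> (t - t0) k) * a t0 k) \<le> exp (- (lam k * (t - t0))) * sup_u"
      using norm_a_le[OF assms(1), of k] by (simp add: norm_mult heat_symbol_lam mult_left_mono)
    finally show ?thesis by simp
  qed
  then have "(cmod (a t k))\<^sup>2 \<le> (exp (- (lam k * (t - t0))) * sup_u + cmod I)\<^sup>2"
    by (intro power_mono) auto
  also have "\<dots> \<le> 2 * (exp (- (lam k * (t - t0))) * sup_u)\<^sup>2 + 2 * (cmod I)\<^sup>2"
    by (rule square_sum_le)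
  finally have "ennreal ((cmod (a t k))\<^sup>2) \<le> ennreal (2 * (exp (- (lam k * (t - t0))) * sup_u)\<^sup>2 + 2 * (cmod I)\<^sup>2)"
    by (rule ennreal_leI)
  also have "\<dots> = ennreal (2 * (exp (- (lam k * (t - t0))))\<^sup>2 * sup_u\<^sup>2) + 2 * ennreal ((cmod I)\<^sup>2)"
    by (simp add: power_mult_distrib ennreal_plus ennreal_mult mult.assoc)
  also have "\<dots> \<le> ennreal (2 * (exp (- (lam k * (t - t0))))\<^sup>2 * sup_u\<^sup>2) + 2 * (ennreal (1 / lam k) * (\<integral>\<^sup>+s. ennreal (e s * (cmod (q s k))\<^sup>2) * indicator {t0..<t} s \<partial>lborel))"
    by (intro add_left_mono mult_left_mono I2) simp
  also have "2 * (ennreal (1 / lam k) * (\<integral>\<^sup>+s. ennreal (e s * (cmod (q s k))\<^sup>2) * indicator {t0..<t} s \<partial>lborel))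
     = ennreal (2 / lam k) * (\<integral>\<^sup>+s. ennreal (e s * (cmod (q s k))\<^sup>2) * indicator {t0..<t} s \<partial>lborel)"
  proof -
    have "ennreal (2 / lam k) = 2 * ennreal (1 / lam k)"
      using lam ennreal_mult[of 2 "1 / lam k"] by simp
    then show ?thesis by (simp add: mult.assoc)
  qed
  finally show ?thesis by (simp add: e_def)
qed

text \<open>
  A bound for all times bounded away from \<open>0\<close>.  Quantifying over every \<open>t0\<close> lets each smoothing step give
  up part of the time interval.
\<close>

definition energy_bounded :: "real \<Rightarrow> bool" where
  "energy_bounded \<rho> \<longleftrightarrow> (\<forall>t0>0. \<exists>C\<ge>0. \<forall>t\<ge>t0. sobolev_energy \<rho> (a t) \<le> ennreal C)"

definition source_energy_bounded :: "real \<Rightarrow> bool" where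
  "source_energy_bounded \<rho> \<longleftrightarrow> (\<forall>t0>0. \<exists>C\<ge>0. \<forall>t\<ge>t0. sobolev_energy \<rho> (q t) \<le> ennreal C)"

lemma source_energy_bounded_0: "source_energy_bounded 0"
proof -
  have "sobolev_energy 0 (q t) \<le> ennreal (sup_g\<^sup>2)" for t
  proof -
    have "sobolev_energy 0 (q t) \<le> (\<integral>\<^sup>+k. ennreal ((cmod (q t k))\<^sup>2) \<partial>int_counting)"
      unfolding sobolev_energy_def by (intro nn_integral_mono ennreal_leI) simp
    also have "\<dots> \<le> ennreal ((1 / (2 * pi)) * (LINT x|torus. (cmod (complex_of_real (g t x)))\<^sup>2))"
      unfolding q_def by (rule bessel[OF bdd_borel_g])
    also have "\<dots> \<le> ennreal (sup_g\<^sup>2)"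
    proof (rule ennreal_leI)
      have "\<bar>g t x\<bar>\<^sup>2 \<le> sup_g\<^sup>2" for x using g_le[of t x] by (intro power_mono) auto
      then show "(1 / (2 * pi)) * (LINT x|torus. (cmod (complex_of_real (g t x)))\<^sup>2) \<le> sup_g\<^sup>2"
        using norm_integral_torus_le[of "\<lambda>x. (g t x)\<^sup>2" "sup_g\<^sup>2"] by (simp add: field_simps)
    qed
    finally show ?thesis .
  qed
  then show ?thesis unfolding source_energy_bounded_def by (meson zero_le_power2)
qed

lemma source_energy_bounded:
  assumes "energy_bounded \<rho>" "0 < \<rho>" "\<rho> < 2"
  shows "source_energy_bounded \<rho>"
  unfolding source_energy_bounded_def
proof (intro allI impI)
  fix t0 :: real assume t0: "t0 > 0"
  then obtain C where C: "C \<ge> 0" "\<And>t. t \<ge> t0 \<Longrightarrow> sobolev_energy \<rho> (a t) \<le> ennreal C"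
    using assms(1) by (auto simp: energy_bounded_def)
  have "sobolev_energy \<rho> (q t) \<le> ennreal (lip_g\<^sup>2 * C)" if "t \<ge> t0" for t
  proof -
    have "sobolev_energy \<rho> (q t) \<le> ennreal (lip_g\<^sup>2) * sobolev_energy \<rho> (a t)"
      using that t0 assms by (intro sobolev_energy_nonlinear) auto
    also have "\<dots> \<le> ennreal (lip_g\<^sup>2) * ennreal C"
      by (intro mult_left_mono C that) simp
    finally show ?thesis using C(1) by (simp add: ennreal_mult)
  qed
  then show "\<exists>C\<ge>0. \<forall>t\<ge>t0. sobolev_energy \<rho> (q t) \<le> ennreal C"
    using C(1) by (intro exI[of _ "lip_g\<^sup>2 * C"]) auto
qed

text \<open>
  The weight \<open>\<bar>k\<bar>\<^sup>\<delta>\<close> is absorbed by the factor \<open>1 / lam k\<close> from the Cauchy--Schwarz inequality.  What is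
  left of the kernel is bounded by \<open>exp (- (t - s))\<close>, which is integrable.  The value at the
  starting time, half of \<open>t1\<close>, has been smoothed by the semigroup.
\<close>

lemma energy_gain:
  assumes src: "source_energy_bounded \<rho>" and \<rho>: "\<rho> \<ge> 0" and \<delta>: "0 \<le> \<delta>" "\<delta> \<le> \<gamma>"
  shows "energy_bounded (\<rho> + \<delta>)"
  unfolding energy_bounded_def
proof (intro allI impI)
  fix t1 :: real assume t1: "t1 > 0"
  \<comment> \<open>the first half of the time up to \<open>t1\<close> is left to the semigroup\<close>
  define t0 where "t0 = t1 / 2"
  have t0: "t0 > 0" "t0 < t1" using t1 by (auto simp: t0_def)
  obtain C where C: "C \<ge> 0" "\<And>t. t \<ge> t0 \<Longrightarrow> sobolev_energy \<rho> (q t) \<le> ennreal C"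
    using src t0 by (auto simp: source_energy_bounded_def)
  obtain D where D: "D > 0" "\<And>k::int. exp (- (t0 * \<bar>real_of_int k\<bar> powr \<gamma>)) \<le> D * \<langle>k\<rangle> powr (- (\<rho> + \<delta> + 2))"
    using exp_powr_decay[of t0 \<gamma> "\<rho> + \<delta> + 2"] t0 \<gamma>_pos \<rho> \<delta> by auto
  define S where "S = (\<integral>\<^sup>+k. ennreal (\<langle>k\<rangle> powr (- 2)) \<partial>int_counting)"
  have S: "S < \<infinity>" unfolding S_def by (rule nn_integral_int_powr_finite) simp
  define w where "w k = \<bar>real_of_int k\<bar> powr (\<rho> + \<delta>)" for k :: int
  define B where "B = ennreal (2 * D * sup_u\<^sup>2) * S + ennreal (2 * C)"
  have "B < \<infinity>" using S by (simp add: B_def ennreal_mult_less_top)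
  have main: "sobolev_energy (\<rho> + \<delta>) (a t) \<le> B" if t: "t \<ge> t1" for t
  proof -
    have tt: "t0 \<le> t" using t t0 by simp
    have ptw: "ennreal (w k * (cmod (a t k))\<^sup>2) \<le> ennreal (2 * D * sup_u\<^sup>2) * ennreal (\<langle>k\<rangle> powr (- 2))
        + ennreal 2 * (\<integral>\<^sup>+s. ennreal (exp (- (1 * (t - s))) * (\<bar>real_of_int k\<bar> powr \<rho> * (cmod (q s k))\<^sup>2)) * indicator {t0..<t} s \<partial>lborel)" for k
    proof (cases "k = 0")
      case False
      define x where "x = \<bar>real_of_int k\<bar>"
      have x1: "x \<ge> 1" using abs_int_ge_1[OF False] by (simp add: x_def)
      have lam1: "lam k \<ge> 1" by (rule lam_ge_1[OF False])
      have first: "w k * (2 * (exp (- (lam k * (t - t0))))\<^sup>2 * sup_u\<^sup>2) \<le> 2 * D * sup_u\<^sup>2 * (1 + x) powr (- 2)"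
      proof -
        have "t0 * x powr \<gamma> \<le> (t - t0) * lam k"
          using lam_ge[of k] t t0 by (intro mult_mono) (auto simp: x_def t0_def)
        then have "exp (- (lam k * (t - t0))) \<le> exp (- (t0 * x powr \<gamma>))" by (simp add: mult.commute)
        also have "\<dots> \<le> D * (1 + x) powr (- (\<rho> + \<delta> + 2))" using D(2)[of k] by (simp add: x_def)
        finally have e: "exp (- (lam k * (t - t0))) \<le> D * (1 + x) powr (- (\<rho> + \<delta> + 2))" .
        have "exp (- (lam k * (t - t0))) \<le> 1" using lam1 tt by simp
        then have "(exp (- (lam k * (t - t0))))\<^sup>2 \<le> exp (- (lam k * (t - t0)))"
          by (simp add: power2_eq_square)
        with e have e2: "(exp (- (lam k * (t - t0))))\<^sup>2 \<le> D * (1 + x) powr (- (\<rho> + \<delta> + 2))" by simp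
        have "w k \<le> (1 + x) powr (\<rho> + \<delta>)"
          unfolding w_def x_def[symmetric] using x1 \<rho> \<delta> by (intro powr_mono2) auto
        then have "w k * (exp (- (lam k * (t - t0))))\<^sup>2 \<le> (1 + x) powr (\<rho> + \<delta>) * (D * (1 + x) powr (- (\<rho> + \<delta> + 2)))"
          by (intro mult_mono e2) auto
        also have "\<dots> = D * ((1 + x) powr (\<rho> + \<delta>) * (1 + x) powr (- (\<rho> + \<delta> + 2)))" by simp
        also have "(1 + x) powr (\<rho> + \<delta>) * (1 + x) powr (- (\<rho> + \<delta> + 2)) = (1 + x) powr (- 2)"
          by (simp only: powr_add[symmetric]) simp
        finally have "(2 * sup_u\<^sup>2) * (w k * (exp (- (lam k * (t - t0))))\<^sup>2) \<le> (2 * sup_u\<^sup>2) * (D * (1 + x) powr (- 2))"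
          by (intro mult_left_mono) auto
        then show ?thesis by (simp only: mult_ac)
      qed
      have wl: "w k * (2 / lam k) \<le> 2 * x powr \<rho>"
      proof -
        have "x powr (\<rho> + \<delta>) \<le> x powr (\<rho> + \<gamma>)" using x1 \<delta> by (intro powr_mono) auto
        also have "\<dots> = x powr \<rho> * x powr \<gamma>" by (rule powr_add)
        also have "\<dots> \<le> x powr \<rho> * lam k" using lam_ge[of k] by (intro mult_left_mono) (auto simp: x_def)
        finally show ?thesis using lam1 by (simp add: w_def x_def[symmetric] field_simps)
      qed
      have im: "(\<integral>\<^sup>+s. ennreal (exp (- (lam k * (t - s))) * (cmod (q s k))\<^sup>2) * indicator {t0..<t} s \<partial>lborel)
          \<le> (\<integral>\<^sup>+s. ennreal (exp (- (1 * (t - s))) * (cmod (q s k))\<^sup>2) * indicator {t0..<t} s \<partial>lborel)"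
      proof (rule nn_integral_mono)
        fix s :: real
        have "exp (- (lam k * (t - s))) * (cmod (q s k))\<^sup>2 \<le> exp (- (1 * (t - s))) * (cmod (q s k))\<^sup>2" if "s < t"
        proof -
          have "1 * (t - s) \<le> lam k * (t - s)" using that by (intro mult_right_mono lam1) auto
          then have "exp (- (lam k * (t - s))) \<le> exp (- (1 * (t - s)))"
            by (simp only: exp_le_cancel_iff neg_le_iff_le)
          then show ?thesis by (rule mult_right_mono) simp
        qed
        then show "ennreal (exp (- (lam k * (t - s))) * (cmod (q s k))\<^sup>2) * indicator {t0..<t} s
           \<le> ennreal (exp (- (1 * (t - s))) * (cmod (q s k))\<^sup>2) * indicator {t0..<t} s"
          by (auto simp: indicator_def intro: ennreal_leI)
      qed
      have "ennreal (w k * (cmod (a t k))\<^sup>2) = ennreal (w k) * ennreal ((cmod (a t k))\<^sup>2)"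
        by (simp add: w_def ennreal_mult)
      also have "\<dots> \<le> ennreal (w k) * (ennreal (2 * (exp (- (lam k * (t - t0))))\<^sup>2 * sup_u\<^sup>2)
        + ennreal (2 / lam k) * (\<integral>\<^sup>+s. ennreal (exp (- (lam k * (t - s))) * (cmod (q s k))\<^sup>2) * indicator {t0..<t} s \<partial>lborel))"
        by (intro mult_left_mono duhamel_square_bound t0 tt False) simp
      also have "\<dots> = ennreal (w k * (2 * (exp (- (lam k * (t - t0))))\<^sup>2 * sup_u\<^sup>2))
        + ennreal (w k * (2 / lam k)) * (\<integral>\<^sup>+s. ennreal (exp (- (lam k * (t - s))) * (cmod (q s k))\<^sup>2) * indicator {t0..<t} s \<partial>lborel)"
      proof -
        have m1: "ennreal (w k) * ennreal (2 * (exp (- (lam k * (t - t0))))\<^sup>2 * sup_u\<^sup>2) = ennreal (w k * (2 * (exp (- (lam k * (t - t0))))\<^sup>2 * sup_u\<^sup>2))"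
          by (rule ennreal_mult[symmetric]) (auto simp: w_def)
        have m2: "ennreal (w k * (2 / lam k)) = ennreal (w k) * ennreal (2 / lam k)"
          using lam1 by (intro ennreal_mult) (auto simp: w_def)
        show ?thesis unfolding distrib_left m1 m2 by (simp only: mult.assoc)
      qed
      also have "\<dots> \<le> ennreal (2 * D * sup_u\<^sup>2 * (1 + x) powr (- 2))
        + ennreal (2 * x powr \<rho>) * (\<integral>\<^sup>+s. ennreal (exp (- (1 * (t - s))) * (cmod (q s k))\<^sup>2) * indicator {t0..<t} s \<partial>lborel)"
        by (rule add_mono[OF ennreal_leI[OF first] mult_mono[OF ennreal_leI[OF wl] im]]) auto
      also have "\<dots> = ennreal (2 * D * sup_u\<^sup>2) * ennreal ((1 + x) powr (- 2))
        + ennreal 2 * (ennreal (x powr \<rho>) * (\<integral>\<^sup>+s. ennreal (exp (- (1 * (t - s))) * (cmod (q s k))\<^sup>2) * indicator {t0..<t} s \<partial>lborel))"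
        using D by (simp add: ennreal_mult mult.assoc)
      also have "ennreal (x powr \<rho>) * (\<integral>\<^sup>+s. ennreal (exp (- (1 * (t - s))) * (cmod (q s k))\<^sup>2) * indicator {t0..<t} s \<partial>lborel)
          = (\<integral>\<^sup>+s. ennreal (exp (- (1 * (t - s))) * (x powr \<rho> * (cmod (q s k))\<^sup>2)) * indicator {t0..<t} s \<partial>lborel)"
        by (subst nn_integral_cmult[symmetric]) (auto intro!: nn_integral_cong simp: ennreal_mult mult_ac)
      finally show ?thesis by (simp add: x_def)
    qed (simp add: w_def)
    have "sobolev_energy (\<rho> + \<delta>) (a t) \<le> (\<integral>\<^sup>+k. ennreal (2 * D * sup_u\<^sup>2) * ennreal (\<langle>k\<rangle> powr (- 2))
        + ennreal 2 * (\<integral>\<^sup>+s. ennreal (exp (- (1 * (t - s))) * (\<bar>real_of_int k\<bar> powr \<rho> * (cmod (q s k))\<^sup>2)) * indicator {t0..<t} s \<partial>lborel) \<partial>int_counting)"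
      unfolding sobolev_energy_def w_def[symmetric] by (intro nn_integral_mono ptw)
    also have "\<dots> = ennreal (2 * D * sup_u\<^sup>2) * S
        + ennreal 2 * (\<integral>\<^sup>+k. (\<integral>\<^sup>+s. ennreal (exp (- (1 * (t - s))) * (\<bar>real_of_int k\<bar> powr \<rho> * (cmod (q s k))\<^sup>2)) * indicator {t0..<t} s \<partial>lborel) \<partial>int_counting)"
      unfolding S_def by (subst nn_integral_add) (auto simp: nn_integral_cmult)
    also have "(\<integral>\<^sup>+k. (\<integral>\<^sup>+s. ennreal (exp (- (1 * (t - s))) * (\<bar>real_of_int k\<bar> powr \<rho> * (cmod (q s k))\<^sup>2)) * indicator {t0..<t} s \<partial>lborel) \<partial>int_counting)
       = (\<integral>\<^sup>+s. (\<integral>\<^sup>+k. ennreal (exp (- (1 * (t - s))) * (\<bar>real_of_int k\<bar> powr \<rho> * (cmod (q s k))\<^sup>2)) * indicator {t0..<t} s \<partial>int_counting) \<partial>lborel)"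
      by (rule nn_integral_count_space_nn_integral[symmetric]) auto
    also have "\<dots> \<le> (\<integral>\<^sup>+s. ennreal C * (ennreal (exp (- (1 * (t - s)))) * indicator {t0..<t} s) \<partial>lborel)"
    proof (rule nn_integral_mono)
      fix s :: real
      have "(\<integral>\<^sup>+k. ennreal (exp (- (1 * (t - s))) * (\<bar>real_of_int k\<bar> powr \<rho> * (cmod (q s k))\<^sup>2)) * indicator {t0..<t} s \<partial>int_counting)
        = (\<integral>\<^sup>+k. (ennreal (exp (- (1 * (t - s)))) * indicator {t0..<t} s) * ennreal (\<bar>real_of_int k\<bar> powr \<rho> * (cmod (q s k))\<^sup>2) \<partial>int_counting)"
        by (intro nn_integral_cong) (simp add: ennreal_mult mult_ac)
      also have "\<dots> = (ennreal (exp (- (1 * (t - s)))) * indicator {t0..<t} s) * sobolev_energy \<rho> (q s)"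
        unfolding sobolev_energy_def by (rule nn_integral_cmult) simp
      also have "\<dots> \<le> ennreal C * (ennreal (exp (- (1 * (t - s)))) * indicator {t0..<t} s)"
        using C(2)[of s] by (auto simp: indicator_def mult.commute[of "ennreal C"] intro: mult_left_mono)
      finally show "(\<integral>\<^sup>+k. ennreal (exp (- (1 * (t - s))) * (\<bar>real_of_int k\<bar> powr \<rho> * (cmod (q s k))\<^sup>2)) * indicator {t0..<t} s \<partial>int_counting)
         \<le> ennreal C * (ennreal (exp (- (1 * (t - s)))) * indicator {t0..<t} s)" .
    qed
    also have "\<dots> = ennreal C * (\<integral>\<^sup>+s. ennreal (exp (- (1 * (t - s)))) * indicator {t0..<t} s \<partial>lborel)"
      by (rule nn_integral_cmult) measurable
    also have "\<dots> \<le> ennreal C * ennreal (1 / 1)"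
      by (intro mult_left_mono nn_integral_exp_decay_le tt) auto
    finally have "sobolev_energy (\<rho> + \<delta>) (a t) \<le> ennreal (2 * D * sup_u\<^sup>2) * S + ennreal 2 * ennreal C"
      by (simp add: mult_left_mono)
    then show ?thesis using C(1) by (simp add: B_def ennreal_mult)
  qed
  show "\<exists>C\<ge>0. \<forall>t\<ge>t1. sobolev_energy (\<rho> + \<delta>) (a t) \<le> ennreal C"
    using main \<open>B < \<infinity>\<close> by (intro exI[of _ "enn2real B"]) (auto simp: less_top)
qed

text \<open>
  The exponents \<open>2 n / N\<close> with \<open>n < N\<close> stay in the range \<open>\<rho> < 2\<close> in which the nonlinearity is
  controlled, and \<open>2 / N < \<gamma>\<close> makes the last gain pass the value \<open>2\<close>.
\<close>

lemma energy_bounded_above_2: "\<exists>\<rho>>2. energy_bounded \<rho>"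
proof -
  obtain N :: nat where "2 / \<gamma> < real N" using reals_Archimedean2 by blast
  then have N: "2 < \<gamma> * real N" using \<gamma>_pos by (simp add: field_simps)
  then have N0: "N > 0" using gr0I by fastforce
  have step: "2 / real N \<le> \<gamma>" using N N0 by (simp add: field_simps)
  have src: "source_energy_bounded (real n * (2 / real N))" if "n < N" for n
    using that
  proof (induction n)
    case 0 then show ?case using source_energy_bounded_0 by simp
  next
    case (Suc n)
    have "energy_bounded (real n * (2 / real N) + 2 / real N)"
      using Suc step by (intro energy_gain) auto
    moreover have "real (Suc n) * (2 / real N) = real n * (2 / real N) + 2 / real N"
      by (simp only: of_nat_Suc distrib_right mult_1 add.commute)
    ultimately have "energy_bounded (real (Suc n) * (2 / real N))" by (simp only:)
    moreover have "real (Suc n) * (2 / real N) < 2" using Suc.prems by (simp add: field_simps)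
    ultimately show ?case by (intro source_energy_bounded) (use N0 in auto)
  qed
  have "energy_bounded (real (N - 1) * (2 / real N) + \<gamma>)"
    using src[of "N - 1"] N0 \<gamma>_pos by (intro energy_gain) auto
  moreover have "real (N - 1) * (2 / real N) + \<gamma> > 2"
    using N N0 by (simp add: of_nat_diff field_simps)
  ultimately show ?thesis by blast
qed

end

section \<open>Smoothing to all orders\<close>

text \<open>
  One of \<open>\<bar>j\<bar>\<close> and \<open>\<bar>k - j\<bar>\<close> is at least \<open>\<bar>k\<bar>/2\<close>.
\<close>

lemma convolution_kernel_bound:
  assumes "\<sigma> \<ge> 0"
  shows "\<langle>j\<rangle> powr (- \<sigma>) * \<langle>k - j\<rangle> powr (- \<sigma>)
    \<le> 2 powr \<sigma> * \<langle>k\<rangle> powr (- \<sigma>) * (\<langle>j\<rangle> powr (- \<sigma>) + \<langle>k - j\<rangle> powr (- \<sigma>))"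
proof -
  define x where "x = 1 + \<bar>real_of_int j\<bar>"
  define y where "y = 1 + \<bar>real_of_int (k - j)\<bar>"
  define z where "z = 1 + \<bar>real_of_int k\<bar>"
  have pos: "x > 0" "y > 0" "z > 0" by (auto simp: x_def y_def z_def)
  have zxy: "z \<le> x + y" by (simp add: x_def y_def z_def)
  have half: "(z / 2) powr (- \<sigma>) = 2 powr \<sigma> * z powr (- \<sigma>)"
    using pos by (simp add: powr_divide powr_minus field_simps)
  have "x powr (- \<sigma>) * y powr (- \<sigma>) \<le> 2 powr \<sigma> * z powr (- \<sigma>) * (x powr (- \<sigma>) + y powr (- \<sigma>))"
  proof (cases "x \<le> y")
    case True
    then have "y powr (- \<sigma>) \<le> (z / 2) powr (- \<sigma>)" using zxy pos assms by (intro powr_mono2') auto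
    then have "x powr (- \<sigma>) * y powr (- \<sigma>) \<le> x powr (- \<sigma>) * (2 powr \<sigma> * z powr (- \<sigma>))"
      unfolding half by (intro mult_left_mono) auto
    also have "\<dots> \<le> 2 powr \<sigma> * z powr (- \<sigma>) * (x powr (- \<sigma>) + y powr (- \<sigma>))"
      by (simp add: distrib_left mult_ac)
    finally show ?thesis .
  next
    case False
    then have "x powr (- \<sigma>) \<le> (z / 2) powr (- \<sigma>)" using zxy pos assms by (intro powr_mono2') auto
    then have "x powr (- \<sigma>) * y powr (- \<sigma>) \<le> (2 powr \<sigma> * z powr (- \<sigma>)) * y powr (- \<sigma>)"
      unfolding half by (intro mult_right_mono) auto
    also have "\<dots> \<le> 2 powr \<sigma> * z powr (- \<sigma>) * (x powr (- \<sigma>) + y powr (- \<sigma>))"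
      by (simp add: distrib_left mult_ac)
    finally show ?thesis .
  qed
  then show ?thesis by (simp add: x_def y_def z_def)
qed

definition convolution_constant :: "real \<Rightarrow> real" where
  "convolution_constant \<sigma> = 2 powr \<sigma> * (2 * (LINT j|int_counting. \<langle>j\<rangle> powr (- \<sigma>)))"

lemma integral_int_reindex:
  fixes f :: "int \<Rightarrow> 'b :: {banach, second_countable_topology}"
  shows "(LINT j|int_counting. f (k - j)) = (LINT j|int_counting. f j)"
    and "integrable int_counting (\<lambda>j. f (k - j)) \<longleftrightarrow> integrable int_counting f"
proof -
  have bij: "bij_betw (\<lambda>j::int. k - j) UNIV UNIV"
    by (rule bij_betw_byWitness[where f' = "\<lambda>j. k - j"]) auto
  show "(LINT j|int_counting. f (k - j)) = (LINT j|int_counting. f j)"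
    using integral_bij_count_space[OF bij, of f] by simp
  show "integrable int_counting (\<lambda>j. f (k - j)) \<longleftrightarrow> integrable int_counting f"
    using integrable_bij_count_space[OF bij, of f] by simp
qed

lemma powr_neg_shift:
  fixes x p :: real
  assumes "x \<ge> 1" "p \<ge> 0" shows "x powr (- p) \<le> 2 powr p * (1 + x) powr (- p)"
proof -
  have "x powr (- p) \<le> ((1 + x) / 2) powr (- p)"
    using assms by (intro powr_mono2') auto
  also have "\<dots> = 2 powr p * (1 + x) powr (- p)"
    using assms by (simp add: powr_divide powr_minus field_simps)
  finally show ?thesis .
qed

context bounded_mild
begin

text \<open>
  The pairing identity with \<open>h = f cis (- k x)\<close> is the convolution formula for the product \<open>u f\<close>.
\<close>

lemma torus_coeff_u_mult:
  assumes t: "t > 0" and f: "bdd_borel f"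
  shows "torus_coeff (\<lambda>x. of_real (u t x) * f x) k = (LINT j|int_counting. a t j * torus_coeff f (k - j))"
    and "integrable int_counting (\<lambda>j. a t j * torus_coeff f (k - j))"
proof -
  have b: "bdd_borel (\<lambda>x. f x * cis (- (of_int k * x)))" by (intro bdd_borel_mult f) auto
  show "torus_coeff (\<lambda>x. of_real (u t x) * f x) k = (LINT j|int_counting. a t j * torus_coeff f (k - j))"
    using u_pairing[OF t b] unfolding torus_coeff_mult_cis by (simp add: torus_coeff_def mult.assoc)
  show "integrable int_counting (\<lambda>j. a t j * torus_coeff f (k - j))"
    using u_pairing_integrable[OF t b] unfolding torus_coeff_mult_cis by simp
qed

lemma convolution_decay:
  assumes t: "t > 0" and f: "bdd_borel f" and \<sigma>: "\<sigma> > 1"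
    and A: "\<And>j. cmod (a t j) \<le> A * \<langle>j\<rangle> powr (- \<sigma>)" "A \<ge> 0"
    and B: "\<And>j. cmod (torus_coeff f j) \<le> B * \<langle>j\<rangle> powr (- \<sigma>)" "B \<ge> 0"
  shows "cmod (torus_coeff (\<lambda>x. of_real (u t x) * f x) k) \<le> A * B * convolution_constant \<sigma> * \<langle>k\<rangle> powr (- \<sigma>)"
proof -
  define w where "w j = \<langle>j\<rangle> powr (- \<sigma>)" for j :: int
  have wi: "integrable int_counting w" unfolding w_def[abs_def] by (rule integrable_int_powr[OF \<sigma>])
  have wi': "integrable int_counting (\<lambda>j. w (k - j))" using wi by (simp only: integral_int_reindex)
  have w0: "w j \<ge> 0" for j by (simp add: w_def)
  have "cmod (torus_coeff (\<lambda>x. of_real (u t x) * f x) k) \<le> (LINT j|int_counting. cmod (a t j * torus_coeff f (k - j)))"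
    unfolding torus_coeff_u_mult(1)[OF t f] by (rule integral_norm_bound)
  also have "\<dots> \<le> (LINT j|int_counting. (A * B * 2 powr \<sigma> * w k) * (w j + w (k - j)))"
  proof (rule integral_mono)
    show "integrable int_counting (\<lambda>j. cmod (a t j * torus_coeff f (k - j)))"
      by (rule integrable_norm[OF torus_coeff_u_mult(2)[OF t f]])
    show "integrable int_counting (\<lambda>j. (A * B * 2 powr \<sigma> * w k) * (w j + w (k - j)))"
      by (intro integrable_mult_right Bochner_Integration.integrable_add wi wi')
    fix j
    have "cmod (a t j * torus_coeff f (k - j)) \<le> (A * w j) * (B * w (k - j))"
      unfolding norm_mult using A(2) w0 by (intro mult_mono A(1)[folded w_def] B(1)[folded w_def]) auto
    also have "\<dots> = (A * B) * (w j * w (k - j))" by (simp only: mult_ac)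
    also have "\<dots> \<le> (A * B) * (2 powr \<sigma> * w k * (w j + w (k - j)))"
      unfolding w_def using A(2) B(2) \<sigma> by (intro mult_left_mono convolution_kernel_bound) auto
    finally show "cmod (a t j * torus_coeff f (k - j)) \<le> (A * B * 2 powr \<sigma> * w k) * (w j + w (k - j))"
      by (simp only: mult_ac)
  qed
  also have "\<dots> = (A * B * 2 powr \<sigma> * w k) * ((LINT j|int_counting. w j) + (LINT j|int_counting. w (k - j)))"
    by (simp add: Bochner_Integration.integral_add[OF wi wi'])
  also have "(LINT j|int_counting. w (k - j)) = (LINT j|int_counting. w j)"
    by (rule integral_int_reindex)
  finally show ?thesis by (simp add: convolution_constant_def w_def mult_ac)
qed

definition d :: "real \<Rightarrow> int \<Rightarrow> complex" where
  "d t k = torus_coeff (\<lambda>x. of_real ((u t x) ^ 3)) k"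

lemma bdd_borel_cube: "t > 0 \<Longrightarrow> bdd_borel (\<lambda>x. of_real ((u t x) ^ 3))"
  using bdd_borel_power[OF bdd_borel_u, of t 3] by simp

lemma q_eq:
  assumes "t > 0" shows "q t k = a t k - d t k"
  using torus_coeff_diff[OF bdd_borel_u[OF assms] bdd_borel_cube[OF assms], of k] assms
  by (simp add: q_def a_def d_def g_def)

lemma d_decay:
  assumes t: "t > 0" and \<sigma>: "\<sigma> > 1"
    and A: "\<And>j. cmod (a t j) \<le> A * \<langle>j\<rangle> powr (- \<sigma>)" "A \<ge> 0"
  shows "cmod (d t k) \<le> A ^ 3 * (convolution_constant \<sigma>)\<^sup>2 * \<langle>k\<rangle> powr (- \<sigma>)"
proof -
  note bu = bdd_borel_u[OF t]
  have K: "convolution_constant \<sigma> \<ge> 0"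
    by (simp add: convolution_constant_def)
  have 2: "cmod (torus_coeff (\<lambda>x. of_real (u t x) * of_real (u t x)) j) \<le> (A * A * convolution_constant \<sigma>) * \<langle>j\<rangle> powr (- \<sigma>)" for j
    by (rule convolution_decay[OF t bu \<sigma> A]) (use A in \<open>auto simp: a_def\<close>)
  have "cmod (torus_coeff (\<lambda>x. of_real (u t x) * (of_real (u t x) * of_real (u t x))) k)
     \<le> A * (A * A * convolution_constant \<sigma>) * convolution_constant \<sigma> * \<langle>k\<rangle> powr (- \<sigma>)"
    by (rule convolution_decay[OF t bdd_borel_mult[OF bu bu] \<sigma> A 2]) (use A K in auto)
  then show ?thesis by (simp add: d_def power3_eq_cube power2_eq_square mult_ac)
qed

lemma duhamel_sup_bound:
  assumes "0 < t0" "t0 \<le> t" "k \<noteq> 0" and Q: "\<And>s. t0 \<le> s \<Longrightarrow> cmod (q s k) \<le> Q"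
  shows "cmod (a t k) \<le> exp (- (lam k * (t - t0))) * sup_u + Q / lam k"
proof -
  have lam: "lam k > 0" using lam_ge_1[OF assms(3)] by simp
  have Q0: "Q \<ge> 0" using Q[of t0] norm_ge_zero order_trans by blast
  define f where "f s = of_real (heat_symbol \<nu> \<gamma> (t - s) k) * q s k" for s
  define I where "I = (LINT s:{t0..<t}|lborel. f s)"
  have int: "integrable lborel (\<lambda>s. indicator {t0..<t} s *\<^sub>R f s)"
    using heat_q_set_integrable[OF assms(2), of k] by (simp add: f_def[abs_def] set_integrable_def)
  have "ennreal (cmod I) \<le> (\<integral>\<^sup>+s. ennreal (cmod (indicator {t0..<t} s *\<^sub>R f s)) \<partial>lborel)"
    using integral_norm_bound_ennreal[OF int] by (simp add: I_def set_lebesgue_integral_def)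
  also have "\<dots> \<le> (\<integral>\<^sup>+s. ennreal Q * (ennreal (exp (- (lam k * (t - s)))) * indicator {t0..<t} s) \<partial>lborel)"
    using Q Q0 by (intro nn_integral_mono)
       (auto simp: indicator_def f_def norm_mult heat_symbol_lam ennreal_mult[symmetric] mult.commute intro!: ennreal_leI mult_right_mono)
  also have "\<dots> = ennreal Q * (\<integral>\<^sup>+s. ennreal (exp (- (lam k * (t - s)))) * indicator {t0..<t} s \<partial>lborel)"
    by (rule nn_integral_cmult) measurable
  also have "\<dots> \<le> ennreal Q * ennreal (1 / lam k)"
    by (intro mult_left_mono nn_integral_exp_decay_le lam assms) auto
  also have "\<dots> = ennreal (Q / lam k)" using Q0 lam by (simp flip: ennreal_mult)
  finally have I: "cmod I \<le> Q / lam k" using Q0 lam by (subst (asm) ennreal_le_iff) auto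
  have "cmod (a t k) \<le> cmod (of_real (heat_symbol \<nu> \<gamma> (t - t0) k) * a t0 k) + cmod I"
    unfolding duhamel_restart[OF assms(1,2)] I_def f_def by (rule norm_triangle_ineq)
  also have "cmod (of_real (heat_symbol \<nu> \<gamma> (t - t0) k) * a t0 k) \<le> exp (- (lam k * (t - t0))) * sup_u"
    using norm_a_le[OF assms(1), of k] by (simp add: norm_mult heat_symbol_lam mult_left_mono)
  finally show ?thesis using I by simp
qed

definition coeff_decay :: "real \<Rightarrow> bool" where
  "coeff_decay \<sigma> \<longleftrightarrow> (\<forall>t0>0. \<exists>C\<ge>0. \<forall>t\<ge>t0. \<forall>k. cmod (a t k) \<le> C * \<langle>k\<rangle> powr (- \<sigma>))"

text \<open>
  A single summand is at most the sum; the decay is summable as soon as \<open>\<rho> > 2\<close>.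
\<close>

lemma coeff_decay_of_energy:
  assumes "energy_bounded \<rho>" "\<rho> \<ge> 0"
  shows "coeff_decay (\<rho> / 2)"
  unfolding coeff_decay_def
proof (intro allI impI)
  fix t0 :: real assume t0: "t0 > 0"
  then obtain C where C: "C \<ge> 0" "\<And>t. t \<ge> t0 \<Longrightarrow> sobolev_energy \<rho> (a t) \<le> ennreal C"
    using assms(1) by (auto simp: energy_bounded_def)
  define B where "B = max sup_u (sqrt C * 2 powr (\<rho> / 2))"
  have "cmod (a t k) \<le> B * \<langle>k\<rangle> powr (- (\<rho> / 2))" if t: "t \<ge> t0" for t k
  proof (cases "k = 0")
    case True then show ?thesis using norm_a_le[of t 0] t t0 by (simp add: B_def)
  next
    case False
    define x where "x = \<bar>real_of_int k\<bar>"
    have x1: "x \<ge> 1" using abs_int_ge_1[OF False] by (simp add: x_def)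
    have "ennreal (x powr \<rho> * (cmod (a t k))\<^sup>2) \<le> sobolev_energy \<rho> (a t)"
      unfolding sobolev_energy_def x_def by (rule nn_integral_ge_point) simp
    also have "\<dots> \<le> ennreal C" by (rule C(2)[OF t])
    finally have "x powr \<rho> * (cmod (a t k))\<^sup>2 \<le> C" using C(1) by (subst (asm) ennreal_le_iff) auto
    moreover have "(x powr (\<rho> / 2))\<^sup>2 = x powr \<rho>" using x1 by (simp add: powr_power)
    ultimately have "(x powr (\<rho> / 2) * cmod (a t k))\<^sup>2 \<le> C" by (simp add: power_mult_distrib)
    then have "x powr (\<rho> / 2) * cmod (a t k) \<le> sqrt C" using real_le_rsqrt by blast
    then have "cmod (a t k) \<le> sqrt C * x powr (- (\<rho> / 2))"
      using x1 by (simp add: powr_minus field_simps)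
    also have "\<dots> \<le> sqrt C * (2 powr (\<rho> / 2) * (1 + x) powr (- (\<rho> / 2)))"
      using x1 assms C by (intro mult_left_mono powr_neg_shift) auto
    also have "\<dots> \<le> B * (1 + x) powr (- (\<rho> / 2))"
      unfolding mult.assoc[symmetric] by (intro mult_right_mono) (auto simp: B_def)
    finally show ?thesis by (simp add: x_def)
  qed
  moreover have "B \<ge> 0" using sup_u_nonneg by (simp add: B_def)
  ultimately show "\<exists>C\<ge>0. \<forall>t\<ge>t0. \<forall>k. cmod (a t k) \<le> C * \<langle>k\<rangle> powr (- (\<rho> / 2))" by blast
qed

text \<open>
  Convolution preserves the decay \<open>\<sigma> > 1\<close>, and integrating the exponential kernel in time gains the
  factor \<open>1 / lam k\<close>, that is, \<open>\<gamma>\<close> powers.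
\<close>

lemma coeff_decay_gain:
  assumes "coeff_decay \<sigma>" "\<sigma> > 1"
  shows "coeff_decay (\<sigma> + \<gamma>)"
  unfolding coeff_decay_def
proof (intro allI impI)
  fix t1 :: real assume t1: "t1 > 0"
  define t0 where "t0 = t1 / 2"
  have t0: "t0 > 0" "t0 < t1" using t1 by (auto simp: t0_def)
  obtain A where A: "A \<ge> 0" "\<And>t k. t \<ge> t0 \<Longrightarrow> cmod (a t k) \<le> A * \<langle>k\<rangle> powr (- \<sigma>)"
    using assms(1) t0 by (auto simp: coeff_decay_def)
  obtain D where D: "D > 0" "\<And>k::int. exp (- (t0 * \<bar>real_of_int k\<bar> powr \<gamma>)) \<le> D * \<langle>k\<rangle> powr (- (\<sigma> + \<gamma>))"
    using exp_powr_decay[of t0 \<gamma> "\<sigma> + \<gamma>"] t0 \<gamma>_pos assms(2) by auto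
  define Q where "Q = A + A ^ 3 * (convolution_constant \<sigma>)\<^sup>2"
  have Q0: "Q \<ge> 0" using A by (simp add: Q_def)
  have Q: "cmod (q s k) \<le> Q * \<langle>k\<rangle> powr (- \<sigma>)" if s: "s \<ge> t0" for s k
  proof -
    have sp: "s > 0" using s t0 by simp
    have "cmod (q s k) \<le> cmod (a s k) + cmod (d s k)"
      unfolding q_eq[OF sp] by (rule norm_triangle_ineq4)
    also have "\<dots> \<le> A * \<langle>k\<rangle> powr (- \<sigma>) + A ^ 3 * (convolution_constant \<sigma>)\<^sup>2 * \<langle>k\<rangle> powr (- \<sigma>)"
      by (intro add_mono A(2)[OF s] d_decay[OF sp assms(2) A(2)[OF s] A(1)])
    finally show ?thesis by (simp add: Q_def distrib_right)
  qed
  define B where "B = sup_u + D * sup_u + Q * 2 powr \<gamma>"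
  have B0: "B \<ge> 0" using sup_u_nonneg D(1) Q0 by (simp add: B_def)
  have "cmod (a t k) \<le> B * \<langle>k\<rangle> powr (- (\<sigma> + \<gamma>))" if t: "t \<ge> t1" for t k
  proof (cases "k = 0")
    case True then show ?thesis using norm_a_le[of t 0] t t1 D(1) Q0 sup_u_nonneg by (simp add: B_def add_increasing2)
  next
    case False
    define x where "x = \<bar>real_of_int k\<bar>"
    have x1: "x \<ge> 1" using abs_int_ge_1[OF False] by (simp add: x_def)
    have lam: "x powr \<gamma> \<le> lam k" "lam k > 0" using lam_ge[of k] lam_ge_1[OF False] by (auto simp: x_def)
    have "cmod (a t k) \<le> exp (- (lam k * (t - t0))) * sup_u + (Q * (1 + x) powr (- \<sigma>)) / lam k"
      using t t0 Q unfolding x_def by (intro duhamel_sup_bound False) auto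
    also have "exp (- (lam k * (t - t0))) \<le> D * (1 + x) powr (- (\<sigma> + \<gamma>))"
    proof -
      have "t0 * x powr \<gamma> \<le> (t - t0) * lam k"
        using lam t t0 by (intro mult_mono) (auto simp: t0_def)
      then have "exp (- (lam k * (t - t0))) \<le> exp (- (t0 * x powr \<gamma>))" by (simp add: mult.commute)
      also have "\<dots> \<le> D * (1 + x) powr (- (\<sigma> + \<gamma>))" using D(2)[of k] by (simp add: x_def)
      finally show ?thesis .
    qed
    also have "(Q * (1 + x) powr (- \<sigma>)) / lam k \<le> (Q * 2 powr \<gamma>) * (1 + x) powr (- (\<sigma> + \<gamma>))"
    proof -
      have "1 / lam k \<le> x powr (- \<gamma>)" using lam x1 by (simp add: powr_minus field_simps)
      also have "\<dots> \<le> 2 powr \<gamma> * (1 + x) powr (- \<gamma>)" using x1 \<gamma>_pos by (intro powr_neg_shift) auto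
      finally have "(Q * (1 + x) powr (- \<sigma>)) * (1 / lam k) \<le> (Q * (1 + x) powr (- \<sigma>)) * (2 powr \<gamma> * (1 + x) powr (- \<gamma>))"
        using Q0 by (intro mult_left_mono) auto
      also have "\<dots> = (Q * 2 powr \<gamma>) * ((1 + x) powr (- \<sigma>) * (1 + x) powr (- \<gamma>))" by (simp only: mult_ac)
      also have "(1 + x) powr (- \<sigma>) * (1 + x) powr (- \<gamma>) = (1 + x) powr (- (\<sigma> + \<gamma>))"
        by (simp only: powr_add[symmetric]) simp
      finally show ?thesis by simp
    qed
    finally have "cmod (a t k) \<le> D * (1 + x) powr (- (\<sigma> + \<gamma>)) * sup_u + (Q * 2 powr \<gamma>) * (1 + x) powr (- (\<sigma> + \<gamma>))"
      using sup_u_nonneg by (simp add: mult_right_mono)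
    also have "\<dots> = (D * sup_u + Q * 2 powr \<gamma>) * (1 + x) powr (- (\<sigma> + \<gamma>))" by (simp add: algebra_simps)
    also have "\<dots> \<le> B * (1 + x) powr (- (\<sigma> + \<gamma>))"
      using sup_u_nonneg by (intro mult_right_mono) (auto simp: B_def)
    finally show ?thesis by (simp add: x_def)
  qed
  then show "\<exists>C\<ge>0. \<forall>t\<ge>t1. \<forall>k. cmod (a t k) \<le> C * \<langle>k\<rangle> powr (- (\<sigma> + \<gamma>))"
    using B0 by blast
qed

lemma coeff_decay_mono:
  assumes "coeff_decay \<sigma>" "p \<le> \<sigma>" shows "coeff_decay p"
  unfolding coeff_decay_def
proof (intro allI impI)
  fix t0 :: real assume "t0 > 0"
  then obtain C where C: "C \<ge> 0" "\<And>t k. t \<ge> t0 \<Longrightarrow> cmod (a t k) \<le> C * \<langle>k\<rangle> powr (- \<sigma>)"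
    using assms(1) \<open>t0 > 0\<close> by (auto simp: coeff_decay_def)
  have "C * \<langle>k\<rangle> powr (- \<sigma>) \<le> C * \<langle>k\<rangle> powr (- p)" for k
    using assms(2) C(1) by (intro mult_left_mono powr_mono) auto
  then show "\<exists>C\<ge>0. \<forall>t\<ge>t0. \<forall>k. cmod (a t k) \<le> C * \<langle>k\<rangle> powr (- p)"
    using C by (meson order_trans)
qed

lemma coeff_decay_all: "coeff_decay p"
proof -
  obtain \<rho> where \<rho>: "\<rho> > 2" "energy_bounded \<rho>" using energy_bounded_above_2 by blast
  have iter: "coeff_decay (\<rho> / 2 + real n * \<gamma>)" for n
  proof (induction n)
    case 0 then show ?case using coeff_decay_of_energy[OF \<rho>(2)] \<rho>(1) by simp
  next
    case (Suc n)
    have "coeff_decay (\<rho> / 2 + real n * \<gamma> + \<gamma>)"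
    proof (intro coeff_decay_gain Suc.IH)
      have "0 \<le> real n * \<gamma>" using \<gamma>_pos by simp
      then show "1 < \<rho> / 2 + real n * \<gamma>" using \<rho>(1) by linarith
    qed
    then show ?case by (simp add: algebra_simps)
  qed
  obtain n :: nat where "p / \<gamma> \<le> real n" using real_arch_simple by blast
  then have "p \<le> \<rho> / 2 + real n * \<gamma>" using \<gamma>_pos \<rho>(1) by (simp add: field_simps)
  then show ?thesis using iter coeff_decay_mono by blast
qed

end

section \<open>Ordinary differential equations for the modes\<close>

text \<open>
  The dual form of the bound of a function by the sum of the absolute values of its coefficients.
\<close>

lemma norm_pairing_le:
  assumes c: "integrable int_counting c" and h: "bdd_borel h"
  shows "cmod (LINT k|int_counting. c k * torus_coeff h (- k)) \<le> (LINT k|int_counting. cmod (c k)) * ((1 / (2 * pi)) * (LINT x|torus. cmod (h x)))"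
proof -
  define H where "H = (1 / (2 * pi)) * (LINT x|torus. cmod (h x))"
  have "cmod (LINT k|int_counting. c k * torus_coeff h (- k)) \<le> (LINT k|int_counting. cmod (c k * torus_coeff h (- k)))"
    by (rule integral_norm_bound)
  also have "\<dots> \<le> (LINT k|int_counting. cmod (c k) * H)"
  proof (rule integral_mono)
    show "integrable int_counting (\<lambda>k. cmod (c k * torus_coeff h (- k)))"
      by (rule integrable_norm[OF series_pairing_integrable[OF c h]])
    show "integrable int_counting (\<lambda>k. cmod (c k) * H)"
      by (rule integrable_mult_left[OF integrable_norm[OF c]])
    show "cmod (c k * torus_coeff h (- k)) \<le> cmod (c k) * H" for k
      unfolding norm_mult H_def by (intro mult_left_mono norm_torus_coeff_le_L1 h) simp
  qed
  also have "\<dots> = (LINT k|int_counting. cmod (c k)) * H" by simp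
  finally show ?thesis by (simp add: H_def)
qed

lemma
  fixes f :: "int \<Rightarrow> real"
  assumes f: "integrable int_counting f" and nn: "\<And>k. f k \<ge> 0"
  shows summable_int_split_nonneg: "summable (\<lambda>n. f (int (Suc n)) + f (- int (Suc n)))"
    and integral_int_split_nonneg: "(LINT k|int_counting. f k) = f 0 + (\<Sum>n. f (int (Suc n)) + f (- int (Suc n)))"
proof -
  define g where "g n = f (int (Suc n)) + f (- int (Suc n))" for n
  have g: "g n \<ge> 0" for n using nn by (simp add: g_def)
  have I: "(LINT k|int_counting. f k) \<ge> 0" using nn by simp
  have "ennreal (LINT k|int_counting. f k) = (\<integral>\<^sup>+k. ennreal (f k) \<partial>int_counting)"
    using nn by (intro nn_integral_eq_integral[symmetric] f) auto
  also have "\<dots> = ennreal (f 0) + (\<Sum>n. ennreal (g n))"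
    unfolding nn_integral_int_split g_def using nn by (simp add: ennreal_plus)
  finally have eq: "ennreal (LINT k|int_counting. f k) = ennreal (f 0) + (\<Sum>n. ennreal (g n))" .
  have "(\<Sum>n. ennreal (g n)) \<noteq> top"
  proof
    assume "(\<Sum>n. ennreal (g n)) = top"
    then have "ennreal (LINT k|int_counting. f k) = top" using eq by simp
    then show False by simp
  qed
  then have s: "summable g" using g by (intro summable_suminf_not_top) auto
  then show "summable (\<lambda>n. f (int (Suc n)) + f (- int (Suc n)))" unfolding g_def .
  have "(\<Sum>n. ennreal (g n)) = ennreal (\<Sum>n. g n)" using g s by (intro suminf_ennreal2) auto
  then have "ennreal (LINT k|int_counting. f k) = ennreal (f 0 + (\<Sum>n. g n))"
    using eq nn suminf_nonneg[OF s g] by (simp add: ennreal_plus)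
  then show "(LINT k|int_counting. f k) = f 0 + (\<Sum>n. f (int (Suc n)) + f (- int (Suc n)))"
    unfolding g_def[symmetric] using I nn suminf_nonneg[OF s g] by (subst (asm) ennreal_inj) auto
qed

text \<open>
  The signed case follows from the nonnegative one applied to \<open>\<bar>f\<bar> + f\<close> and \<open>\<bar>f\<bar>\<close>.
\<close>

lemma
  fixes f :: "int \<Rightarrow> real"
  assumes f: "integrable int_counting f" and even: "\<And>k. f (- k) = f k" and zero: "f 0 = 0"
  shows summable_int_even: "summable (\<lambda>n. 2 * f (int (Suc n)))"
    and integral_int_even: "(LINT k|int_counting. f k) = (\<Sum>n. 2 * f (int (Suc n)))"
proof -
  have f1: "integrable int_counting (\<lambda>k. \<bar>f k\<bar> + f k)" and f2: "integrable int_counting (\<lambda>k. \<bar>f k\<bar>)"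
    using f by auto
  note s1 = summable_int_split_nonneg[OF f1] integral_int_split_nonneg[OF f1]
  note s2 = summable_int_split_nonneg[OF f2] integral_int_split_nonneg[OF f2]
  define g1 where "g1 n = (\<bar>f (int (Suc n))\<bar> + f (int (Suc n))) + (\<bar>f (- int (Suc n))\<bar> + f (- int (Suc n)))" for n
  define g2 where "g2 n = \<bar>f (int (Suc n))\<bar> + \<bar>f (- int (Suc n))\<bar>" for n
  have sg: "summable g1" "summable g2" unfolding g1_def[abs_def] g2_def[abs_def] by (rule s1 s2; simp)+
  have g: "g1 n - g2 n = 2 * f (int (Suc n))" for n
    using even[of "int (Suc n)"] by (simp add: g1_def g2_def)
  show "summable (\<lambda>n. 2 * f (int (Suc n)))"
    using summable_diff[OF sg] by (simp only: g)
  have "(LINT k|int_counting. f k) = (LINT k|int_counting. \<bar>f k\<bar> + f k) - (LINT k|int_counting. \<bar>f k\<bar>)"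
    using Bochner_Integration.integral_diff[OF f1 f2] by simp
  also have "\<dots> = suminf g1 - suminf g2"
  proof -
    have "(LINT k|int_counting. \<bar>f k\<bar> + f k) = (\<bar>f 0\<bar> + f 0) + suminf g1"
      unfolding g1_def by (rule s1(2)) simp
    moreover have "(LINT k|int_counting. \<bar>f k\<bar>) = \<bar>f 0\<bar> + suminf g2"
      unfolding g2_def by (rule s2(2)) simp
    ultimately show ?thesis using zero by simp
  qed
  also have "\<dots> = (\<Sum>n. 2 * f (int (Suc n)))"
    using suminf_diff[OF sg] by (simp only: g)
  finally show "(LINT k|int_counting. f k) = (\<Sum>n. 2 * f (int (Suc n)))" .
qed

lemma lipschitz_imp_continuous_on:
  fixes f :: "real \<Rightarrow> complex"
  assumes "\<And>s t. s \<in> S \<Longrightarrow> t \<in> S \<Longrightarrow> cmod (f t - f s) \<le> L * \<bar>t - s\<bar>" "L \<ge> 0"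
  shows "continuous_on S f"
  by (rule lipschitz_on_continuous_on[of L]) (use assms in \<open>auto simp: lipschitz_on_def dist_norm\<close>)

context bounded_mild
begin

text \<open>
  In contrast to \<open>duhamel_sup_bound\<close> the bound is proportional to the elapsed time; it serves to prove
  that the coefficients are Lipschitz in time.
\<close>

lemma duhamel_increment:
  assumes "0 < t0" "t0 \<le> t" and Q: "\<And>s. t0 \<le> s \<Longrightarrow> cmod (q s k) \<le> Q"
  shows "cmod (a t k - of_real (heat_symbol \<nu> \<gamma> (t - t0) k) * a t0 k) \<le> Q * (t - t0)"
proof -
  have Q0: "Q \<ge> 0" using Q[of t0] norm_ge_zero order_trans by blast
  define f where "f s = of_real (heat_symbol \<nu> \<gamma> (t - s) k) * q s k" for s
  define I where "I = (LINT s:{t0..<t}|lborel. f s)"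
  have int: "integrable lborel (\<lambda>s. indicator {t0..<t} s *\<^sub>R f s)"
    using heat_q_set_integrable[OF assms(2), of k] by (simp add: f_def[abs_def] set_integrable_def)
  have "ennreal (cmod I) \<le> (\<integral>\<^sup>+s. ennreal (cmod (indicator {t0..<t} s *\<^sub>R f s)) \<partial>lborel)"
    using integral_norm_bound_ennreal[OF int] by (simp add: I_def set_lebesgue_integral_def)
  also have "\<dots> \<le> (\<integral>\<^sup>+s. ennreal Q * indicator {t0..<t} s \<partial>lborel)"
  proof (rule nn_integral_mono)
    fix s
    have "heat_symbol \<nu> \<gamma> (t - s) k * cmod (q s k) \<le> 1 * Q" if "t0 \<le> s" "s < t"
      using that \<nu>_pos by (intro mult_mono heat_symbol_le_1 Q) auto
    then show "ennreal (cmod (indicator {t0..<t} s *\<^sub>R f s)) \<le> ennreal Q * indicator {t0..<t} s"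
      using heat_symbol_pos[of \<nu> \<gamma> "t - s" k] by (auto simp: indicator_def f_def norm_mult intro: ennreal_leI)
  qed
  also have "\<dots> = ennreal (Q * (t - t0))"
    using assms Q0 by (simp add: nn_integral_cmult_indicator flip: ennreal_mult)
  finally have "cmod I \<le> Q * (t - t0)" using Q0 assms by (subst (asm) ennreal_le_iff) auto
  then show ?thesis
    unfolding duhamel_restart[OF assms(1,2)] I_def f_def by simp
qed

lemma lam_le: "lam k \<le> \<nu> * \<langle>k\<rangle>\<^sup>2"
proof -
  have "\<bar>real_of_int k\<bar> powr \<gamma> \<le> \<langle>k\<rangle> powr \<gamma>" using \<gamma>_pos by (intro powr_mono2) auto
  also have "\<dots> \<le> \<langle>k\<rangle> powr 2" using \<gamma>_le_2 by (intro powr_mono) auto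
  finally show ?thesis using \<nu>_pos by (simp add: lam_def mult_left_mono)
qed

lemma coeff_decay_obtain:
  assumes "t0 > 0"
  obtains C where "C \<ge> 0" "\<And>t k. t \<ge> t0 \<Longrightarrow> cmod (a t k) \<le> C * \<langle>k\<rangle> powr (- p)"
  using coeff_decay_all[of p] assms by (auto simp: coeff_decay_def)

lemma a_lipschitz_in_time:
  assumes t0: "t0 > 0"
  obtains L where "L \<ge> 0" "\<And>s t k. t0 \<le> s \<Longrightarrow> t0 \<le> t \<Longrightarrow> cmod (a t k - a s k) \<le> L * \<bar>t - s\<bar> * \<langle>k\<rangle> powr (- 2)"
proof -
  obtain A where A: "A \<ge> 0" "\<And>t k. t \<ge> t0 \<Longrightarrow> cmod (a t k) \<le> A * \<langle>k\<rangle> powr (- 4)"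
    using coeff_decay_obtain[OF t0] by blast
  define Q where "Q = A + A ^ 3 * (convolution_constant 4)\<^sup>2"
  define L where "L = \<nu> * A + Q"
  have Q0: "Q \<ge> 0" using A by (simp add: Q_def)
  have Q: "cmod (q s k) \<le> Q * \<langle>k\<rangle> powr (- 2)" if s: "s \<ge> t0" for s k
  proof -
    have sp: "s > 0" using s t0 by simp
    have "cmod (q s k) \<le> cmod (a s k) + cmod (d s k)"
      unfolding q_eq[OF sp] by (rule norm_triangle_ineq4)
    also have "\<dots> \<le> A * \<langle>k\<rangle> powr (- 4) + A ^ 3 * (convolution_constant 4)\<^sup>2 * \<langle>k\<rangle> powr (- 4)"
      by (intro add_mono A(2)[OF s] d_decay[OF sp _ A(2)[OF s] A(1)]) simp
    also have "\<dots> = Q * \<langle>k\<rangle> powr (- 4)" by (simp add: Q_def distrib_right)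
    also have "\<dots> \<le> Q * \<langle>k\<rangle> powr (- 2)"
      using Q0 by (intro mult_left_mono powr_mono) auto
    finally show ?thesis .
  qed
  have main: "cmod (a t k - a s k) \<le> L * (t - s) * \<langle>k\<rangle> powr (- 2)" if st: "t0 \<le> s" "s \<le> t" for s t k
  proof -
    define x where "x = 1 + \<bar>real_of_int k\<bar>"
    have x1: "x \<ge> 1" by (simp add: x_def)
    define h where "h = heat_symbol \<nu> \<gamma> (t - s) k"
    have h: "0 \<le> 1 - h" "1 - h \<le> lam k * (t - s)"
      using st heat_symbol_le_1[of \<nu> "t - s" \<gamma> k] \<nu>_pos exp_ge_add_one_self[of "- (lam k * (t - s))"]
      by (auto simp: h_def heat_symbol_lam)
    have "a t k - a s k = (a t k - of_real h * a s k) - of_real (1 - h) * a s k"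
      by (simp add: algebra_simps)
    then have "cmod (a t k - a s k) \<le> cmod (a t k - of_real h * a s k) + cmod (of_real (1 - h) * a s k)"
      by (metis norm_triangle_ineq4)
    also have "cmod (a t k - of_real h * a s k) \<le> Q * x powr (- 2) * (t - s)"
      unfolding h_def x_def using st t0 by (intro duhamel_increment Q) auto
    also have "cmod (of_real (1 - h) * a s k) \<le> (\<nu> * A) * x powr (- 2) * (t - s)"
    proof -
      have "cmod (of_real (1 - h) * a s k) = (1 - h) * cmod (a s k)"
        using h(1) by (simp only: norm_mult norm_of_real abs_of_nonneg)
      also have "\<dots> \<le> (\<nu> * x\<^sup>2 * (t - s)) * (A * x powr (- 4))"
      proof (intro mult_mono)
        show "1 - h \<le> \<nu> * x\<^sup>2 * (t - s)"
          using h(2) mult_right_mono[OF lam_le[of k], of "t - s"] st by (simp add: x_def)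
        show "cmod (a s k) \<le> A * x powr (- 4)" using A(2)[OF st(1)] by (simp add: x_def)
      qed (use st \<nu>_pos in auto)
      also have "\<dots> = (\<nu> * A) * (x powr 2 * x powr (- 4)) * (t - s)"
        using x1 by (simp add: mult_ac)
      also have "x powr 2 * x powr (- 4) = x powr (- 2)" by (simp only: powr_add[symmetric]) simp
      finally show ?thesis .
    qed
    finally show ?thesis by (simp add: L_def x_def algebra_simps)
  qed
  have "cmod (a t k - a s k) \<le> L * \<bar>t - s\<bar> * \<langle>k\<rangle> powr (- 2)" if "t0 \<le> s" "t0 \<le> t" for s t k
    using main[of s t k] main[of t s k] that by (cases "s \<le> t") (auto simp: norm_minus_commute)
  moreover have "L \<ge> 0" using A Q0 \<nu>_pos by (simp add: L_def)
  ultimately show ?thesis using that by blast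
qed

lemma integrable_a:
  assumes "t > 0" shows "integrable int_counting (a t)"
proof -
  obtain A where "\<And>s k. s \<ge> t \<Longrightarrow> cmod (a s k) \<le> A * \<langle>k\<rangle> powr (- 2)"
    using coeff_decay_obtain[OF assms] by blast
  then show ?thesis by (intro integrable_int_bound[of 2 _ A]) auto
qed

text \<open>
  \<open>u\<^sup>3 - v\<^sup>3 = (u - v)(u\<^sup>2 + u v + v\<^sup>2)\<close>: the first factor is paired with the second one.
\<close>

lemma d_lipschitz_in_time:
  assumes t0: "t0 > 0"
  obtains L where "L \<ge> 0" "\<And>s t k. t0 \<le> s \<Longrightarrow> t0 \<le> t \<Longrightarrow> cmod (d t k - d s k) \<le> L * \<bar>t - s\<bar>"
proof -
  obtain L where L: "L \<ge> 0" "\<And>s t k. t0 \<le> s \<Longrightarrow> t0 \<le> t \<Longrightarrow> cmod (a t k - a s k) \<le> L * \<bar>t - s\<bar> * \<langle>k\<rangle> powr (- 2)"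
    using a_lipschitz_in_time[OF t0] by blast
  define W where "W = (LINT k|int_counting. \<langle>k\<rangle> powr (- 2))"
  have W0: "W \<ge> 0" by (simp add: W_def)
  have "cmod (d t k - d s k) \<le> (L * W * (3 * sup_u\<^sup>2)) * \<bar>t - s\<bar>" if st: "t0 \<le> s" "t0 \<le> t" for s t k
  proof -
    have s: "s > 0" and t: "t > 0" using st t0 by auto
    note bs = bdd_borel_u[OF s] and bt = bdd_borel_u[OF t]
    define h where "h x = (of_real ((u t x)\<^sup>2 + u t x * u s x + (u s x)\<^sup>2) :: complex) * cis (- (of_int k * x))" for x
    have bh: "bdd_borel h"
    proof -
      have "bdd_borel (\<lambda>x. (complex_of_real (u t x)) ^ 2 + complex_of_real (u t x) * complex_of_real (u s x) + (complex_of_real (u s x)) ^ 2)"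
        by (intro bdd_borel_add bdd_borel_mult bdd_borel_power bs bt)
      from bdd_borel_mult[OF this bdd_borel_cis_minus[of "of_int k"]] show ?thesis by (simp add: h_def[abs_def])
    qed
    have hle: "cmod (h x) \<le> 3 * sup_u\<^sup>2" for x
    proof -
      have "\<bar>(u t x)\<^sup>2 + u t x * u s x + (u s x)\<^sup>2\<bar> \<le> \<bar>u t x\<bar>\<^sup>2 + \<bar>u t x\<bar> * \<bar>u s x\<bar> + \<bar>u s x\<bar>\<^sup>2"
        using abs_triangle_ineq[of "(u t x)\<^sup>2 + u t x * u s x" "(u s x)\<^sup>2"] abs_triangle_ineq[of "(u t x)\<^sup>2" "u t x * u s x"]
        by (simp add: abs_mult)
      also have "\<dots> \<le> sup_u\<^sup>2 + sup_u * sup_u + sup_u\<^sup>2"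
        using u_le[of t x] u_le[of s x] s t sup_u_nonneg by (intro add_mono power_mono mult_mono) auto
      finally show ?thesis by (simp add: h_def norm_mult power2_eq_square del: of_real_add of_real_mult of_real_power)
    qed
    have diff: "complex_of_real (u t x) * h x - complex_of_real (u s x) * h x
       = (of_real ((u t x) ^ 3) - of_real ((u s x) ^ 3)) * cis (- (of_int k * x))" for x
      by (simp add: h_def power2_eq_square power3_eq_cube algebra_simps)
    have ia: "integrable int_counting (\<lambda>j. a t j - a s j)"
      by (intro Bochner_Integration.integrable_diff integrable_a s t)
    have "d t k - d s k = torus_coeff (\<lambda>x. of_real ((u t x) ^ 3) - of_real ((u s x) ^ 3)) k"
      unfolding d_def by (rule torus_coeff_diff[symmetric, OF bdd_borel_cube[OF t] bdd_borel_cube[OF s]])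
    also have "\<dots> = (1 / (2 * pi)) *\<^sub>R (LINT x|torus. complex_of_real (u t x) * h x - complex_of_real (u s x) * h x)"
      unfolding diff torus_coeff_def ..
    also have "\<dots> = (1 / (2 * pi)) *\<^sub>R (LINT x|torus. complex_of_real (u t x) * h x) - (1 / (2 * pi)) *\<^sub>R (LINT x|torus. complex_of_real (u s x) * h x)"
      by (subst Bochner_Integration.integral_diff)
         (auto intro!: bdd_borel_integrable bdd_borel_mult bs bt bh simp: scaleR_diff_right)
    also have "\<dots> = (LINT j|int_counting. (a t j - a s j) * torus_coeff h (- j))"
      unfolding u_pairing[OF t bh] u_pairing[OF s bh] left_diff_distrib
      by (rule Bochner_Integration.integral_diff[symmetric, OF u_pairing_integrable[OF t bh] u_pairing_integrable[OF s bh]])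
    finally have "cmod (d t k - d s k) \<le> (LINT j|int_counting. cmod (a t j - a s j)) * ((1 / (2 * pi)) * (LINT x|torus. cmod (h x)))"
      using norm_pairing_le[OF ia bh] by simp
    also have "\<dots> \<le> (L * \<bar>t - s\<bar> * W) * (3 * sup_u\<^sup>2)"
    proof (rule mult_mono)
      have "(LINT j|int_counting. cmod (a t j - a s j)) \<le> (LINT j|int_counting. L * \<bar>t - s\<bar> * \<langle>j\<rangle> powr (- 2))"
        by (intro integral_mono integrable_norm ia integrable_mult_right integrable_int_powr L(2) st) auto
      then show "(LINT j|int_counting. cmod (a t j - a s j)) \<le> L * \<bar>t - s\<bar> * W" by (simp add: W_def)
      have "(LINT x|torus. cmod (h x)) \<le> 2 * pi * (3 * sup_u\<^sup>2)"
      proof -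
        have [measurable]: "h \<in> borel_measurable borel" using bh by (simp add: bdd_borel_def)
        have "norm (LINT x|torus. cmod (h x)) \<le> 2 * pi * (3 * sup_u\<^sup>2)"
          by (rule norm_integral_torus_le) (use hle in auto)
        then show ?thesis by simp
      qed
      then show "(1 / (2 * pi)) * (LINT x|torus. cmod (h x)) \<le> 3 * sup_u\<^sup>2" by (simp add: field_simps)
    qed (use L W0 in auto)
    finally show ?thesis by (simp add: mult_ac)
  qed
  moreover have "L * W * (3 * sup_u\<^sup>2) \<ge> 0" using L W0 by simp
  ultimately show ?thesis using that by blast
qed

lemma q_continuous_on:
  assumes t0: "t0 > 0" shows "continuous_on {t0..} (\<lambda>s. q s k)"
proof -
  obtain L where L: "L \<ge> 0" "\<And>s t k. t0 \<le> s \<Longrightarrow> t0 \<le> t \<Longrightarrow> cmod (d t k - d s k) \<le> L * \<bar>t - s\<bar>"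
    using d_lipschitz_in_time[OF t0] by blast
  obtain A where A: "A \<ge> 0" "\<And>s t k. t0 \<le> s \<Longrightarrow> t0 \<le> t \<Longrightarrow> cmod (a t k - a s k) \<le> A * \<bar>t - s\<bar> * \<langle>k\<rangle> powr (- 2)"
    using a_lipschitz_in_time[OF t0] by blast
  have "continuous_on {t0..} (\<lambda>s. d s k)"
    by (rule lipschitz_imp_continuous_on[of _ _ L]) (use L in auto)
  moreover have "continuous_on {t0..} (\<lambda>s. a s k)"
  proof (rule lipschitz_imp_continuous_on[of _ _ "A * \<langle>k\<rangle> powr (- 2)"])
    show "cmod (a t k - a s k) \<le> A * \<langle>k\<rangle> powr (- 2) * \<bar>t - s\<bar>" if "s \<in> {t0..}" "t \<in> {t0..}" for s t
      using A(2)[of s t k] that by (simp add: mult_ac)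
  qed (use A in auto)
  ultimately have "continuous_on {t0..} (\<lambda>s. a s k - d s k)" by (intro continuous_intros)
  then show ?thesis
    by (rule continuous_on_cong[THEN iffD1, rotated -1]) (use t0 in \<open>auto simp: q_eq\<close>)
qed

text \<open>
  After multiplication by \<open>exp (lam k * s)\<close> Duhamel's formula is the integral of a continuous function.
\<close>

lemma a_has_vector_derivative:
  assumes t: "t > 0"
  shows "((\<lambda>t. a t k) has_vector_derivative (- of_real (lam k) * a t k + q t k)) (at t)"
proof -
  define t0 where "t0 = t / 2"
  have t0: "t0 > 0" "t0 < t" using t by (auto simp: t0_def)
  define f where "f s = of_real (exp (lam k * s)) * q s k" for s
  define F where "F s = of_real (exp (lam k * t0)) * a t0 k + integral {t0..s} f" for s
  have cf: "continuous_on {t0..} f" unfolding f_def by (intro continuous_intros q_continuous_on t0)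
  have aF: "a s k = of_real (exp (- (lam k * s))) * F s" if s: "t0 \<le> s" for s
  proof -
    have e: "heat_symbol \<nu> \<gamma> (s - r) k = exp (- (lam k * s)) * exp (lam k * r)" for r
      by (simp add: heat_symbol_lam algebra_simps flip: exp_add)
    have int: "set_integrable lborel {t0..s} f"
      by (rule borel_integrable_atLeastAtMost') (use cf in \<open>auto intro: continuous_on_subset\<close>)
    have ae: "AE r in lborel. r \<noteq> s" by (rule AE_lborel_singleton)
    have fm: "f \<in> borel_measurable borel" unfolding f_def by measurable
    have "(LINT r:{t0..<s}|lborel. of_real (heat_symbol \<nu> \<gamma> (s - r) k) * q r k) = of_real (exp (- (lam k * s))) * (LINT r:{t0..<s}|lborel. f r)"
      by (simp add: e f_def mult.assoc)
    also have "(LINT r:{t0..<s}|lborel. f r) = (LINT r:{t0..s}|lborel. f r)"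
      unfolding set_lebesgue_integral_def
      by (rule integral_cong_AE) (use ae fm in \<open>auto simp: indicator_def elim!: eventually_mono\<close>)
    also have "\<dots> = integral {t0..s} f" by (rule set_borel_integral_eq_integral[OF int])
    finally show ?thesis
      using duhamel_restart[OF t0(1) s, of k] by (simp add: e F_def distrib_left mult.assoc)
  qed
  have "(F has_vector_derivative f t) (at t within {t0..2 * t})"
    unfolding F_def
    by (rule has_vector_derivative_add_const[THEN iffD2, of _ _ _ _] |
        (subst add.commute, subst has_vector_derivative_add_const))
       (rule integral_has_vector_derivative, use cf t t0 in \<open>auto intro: continuous_on_subset\<close>)
  then have "(F has_vector_derivative f t) (at t)"
    using t t0 by (subst (asm) at_within_interior) auto
  moreover have "((\<lambda>s. complex_of_real (exp (- (lam k * s)))) has_vector_derivative of_real (- lam k * exp (- (lam k * t)))) (at t)"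
    by (rule has_vector_derivative_of_real) (auto intro!: derivative_eq_intros simp: has_real_derivative_iff_has_vector_derivative[symmetric])
  ultimately have "((\<lambda>s. of_real (exp (- (lam k * s))) * F s) has_vector_derivative
      (of_real (exp (- (lam k * t))) * f t + of_real (- lam k * exp (- (lam k * t))) * F t)) (at t)"
    by (intro has_vector_derivative_mult)
  moreover have "of_real (exp (- (lam k * t))) * f t = q t k"
    by (simp add: f_def mult.assoc[symmetric] flip: of_real_mult exp_add)
  moreover have "of_real (- lam k * exp (- (lam k * t))) * F t = - of_real (lam k) * a t k"
    using aF[of t] t0 by simp
  ultimately have D: "((\<lambda>s. of_real (exp (- (lam k * s))) * F s) has_vector_derivative (- of_real (lam k) * a t k + q t k)) (at t)"
    by (simp only: add.commute)
  show ?thesis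
    by (rule has_vector_derivative_transform_within_open[OF D, of "{t0<..}"]) (use t0 aF in auto)
qed

text \<open>
  For an odd solution the coefficients are purely imaginary: \<open>a t k = \<i> y t k\<close>.
\<close>

definition y :: "real \<Rightarrow> int \<Rightarrow> real" where "y t k = Im (a t k)"

definition c :: "real \<Rightarrow> int \<Rightarrow> real" where "c t k = Im (d t k)"

lemma a_eq_y: "t > 0 \<Longrightarrow> a t k = \<i> * of_real (y t k)"
  using Re_a_zero[of t k] by (simp add: complex_eq_iff y_def)

lemma norm_a_y: "t > 0 \<Longrightarrow> cmod (a t k) = \<bar>y t k\<bar>"
  by (simp add: norm_a_eq y_def)

lemma y_minus: "y t (- k) = - y t k"
  by (simp add: y_def a_minus)

lemma d_minus: "d t (- k) = cnj (d t k)"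
  unfolding d_def by (rule torus_coeff_of_real_minus)

lemma c_minus: "c t (- k) = - c t k"
  by (simp add: c_def d_minus)

lemma y_zero: "y t 0 = 0"
  using y_minus[of t 0] by simp

lemma y_derivative:
  assumes "t > 0"
  shows "((\<lambda>t. y t k) has_real_derivative (- (lam k - 1) * y t k - c t k)) (at t)"
proof -
  have "((\<lambda>t. Im (a t k)) has_vector_derivative Im (- of_real (lam k) * a t k + q t k)) (at t)"
    by (rule bounded_linear.has_vector_derivative[OF bounded_linear_Im a_has_vector_derivative[OF assms]])
  moreover have "Im (- of_real (lam k) * a t k + q t k) = - (lam k - 1) * y t k - c t k"
    by (simp add: q_eq[OF assms] y_def c_def algebra_simps)
  ultimately show ?thesis by (simp add: has_real_derivative_iff_has_vector_derivative y_def)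
qed

end

section \<open>Dissipation of energy\<close>

lemma nondecreasing_on_ray:
  fixes f f' :: "real \<Rightarrow> real"
  assumes "\<And>t. t \<ge> T \<Longrightarrow> (f has_real_derivative f' t) (at t)" "\<And>t. t \<ge> T \<Longrightarrow> f' t \<ge> 0"
    and "T \<le> s" "s \<le> t"
  shows "f s \<le> f t"
proof (rule DERIV_nonneg_imp_nondecreasing[OF assms(4)])
  fix x assume "s \<le> x" "x \<le> t"
  then have "x \<ge> T" using assms(3) by simp
  then show "\<exists>y. (f has_real_derivative y) (at x) \<and> 0 \<le> y" using assms(1,2) by blast
qed

text \<open>
  The differences of a supersolution with a solution and with its negative, multiplied by the
  integrating factor, are nondecreasing.
\<close>

lemma damped_comparison:
  fixes y z z' b :: "real \<Rightarrow> real"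
  assumes y: "\<And>t. t \<ge> T \<Longrightarrow> (y has_real_derivative (- \<mu> * y t - b t)) (at t)"
    and z: "\<And>t. t \<ge> T \<Longrightarrow> (z has_real_derivative z' t) (at t)"
    and b: "\<And>t. t \<ge> T \<Longrightarrow> \<bar>b t\<bar> \<le> z' t + \<mu> * z t"
    and init: "\<bar>y T\<bar> \<le> z T" and t: "t \<ge> T"
  shows "\<bar>y t\<bar> \<le> z t"
proof -
  have 1: "exp (\<mu> * T) * (z T - y T) \<le> exp (\<mu> * t) * (z t - y t)"
  proof (rule nondecreasing_on_ray[where f = "\<lambda>t. exp (\<mu> * t) * (z t - y t)" and f' = "\<lambda>r. exp (\<mu> * r) * (z' r + \<mu> * z r + b r)" and T = T])
    show "((\<lambda>t. exp (\<mu> * t) * (z t - y t)) has_real_derivative exp (\<mu> * r) * (z' r + \<mu> * z r + b r)) (at r)" if "r \<ge> T" for r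
      by (rule derivative_eq_intros y[OF that] z[OF that] refl)+ (simp add: algebra_simps)
    show "0 \<le> exp (\<mu> * r) * (z' r + \<mu> * z r + b r)" if "r \<ge> T" for r
      using b[OF that] by simp
  qed (use t in auto)
  have 2: "exp (\<mu> * T) * (z T + y T) \<le> exp (\<mu> * t) * (z t + y t)"
  proof (rule nondecreasing_on_ray[where f = "\<lambda>t. exp (\<mu> * t) * (z t + y t)" and f' = "\<lambda>r. exp (\<mu> * r) * (z' r + \<mu> * z r - b r)" and T = T])
    show "((\<lambda>t. exp (\<mu> * t) * (z t + y t)) has_real_derivative exp (\<mu> * r) * (z' r + \<mu> * z r - b r)) (at r)" if "r \<ge> T" for r
      by (rule derivative_eq_intros y[OF that] z[OF that] refl)+ (simp add: algebra_simps)
    show "0 \<le> exp (\<mu> * r) * (z' r + \<mu> * z r - b r)" if "r \<ge> T" for r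
      using b[OF that] by simp
  qed (use t in auto)
  have "0 \<le> exp (\<mu> * T) * (z T - y T)" "0 \<le> exp (\<mu> * T) * (z T + y T)"
    using init by auto
  with 1 2 have "0 \<le> exp (\<mu> * t) * (z t - y t)" "0 \<le> exp (\<mu> * t) * (z t + y t)" by linarith+
  then show ?thesis by (auto simp: zero_le_mult_iff)
qed

context bounded_mild
begin

definition energy :: "real \<Rightarrow> real" where
  "energy t = (1 / (2 * pi)) * (LINT x|torus. (u t x)\<^sup>2)"

lemma energy_nonneg: "energy t \<ge> 0"
  by (simp add: energy_def)

lemma integrable_u_power:
  assumes "t > 0" shows "integrable torus (\<lambda>x. (u t x) ^ n)"
proof (rule integrable_torus)
  have [measurable]: "u t \<in> borel_measurable borel" by (rule u_measurable[OF assms])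
  show "(\<lambda>x. u t x ^ n) \<in> borel_measurable borel" by measurable
  show "norm (u t x ^ n) \<le> sup_u ^ n" for x
    using u_le[of t x] assms by (auto simp: power_abs intro: power_mono)
qed

lemma d_decay_obtain:
  assumes "t0 > 0"
  obtains D where "D \<ge> 0" "\<And>t k. t \<ge> t0 \<Longrightarrow> cmod (d t k) \<le> D * \<langle>k\<rangle> powr (- 2)"
proof -
  obtain A where A: "A \<ge> 0" "\<And>t k. t \<ge> t0 \<Longrightarrow> cmod (a t k) \<le> A * \<langle>k\<rangle> powr (- 2)"
    using coeff_decay_obtain[OF assms] by blast
  have "cmod (d t k) \<le> A ^ 3 * (convolution_constant 2)\<^sup>2 * \<langle>k\<rangle> powr (- 2)" if "t \<ge> t0" for t k
    using that assms A by (intro d_decay) auto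
  then show ?thesis using that[of "A ^ 3 * (convolution_constant 2)\<^sup>2"] A(1) by simp
qed

text \<open>
  The two modes \<open>k\<close> and \<open>- k\<close> contribute equally, hence the factor \<open>2\<close>.
\<close>

lemma
  assumes t: "t > 0"
  shows energy_summable: "summable (\<lambda>n. 2 * (y t (int (Suc n)))\<^sup>2)"
    and energy_series: "energy t = (\<Sum>n. 2 * (y t (int (Suc n)))\<^sup>2)"
proof -
  have *: "a t k * torus_coeff (\<lambda>x. of_real (u t x)) (- k) = of_real ((y t k)\<^sup>2)" for k
  proof -
    have "a t k * torus_coeff (\<lambda>x. of_real (u t x)) (- k) = a t k * a t (- k)" by (simp add: a_def)
    also have "\<dots> = of_real ((y t k)\<^sup>2)" by (simp add: complex_eq_iff a_eq_y[OF t] y_minus power2_eq_square)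
    finally show ?thesis .
  qed
  have int: "integrable int_counting (\<lambda>k. (y t k)\<^sup>2)"
    using u_pairing_integrable[OF t bdd_borel_u[OF t]] by (simp only: * complex_of_real_integrable_eq)
  have "complex_of_real (energy t) = (1 / (2 * pi)) *\<^sub>R (LINT x|torus. complex_of_real (u t x) * complex_of_real (u t x))"
    by (simp add: energy_def scaleR_conv_of_real power2_eq_square flip: of_real_mult)
  also have "\<dots> = complex_of_real (LINT k|int_counting. (y t k)\<^sup>2)"
    unfolding u_pairing[OF t bdd_borel_u[OF t]] * by (rule integral_complex_of_real)
  finally have eq: "energy t = (LINT k|int_counting. (y t k)\<^sup>2)" by (simp only: of_real_eq_iff)
  show "summable (\<lambda>n. 2 * (y t (int (Suc n)))\<^sup>2)"
    by (rule summable_int_even[OF int]) (auto simp: y_minus y_zero)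
  show "energy t = (\<Sum>n. 2 * (y t (int (Suc n)))\<^sup>2)"
    unfolding eq by (rule integral_int_even[OF int]) (auto simp: y_minus y_zero)
qed

lemma
  assumes t: "t > 0"
  shows quartic_summable: "summable (\<lambda>n. 2 * (y t (int (Suc n)) * c t (int (Suc n))))"
    and quartic_series: "(1 / (2 * pi)) * (LINT x|torus. (u t x) ^ 4) = (\<Sum>n. 2 * (y t (int (Suc n)) * c t (int (Suc n))))"
proof -
  note b3 = bdd_borel_cube[OF t]
  have *: "Re (a t k * torus_coeff (\<lambda>x. of_real ((u t x) ^ 3)) (- k)) = y t k * c t k" for k
  proof -
    have "torus_coeff (\<lambda>x. of_real ((u t x) ^ 3)) (- k) = cnj (d t k)" using d_minus[of t k] unfolding d_def .
    then show ?thesis by (simp only: a_eq_y[OF t]) (simp add: c_def)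
  qed
  note iu = u_pairing_integrable[OF t b3]
  have int: "integrable int_counting (\<lambda>k. y t k * c t k)"
    using integrable_Re[OF iu] by (simp only: *)
  have "complex_of_real ((1 / (2 * pi)) * (LINT x|torus. (u t x) ^ 4)) = (1 / (2 * pi)) *\<^sub>R (LINT x|torus. complex_of_real (u t x) * complex_of_real ((u t x) ^ 3))"
    by (simp add: scaleR_conv_of_real power_Suc[symmetric] numeral_eq_Suc flip: of_real_mult of_real_power)
  also have "\<dots> = (LINT k|int_counting. a t k * torus_coeff (\<lambda>x. of_real ((u t x) ^ 3)) (- k))"
    by (rule u_pairing[OF t b3])
  finally have "(1 / (2 * pi)) * (LINT x|torus. (u t x) ^ 4) = Re (LINT k|int_counting. a t k * torus_coeff (\<lambda>x. of_real ((u t x) ^ 3)) (- k))"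
    by (metis Re_complex_of_real)
  also have "\<dots> = (LINT k|int_counting. y t k * c t k)"
    unfolding integral_Re[OF iu, symmetric] by (simp only: *)
  finally have eq: "(1 / (2 * pi)) * (LINT x|torus. (u t x) ^ 4) = (LINT k|int_counting. y t k * c t k)" .
  show "summable (\<lambda>n. 2 * (y t (int (Suc n)) * c t (int (Suc n))))"
    by (rule summable_int_even[OF int]) (auto simp: y_minus c_minus y_zero)
  show "(1 / (2 * pi)) * (LINT x|torus. (u t x) ^ 4) = (\<Sum>n. 2 * (y t (int (Suc n)) * c t (int (Suc n))))"
    unfolding eq by (rule integral_int_even[OF int]) (auto simp: y_minus c_minus y_zero)
qed

text \<open>
  The variance of \<open>u\<^sup>2\<close> is nonnegative.
\<close>

lemma energy_sq_le_quartic: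
  assumes t: "t > 0"
  shows "(energy t)\<^sup>2 \<le> (1 / (2 * pi)) * (LINT x|torus. (u t x) ^ 4)"
proof -
  define E where "E = energy t"
  note i4 = integrable_u_power[OF t, of 4] and i2 = integrable_u_power[OF t, of 2]
  have ic: "integrable torus (\<lambda>x. E\<^sup>2)" by (rule integrable_torus[of _ "E\<^sup>2"]) auto
  have "0 \<le> (LINT x|torus. ((u t x)\<^sup>2 - E)\<^sup>2)" by simp
  also have "(\<lambda>x. ((u t x)\<^sup>2 - E)\<^sup>2) = (\<lambda>x. (u t x) ^ 4 - (2 * E) * (u t x)\<^sup>2 + E\<^sup>2)"
    by (simp add: fun_eq_iff power2_diff power_mult[symmetric])
  also have "(LINT x|torus. (u t x) ^ 4 - (2 * E) * (u t x)\<^sup>2 + E\<^sup>2)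
      = (LINT x|torus. (u t x) ^ 4) - (2 * E) * (LINT x|torus. (u t x)\<^sup>2) + 2 * pi * E\<^sup>2"
    using i4 i2 ic by simp
  also have "(LINT x|torus. (u t x)\<^sup>2) = 2 * pi * E" by (simp add: E_def energy_def)
  finally show ?thesis by (simp add: E_def[symmetric] field_simps power2_eq_square)
qed

text \<open>
  The cubic term is quadratically small although only \<open>\<bar>u\<bar> \<le> sup_u\<close> is known pointwise.
\<close>

lemma norm_d_le_energy:
  assumes t: "t > 0" shows "cmod (d t k) \<le> sup_u * energy t"
proof -
  have "cmod (d t k) \<le> (1 / (2 * pi)) * (LINT x|torus. cmod (of_real ((u t x) ^ 3)))"
    unfolding d_def by (rule norm_torus_coeff_le_L1[OF bdd_borel_cube[OF t]])
  also have "\<dots> \<le> (1 / (2 * pi)) * (LINT x|torus. sup_u * (u t x)\<^sup>2)"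
  proof (intro mult_left_mono integral_mono)
    show "integrable torus (\<lambda>x. cmod (complex_of_real ((u t x) ^ 3)))"
      by (rule integrable_norm[OF bdd_borel_integrable[OF bdd_borel_cube[OF t]]])
    show "integrable torus (\<lambda>x. sup_u * (u t x)\<^sup>2)"
      by (rule integrable_mult_right[OF integrable_u_power[OF t]])
    show "cmod (complex_of_real ((u t x) ^ 3)) \<le> sup_u * (u t x)\<^sup>2" for x
    proof -
      have "cmod (complex_of_real ((u t x) ^ 3)) = \<bar>u t x\<bar> * (u t x)\<^sup>2"
        unfolding norm_of_real by (simp add: power_abs power3_eq_cube power2_eq_square abs_mult)
      then show ?thesis using u_le[of t x] t by (simp add: mult_right_mono)
    qed
  qed simp
  finally show ?thesis by (simp add: energy_def)
qed

lemma abs_c_le_energy: "t > 0 \<Longrightarrow> \<bar>c t k\<bar> \<le> sup_u * energy t"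
  using norm_d_le_energy[of t k] abs_Im_le_cmod[of "d t k"] by (simp add: c_def)

lemma lam_ge_viscosity: "k \<noteq> 0 \<Longrightarrow> lam k \<ge> \<nu>"
  using ge_one_powr_ge_zero[of "\<bar>real_of_int k\<bar>" \<gamma>] abs_int_ge_1[of k] \<gamma>_pos \<nu>_pos
  by (simp add: lam_def)

text \<open>
  The decay of the coefficients in \<open>k\<close>, uniform near \<open>t\<close>, permits differentiation term by term.
\<close>

lemma energy_derivative:
  assumes t: "t > 0"
  shows "(energy has_real_derivative (\<Sum>n. 4 * y t (int (Suc n)) * (- (lam (int (Suc n)) - 1) * y t (int (Suc n)) - c t (int (Suc n))))) (at t)"
    and "summable (\<lambda>n. 4 * y t (int (Suc n)) * (- (lam (int (Suc n)) - 1) * y t (int (Suc n)) - c t (int (Suc n))))"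
proof -
  define t0 where "t0 = t / 2"
  have t0: "t0 > 0" "t0 < t" using t by (auto simp: t0_def)
  obtain A where A: "A \<ge> 0" "\<And>t k. t \<ge> t0 \<Longrightarrow> cmod (a t k) \<le> A * \<langle>k\<rangle> powr (- 2)"
    using coeff_decay_obtain[OF t0(1)] by blast
  obtain D where D: "D \<ge> 0" "\<And>t k. t \<ge> t0 \<Longrightarrow> cmod (d t k) \<le> D * \<langle>k\<rangle> powr (- 2)"
    using d_decay_obtain[OF t0(1)] by blast
  define f where "f n t = 2 * (y t (int (Suc n)))\<^sup>2" for n t
  define f' where "f' n t = 4 * y t (int (Suc n)) * (- (lam (int (Suc n)) - 1) * y t (int (Suc n)) - c t (int (Suc n)))" for n t
  define B where "B = 4 * A * (\<nu> * A + D)"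
  have bound: "\<bar>f' n s\<bar> \<le> B * real (n + 2) powr (- 2)" if s: "s \<ge> t0" for n s
  proof -
    define k where "k = int (Suc n)"
    define x where "x = 1 + \<bar>real_of_int k\<bar>"
    have x: "x = real (n + 2)" by (simp add: x_def k_def)
    have x1: "x \<ge> 1" by (simp add: x_def)
    have k0: "k \<noteq> 0" by (simp add: k_def)
    have sp: "s > 0" using s t0 by simp
    have ya: "\<bar>y s k\<bar> \<le> A * x powr (- 2)" using A(2)[OF s, of k] by (simp add: norm_a_y[OF sp] x_def)
    have ca: "\<bar>c s k\<bar> \<le> D * 1"
    proof -
      have "\<bar>c s k\<bar> \<le> D * x powr (- 2)"
        using D(2)[OF s, of k] abs_Im_le_cmod[of "d s k"] by (simp add: c_def x_def)
      also have "\<dots> \<le> D * 1"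
        using x1 D(1) powr_mono[of "-2" 0 x] by (intro mult_left_mono) auto
      finally show ?thesis .
    qed
    have "\<bar>- (lam k - 1) * y s k - c s k\<bar> \<le> \<bar>lam k - 1\<bar> * \<bar>y s k\<bar> + \<bar>c s k\<bar>"
      using abs_triangle_ineq4[of "- (lam k - 1) * y s k" "c s k"] by (simp add: abs_mult abs_minus_commute)
    also have "\<bar>lam k - 1\<bar> * \<bar>y s k\<bar> \<le> (\<nu> * x\<^sup>2) * (A * x powr (- 2))"
      using lam_le[of k] lam_ge_1[OF k0] ya by (intro mult_mono) (auto simp: x_def)
    also have "\<dots> = \<nu> * A * (x powr 2 * x powr (- 2))" using x1 by simp
    also have "x powr 2 * x powr (- 2) = 1" using x1 by (simp only: powr_add[symmetric]) simp
    finally have 2: "\<bar>- (lam k - 1) * y s k - c s k\<bar> \<le> \<nu> * A + D" using ca by simp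
    have "\<bar>f' n s\<bar> = 4 * (\<bar>y s k\<bar> * \<bar>- (lam k - 1) * y s k - c s k\<bar>)"
      by (simp add: f'_def k_def abs_mult)
    also have "\<dots> \<le> 4 * ((A * x powr (- 2)) * (\<nu> * A + D))"
      by (intro mult_left_mono mult_mono ya 2) (use A in auto)
    finally show ?thesis unfolding B_def x by (simp only: mult_ac)
  qed
  have sB: "summable (\<lambda>n. B * real (n + 2) powr (- 2))"
    using summable_ignore_initial_segment[of "\<lambda>n. real n powr (- 2)" 2]
    by (intro summable_mult) (simp add: summable_real_powr_iff)
  have der: "(f n has_real_derivative f' n s) (at s)" if "s \<ge> t0" for n s
  proof -
    have "s > 0" using that t0 by simp
    show ?thesis unfolding f_def f'_def
      by (rule derivative_eq_intros y_derivative[OF \<open>s > 0\<close>] refl)+ simp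
  qed
  have unif: "uniformly_convergent_on {t0..} (\<lambda>n s. \<Sum>i<n. f' i s)"
    by (rule Weierstrass_m_test'[OF _ sB]) (use bound in auto)
  have "((\<lambda>s. \<Sum>n. f n s) has_real_derivative (\<Sum>n. f' n t)) (at t)"
  proof (rule has_field_derivative_series'(2)[OF _ _ unif, of _ t])
    show "convex {t0..}" by simp
    show "(f n has_real_derivative f' n s) (at s within {t0..})" if "s \<in> {t0..}" for n s
      using der[of s n] that by (auto intro: has_field_derivative_at_within)
    show "t \<in> {t0..}" "t \<in> interior {t0..}" using t0 by (auto simp: interior_real_atLeast)
    show "summable (\<lambda>n. f n t)" unfolding f_def by (rule energy_summable[OF t])
  qed
  then have "(energy has_real_derivative (\<Sum>n. f' n t)) (at t)"
    by (rule has_field_derivative_transform_within_open[of _ _ _ "{0<..}"]) (use t energy_series in \<open>auto simp: f_def\<close>)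
  then show "(energy has_real_derivative (\<Sum>n. 4 * y t (int (Suc n)) * (- (lam (int (Suc n)) - 1) * y t (int (Suc n)) - c t (int (Suc n))))) (at t)"
    by (simp only: f'_def)
  have "summable (\<lambda>n. f' n t)"
    by (rule summable_comparison_test'[OF sB, of 0]) (use bound[of t] t0 in auto)
  then show "summable (\<lambda>n. 4 * y t (int (Suc n)) * (- (lam (int (Suc n)) - 1) * y t (int (Suc n)) - c t (int (Suc n))))"
    by (simp only: f'_def)
qed

text \<open>
  The linear part uses \<open>lam k \<ge> \<nu>\<close> for \<open>k \<noteq> 0\<close>; the cubic part sums up to the mean of \<open>u\<^sup>4\<close>.
\<close>

lemma energy_dissipation:
  assumes t: "t > 0"
  obtains E' where "(energy has_real_derivative E') (at t)" "E' \<le> - 2 * (\<nu> - 1) * energy t - 2 * (energy t)\<^sup>2"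
proof -
  define E' where "E' = (\<Sum>n. 4 * y t (int (Suc n)) * (- (lam (int (Suc n)) - 1) * y t (int (Suc n)) - c t (int (Suc n))))"
  have s: "summable (\<lambda>n. - 2 * (\<nu> - 1) * (2 * (y t (int (Suc n)))\<^sup>2) - 2 * (2 * (y t (int (Suc n)) * c t (int (Suc n)))))"
    by (intro summable_diff summable_mult energy_summable[OF t] quartic_summable[OF t])
  have "E' \<le> (\<Sum>n. - 2 * (\<nu> - 1) * (2 * (y t (int (Suc n)))\<^sup>2) - 2 * (2 * (y t (int (Suc n)) * c t (int (Suc n)))))"
    unfolding E'_def
  proof (rule suminf_le[OF _ energy_derivative(2)[OF t] s])
    fix n
    define k where "k = int (Suc n)"
    have "k \<noteq> 0" by (simp add: k_def)
    then have "(\<nu> - 1) * (y t k)\<^sup>2 \<le> (lam k - 1) * (y t k)\<^sup>2"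
      using lam_ge_viscosity[of k] by (intro mult_right_mono) auto
    then show "4 * y t (int (Suc n)) * (- (lam (int (Suc n)) - 1) * y t (int (Suc n)) - c t (int (Suc n)))
        \<le> - 2 * (\<nu> - 1) * (2 * (y t (int (Suc n)))\<^sup>2) - 2 * (2 * (y t (int (Suc n)) * c t (int (Suc n))))"
      unfolding k_def[symmetric] by (simp add: algebra_simps power2_eq_square)
  qed
  also have "\<dots> = - 2 * (\<nu> - 1) * energy t - 2 * ((1 / (2 * pi)) * (LINT x|torus. (u t x) ^ 4))"
    unfolding energy_series[OF t] quartic_series[OF t]
      suminf_diff[OF summable_mult[OF energy_summable[OF t]] summable_mult[OF quartic_summable[OF t]], symmetric]
      suminf_mult[OF energy_summable[OF t]] suminf_mult[OF quartic_summable[OF t]] ..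
  also have "\<dots> \<le> - 2 * (\<nu> - 1) * energy t - 2 * (energy t)\<^sup>2"
    using energy_sq_le_quartic[OF t] by simp
  finally show ?thesis using energy_derivative(1)[OF t] that by (simp add: E'_def)
qed

lemma energy_exponential_decay:
  assumes "t \<ge> 1"
  shows "energy t \<le> energy 1 * exp (2 * (\<nu> - 1)) * exp (- 2 * (\<nu> - 1) * t)"
proof -
  define l where "l = 2 * (\<nu> - 1)"
  have "\<exists>E'. (energy has_real_derivative E') (at s) \<and> E' \<le> - l * energy s" if sp: "s > 0" for s
  proof -
    obtain E' where "(energy has_real_derivative E') (at s)" "E' \<le> - 2 * (\<nu> - 1) * energy s - 2 * (energy s)\<^sup>2"
      using energy_dissipation[OF sp] by blast
    moreover have "0 \<le> (energy s)\<^sup>2" by simp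
    ultimately have "E' \<le> - l * energy s" unfolding l_def by linarith
    then show ?thesis using \<open>(energy has_real_derivative E') (at s)\<close> by blast
  qed
  then obtain E' where E': "\<And>s. s > 0 \<Longrightarrow> (energy has_real_derivative E' s) (at s)" "\<And>s. s > 0 \<Longrightarrow> E' s \<le> - l * energy s"
    by metis
  have "- (exp (l * 1) * energy 1) \<le> - (exp (l * t) * energy t)"
  proof (rule nondecreasing_on_ray[where f = "\<lambda>t. - (exp (l * t) * energy t)" and f' = "\<lambda>s. - (exp (l * s) * (E' s + l * energy s))" and T = 1])
    show "((\<lambda>t. - (exp (l * t) * energy t)) has_real_derivative - (exp (l * s) * (E' s + l * energy s))) (at s)" if "s \<ge> 1" for s
      using that by (auto intro!: derivative_eq_intros E'(1) simp: algebra_simps)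
    show "0 \<le> - (exp (l * s) * (E' s + l * energy s))" if "s \<ge> 1" for s
      using E'(2)[of s] that by (simp add: mult_nonneg_nonpos)
  qed (use assms in auto)
  then have "energy t \<le> energy 1 * exp l * exp (- (l * t))"
    by (simp add: exp_minus field_simps)
  moreover have "exp (- 2 * (\<nu> - 1) * t) = exp (- (l * t))" by (simp add: l_def algebra_simps)
  ultimately show ?thesis by (simp only: l_def)
qed

text \<open>
  As long as the energy is positive, the derivative of its reciprocal is at least \<open>2\<close>.
\<close>

lemma energy_algebraic_decay:
  assumes "t \<ge> 2"
  shows "energy t \<le> 1 / t"
proof (cases "energy t = 0")
  case False
  have "\<exists>E'. (energy has_real_derivative E') (at s) \<and> E' \<le> - 2 * (energy s)\<^sup>2" if sp: "s > 0" for s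
  proof -
    obtain E' where "(energy has_real_derivative E') (at s)" "E' \<le> - 2 * (\<nu> - 1) * energy s - 2 * (energy s)\<^sup>2"
      using energy_dissipation[OF sp] by blast
    moreover have "0 \<le> 2 * (\<nu> - 1) * energy s" using \<nu>_ge_1 energy_nonneg[of s] by simp
    ultimately have "E' \<le> - 2 * (energy s)\<^sup>2" by linarith
    then show ?thesis using \<open>(energy has_real_derivative E') (at s)\<close> by blast
  qed
  then obtain E' where E': "\<And>s. s > 0 \<Longrightarrow> (energy has_real_derivative E' s) (at s)" "\<And>s. s > 0 \<Longrightarrow> E' s \<le> - 2 * (energy s)\<^sup>2"
    by metis
  have decr: "energy s \<le> energy r" if "1 \<le> r" "r \<le> s" for r s
  proof -
    have "- energy r \<le> - energy s"
    proof (rule nondecreasing_on_ray[where f = "\<lambda>s. - energy s" and f' = "\<lambda>p. - E' p" and T = 1])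
      show "((\<lambda>s. - energy s) has_real_derivative - E' p) (at p)" if "p \<ge> 1" for p
        using that by (intro DERIV_minus E'(1)) auto
      show "0 \<le> - E' p" if "p \<ge> 1" for p
      proof -
        have "0 \<le> (energy p)\<^sup>2" by simp
        then show ?thesis using E'(2)[of p] that by linarith
      qed
    qed (use that in auto)
    then show ?thesis by simp
  qed
  have pos: "energy s > 0" if "1 \<le> s" "s \<le> t" for s
    using decr[OF that] False energy_nonneg[of t] by linarith
  have "1 / energy 1 - 2 * 1 \<le> 1 / energy t - 2 * t"
  proof (rule DERIV_nonneg_imp_nondecreasing[where f = "\<lambda>s. 1 / energy s - 2 * s"])
    fix s assume s: "1 \<le> s" "s \<le> t"
    have "((\<lambda>s. 1 / energy s - 2 * s) has_real_derivative (- E' s / (energy s)\<^sup>2 - 2)) (at s)"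
      using s pos[OF s] by (auto intro!: derivative_eq_intros E'(1) simp: power2_eq_square)
    moreover have "0 \<le> - E' s / (energy s)\<^sup>2 - 2"
      using E'(2)[of s] s pos[OF s] by (simp add: field_simps)
    ultimately show "\<exists>D. ((\<lambda>s. 1 / energy s - 2 * s) has_real_derivative D) (at s) \<and> 0 \<le> D" by blast
  qed (use assms in auto)
  moreover have "1 / energy 1 > 0" using pos[of 1] assms by simp
  ultimately have "t \<le> 1 / energy t" using assms by linarith
  then show ?thesis using pos[of t] assms by (simp add: field_simps)
qed (use assms in simp)

end

section \<open>Asymptotics of scalar equations\<close>

lemma bounded_nondecreasing_converges:
  fixes f :: "real \<Rightarrow> real"
  assumes mono: "\<And>s t. T \<le> s \<Longrightarrow> s \<le> t \<Longrightarrow> f s \<le> f t" and B: "\<And>t. T \<le> t \<Longrightarrow> f t \<le> B"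
  shows "\<exists>l. (f \<longlongrightarrow> l) at_top"
proof
  have bdd: "bdd_above (f ` {T..})" using B by (auto simp: bdd_above_def)
  show "(f \<longlongrightarrow> (SUP t\<in>{T..}. f t)) at_top"
  proof (rule increasing_tendsto)
    show "\<forall>\<^sub>F t in at_top. f t \<le> (SUP t\<in>{T..}. f t)"
      using eventually_ge_at_top[of T] by eventually_elim (auto intro: cSUP_upper bdd)
    fix x assume "x < (SUP t\<in>{T..}. f t)"
    then obtain s where s: "s \<ge> T" "x < f s" using less_cSUP_iff[OF _ bdd] by auto
    show "\<forall>\<^sub>F t in at_top. x < f t"
      using eventually_ge_at_top[of s] by eventually_elim (use s mono[of s] in force)
  qed
qed

text \<open>
  Subtracting \<open>K/\<delta> exp (- \<delta> t)\<close>, the integral of the bound from \<open>t\<close> to infinity, makes \<open>v\<close> nondecreasing,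
  and adding it makes \<open>v\<close> nonincreasing.
\<close>

lemma converges_of_exponential_derivative_bound:
  fixes v v' :: "real \<Rightarrow> real"
  assumes v: "\<And>t. t \<ge> T \<Longrightarrow> (v has_real_derivative v' t) (at t)"
    and b: "\<And>t. t \<ge> T \<Longrightarrow> \<bar>v' t\<bar> \<le> K * exp (- (\<delta> * t))" and \<delta>: "\<delta> > 0"
  shows "\<exists>l. (v \<longlongrightarrow> l) at_top"
proof -
  define p where "p t = v t - K / \<delta> * exp (- (\<delta> * t))" for t
  have p: "p s \<le> p t" if "T \<le> s" "s \<le> t" for s t
  proof (rule nondecreasing_on_ray[where f = p and f' = "\<lambda>t. v' t + K * exp (- (\<delta> * t))" and T = T])
    show "(p has_real_derivative v' t + K * exp (- (\<delta> * t))) (at t)" if "T \<le> t" for t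
      unfolding p_def using \<delta> by (auto intro!: derivative_eq_intros v[OF that])
    show "0 \<le> v' t + K * exp (- (\<delta> * t))" if "T \<le> t" for t using b[OF that] by linarith
  qed (use that in auto)
  have n: "- (v s + K / \<delta> * exp (- (\<delta> * s))) \<le> - (v t + K / \<delta> * exp (- (\<delta> * t)))" if "T \<le> s" "s \<le> t" for s t
  proof (rule nondecreasing_on_ray[where f = "\<lambda>t. - (v t + K / \<delta> * exp (- (\<delta> * t)))" and f' = "\<lambda>t. - (v' t - K * exp (- (\<delta> * t)))" and T = T])
    show "((\<lambda>t. - (v t + K / \<delta> * exp (- (\<delta> * t)))) has_real_derivative - (v' t - K * exp (- (\<delta> * t)))) (at t)" if "T \<le> t" for t
      using \<delta> by (auto intro!: derivative_eq_intros v[OF that])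
    show "0 \<le> - (v' t - K * exp (- (\<delta> * t)))" if "T \<le> t" for t using b[OF that] by linarith
  qed (use that in auto)
  have "0 \<le> K * exp (- (\<delta> * T))" using b[of T] by linarith
  then have K: "K \<ge> 0" by (simp add: zero_le_mult_iff)
  have "p t \<le> v T + K / \<delta> * exp (- (\<delta> * T))" if "T \<le> t" for t
  proof -
    have "0 \<le> K / \<delta> * exp (- (\<delta> * t))" using K \<delta> by simp
    then show ?thesis using n[of T t] that unfolding p_def by linarith
  qed
  with p obtain l where l: "(p \<longlongrightarrow> l) at_top"
    using bounded_nondecreasing_converges[of T p] by blast
  have "filterlim (\<lambda>t. \<delta> * t) at_top at_top"
    using \<delta> by (intro filterlim_tendsto_pos_mult_at_top[OF tendsto_const]) (auto intro: filterlim_ident)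
  then have "((\<lambda>t. exp (- (\<delta> * t))) \<longlongrightarrow> 0) at_top"
    by (intro filterlim_compose[OF exp_at_bot]) (simp add: filterlim_uminus_at_bot)
  then have "((\<lambda>t. p t + K / \<delta> * exp (- (\<delta> * t))) \<longlongrightarrow> l + K / \<delta> * 0) at_top"
    by (intro tendsto_intros l)
  then show ?thesis by (auto simp: p_def)
qed

text \<open>At the last zero before a negative value the derivative would be nonpositive.\<close>

lemma barrier:
  fixes f f' :: "real \<Rightarrow> real"
  assumes f: "\<And>t. t \<ge> T \<Longrightarrow> (f has_real_derivative f' t) (at t)"
    and zero: "\<And>t. t \<ge> T \<Longrightarrow> f t = 0 \<Longrightarrow> f' t > 0"
    and init: "f T \<ge> 0" and t: "t \<ge> T"
  shows "f t \<ge> 0"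
proof (rule ccontr)
  assume neg: "\<not> f t \<ge> 0"
  define S where "S = {s \<in> {T..t}. f s \<ge> 0}"
  have cont: "continuous_on {T..t} f"
  proof (intro continuous_at_imp_continuous_on ballI)
    fix x assume "x \<in> {T..t}"
    then show "isCont f x" by (intro DERIV_isCont[OF f]) simp
  qed
  have "S = {T..t} \<inter> f -` {0..}" by (auto simp: S_def)
  then have "closed S" using continuous_closed_preimage[OF cont, of "{0..}"] by simp
  have "T \<in> S" using init t by (simp add: S_def)
  have bdd: "bdd_above S" by (auto simp: S_def bdd_above_def)
  define s where "s = Sup S"
  have "s \<in> S" unfolding s_def using \<open>closed S\<close> \<open>T \<in> S\<close> bdd by (intro closed_contains_Sup) auto
  then have s: "T \<le> s" "s \<le> t" "f s \<ge> 0" by (auto simp: S_def)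
  have st: "s < t" using s neg by (cases "s = t") auto
  have after: "f r < 0" if "s < r" "r \<le> t" for r
  proof (rule ccontr)
    assume "\<not> f r < 0"
    then have "r \<in> S" using that s by (auto simp: S_def)
    then have "r \<le> s" unfolding s_def using bdd by (rule cSup_upper)
    then show False using that by simp
  qed
  have "f s = 0"
  proof (rule ccontr)
    assume "f s \<noteq> 0"
    then have "f s > 0" using s by simp
    have "\<exists>x\<ge>s. x \<le> t \<and> f x = 0"
      by (rule IVT2') (use neg st s cont \<open>f s > 0\<close> in \<open>auto intro: continuous_on_subset\<close>)
    then obtain x where "s \<le> x" "x \<le> t" "f x = 0" by blast
    then show False using after[of x] \<open>f s > 0\<close> by (cases "x = s") auto
  qed
  obtain e where e: "e > 0" "\<And>h. 0 < h \<Longrightarrow> h < e \<Longrightarrow> f s < f (s + h)"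
    using DERIV_pos_inc_right[OF f[OF s(1)] zero[OF s(1) \<open>f s = 0\<close>]] by blast
  define h where "h = min (e / 2) (t - s)"
  have "f s < f (s + h)" using e(1) st by (intro e(2)) (auto simp: h_def)
  moreover have "f (s + h) < 0" using e(1) st by (intro after) (auto simp: h_def)
  ultimately show False using \<open>f s = 0\<close> by simp
qed

text \<open>
  A solution that touches the curve \<open>\<epsilon>/\<surd>t\<close> decreases more slowly than the curve, since
  \<open>3 \<epsilon>\<^sup>3 \<le> \<epsilon>/4\<close> and the curve has slope \<open>- \<epsilon>/2 t\<^sup>-\<^sup>3\<^sup>/\<^sup>2\<close>.  So \<open>y\<close> stays above it, and the perturbation is small
  compared to \<open>y\<^sup>3\<close>.  Consequently
  the derivative of \<open>1/y\<^sup>2\<close> tends to \<open>6\<close>, and \<open>t y\<^sup>2\<close> tends to \<open>1/6\<close>.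
\<close>

lemma cubic_ode_positive:
  fixes y e :: "real \<Rightarrow> real"
  assumes y: "\<And>t. t \<ge> T \<Longrightarrow> (y has_real_derivative (- 3 * (y t) ^ 3 - e t)) (at t)"
    and e: "\<And>t. t \<ge> T \<Longrightarrow> \<bar>e t\<bar> \<le> K * t powr (- 15 / 8)"
    and T: "T \<ge> 1" and \<epsilon>: "0 < \<epsilon>" "\<epsilon> \<le> 1 / 4" and small: "K * T powr (- 3 / 8) < \<epsilon> / 4"
    and init: "y T \<ge> \<epsilon> * T powr (- 1 / 2)"
  shows "((\<lambda>t. t powr (1 / 2) * y t) \<longlongrightarrow> sqrt (1 / 6)) at_top"
proof -
  have "0 \<le> K * T powr (- 15 / 8)" using e[of T] by linarith
  then have K: "K \<ge> 0" using T by (simp add: zero_le_mult_iff)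
  have low: "y t \<ge> \<epsilon> * t powr (- 1 / 2)" if t: "t \<ge> T" for t
  proof -
    have "y t - \<epsilon> * t powr (- 1 / 2) \<ge> 0"
    proof (rule barrier[where f = "\<lambda>t. y t - \<epsilon> * t powr (- 1 / 2)" and f' = "\<lambda>t. (- 3 * (y t) ^ 3 - e t) + \<epsilon> / 2 * t powr (- 3 / 2)" and T = T])
      fix s assume s: "s \<ge> T"
      then have s0: "s > 0" using T by simp
      show "((\<lambda>t. y t - \<epsilon> * t powr (- 1 / 2)) has_real_derivative (- 3 * (y s) ^ 3 - e s) + \<epsilon> / 2 * s powr (- 3 / 2)) (at s)"
        using s0 by (auto intro!: derivative_eq_intros y[OF s])
      assume "y s - \<epsilon> * s powr (- 1 / 2) = 0"
      then have ys: "y s = \<epsilon> * s powr (- 1 / 2)" by simp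
      have y3: "(y s) ^ 3 = \<epsilon> ^ 3 * s powr (- 3 / 2)"
        using s0 by (simp add: ys power_mult_distrib powr_power)
      have "\<epsilon> * \<epsilon> \<le> (1 / 4) * (1 / 4)" using \<epsilon> by (intro mult_mono) auto
      then have "3 * (\<epsilon> * \<epsilon>) * \<epsilon> \<le> (1 / 4) * \<epsilon>" using \<epsilon> by (intro mult_right_mono) auto
      then have e3: "3 * \<epsilon> ^ 3 \<le> \<epsilon> / 4" by (simp add: power3_eq_cube)
      have "\<bar>e s\<bar> \<le> (K * s powr (- 3 / 8)) * s powr (- 3 / 2)"
        using e[OF s] s0 by (simp add: mult.assoc powr_add[symmetric])
      also have "\<dots> \<le> (K * T powr (- 3 / 8)) * s powr (- 3 / 2)"
        using s T K by (intro mult_right_mono mult_left_mono powr_mono2') auto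
      also have "\<dots> < \<epsilon> / 4 * s powr (- 3 / 2)"
        using small s0 by (intro mult_strict_right_mono) auto
      finally have "\<bar>e s\<bar> < \<epsilon> / 4 * s powr (- 3 / 2)" .
      moreover have "3 * (y s) ^ 3 \<le> \<epsilon> / 4 * s powr (- 3 / 2)"
        unfolding y3 using e3 mult_right_mono[of "3 * \<epsilon> ^ 3" "\<epsilon> / 4" "s powr (- 3 / 2)"] by simp
      ultimately show "0 < (- 3 * (y s) ^ 3 - e s) + \<epsilon> / 2 * s powr (- 3 / 2)" by linarith
    qed (use init t in auto)
    then show ?thesis by simp
  qed
  have pos: "y t > 0" if "t \<ge> T" for t
  proof -
    have "0 < \<epsilon> * t powr (- 1 / 2)" using \<epsilon> that T by simp
    then show ?thesis using low[OF that] by linarith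
  qed
  define w where "w t = 1 / (y t)\<^sup>2" for t
  define L where "L = 2 * K / \<epsilon> ^ 3"
  have L: "L \<ge> 0" using K \<epsilon> by (simp add: L_def)
  have w: "(w has_real_derivative (6 + 2 * e t / (y t) ^ 3)) (at t)" if t: "t \<ge> T" for t
    unfolding w_def using pos[OF t]
    by (auto intro!: derivative_eq_intros y[OF t] simp: field_simps power_eq_if)
  have wb: "\<bar>2 * e t / (y t) ^ 3\<bar> \<le> L * t powr (- 3 / 8)" if t: "t \<ge> T" for t
  proof -
    have t0: "t > 0" using t T by simp
    have "\<epsilon> ^ 3 * t powr (- 3 / 2) = (\<epsilon> * t powr (- 1 / 2)) ^ 3"
      using t0 by (simp add: power_mult_distrib powr_power)
    also have "\<dots> \<le> (y t) ^ 3" using low[OF t] \<epsilon> by (intro power_mono) auto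
    finally have y3: "\<epsilon> ^ 3 * t powr (- 3 / 2) \<le> (y t) ^ 3" .
    have "\<bar>2 * e t / (y t) ^ 3\<bar> = 2 * \<bar>e t\<bar> / (y t) ^ 3" using pos[OF t] by (simp add: abs_mult)
    also have "\<dots> \<le> 2 * (K * t powr (- 15 / 8)) / (\<epsilon> ^ 3 * t powr (- 3 / 2))"
      using e[OF t] y3 \<epsilon> t0 by (intro frac_le) auto
    also have "\<dots> = L * (t powr (- 15 / 8) / t powr (- 3 / 2))" by (simp add: L_def)
    also have "t powr (- 15 / 8) / t powr (- 3 / 2) = t powr (- 3 / 8)" by (simp add: powr_diff[symmetric])
    finally show ?thesis .
  qed
  have up: "(w t - 6 * t) - 8 / 5 * L * t powr (5 / 8) \<le> (w T - 6 * T) - 8 / 5 * L * T powr (5 / 8)" if t: "t \<ge> T" for t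
  proof -
    have "- ((w T - 6 * T) - 8 / 5 * L * T powr (5 / 8)) \<le> - ((w t - 6 * t) - 8 / 5 * L * t powr (5 / 8))"
    proof (rule nondecreasing_on_ray[where f = "\<lambda>t. - ((w t - 6 * t) - 8 / 5 * L * t powr (5 / 8))" and f' = "\<lambda>t. - (2 * e t / (y t) ^ 3 - L * t powr (- 3 / 8))" and T = T])
      fix s assume s: "s \<ge> T"
      show "((\<lambda>t. - ((w t - 6 * t) - 8 / 5 * L * t powr (5 / 8))) has_real_derivative - (2 * e s / (y s) ^ 3 - L * s powr (- 3 / 8))) (at s)"
        using s T by (auto intro!: derivative_eq_intros w[OF s])
      show "0 \<le> - (2 * e s / (y s) ^ 3 - L * s powr (- 3 / 8))" using wb[OF s] by linarith
    qed (use t in auto)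
    then show ?thesis by simp
  qed
  have dn: "(w T - 6 * T) + 8 / 5 * L * T powr (5 / 8) \<le> (w t - 6 * t) + 8 / 5 * L * t powr (5 / 8)" if t: "t \<ge> T" for t
  proof (rule nondecreasing_on_ray[where f = "\<lambda>t. (w t - 6 * t) + 8 / 5 * L * t powr (5 / 8)" and f' = "\<lambda>t. 2 * e t / (y t) ^ 3 + L * t powr (- 3 / 8)" and T = T])
    fix s assume s: "s \<ge> T"
    show "((\<lambda>t. (w t - 6 * t) + 8 / 5 * L * t powr (5 / 8)) has_real_derivative 2 * e s / (y s) ^ 3 + L * s powr (- 3 / 8)) (at s)"
      using s T by (auto intro!: derivative_eq_intros w[OF s])
    show "0 \<le> 2 * e s / (y s) ^ 3 + L * s powr (- 3 / 8)" using wb[OF s] by linarith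
  qed (use t in auto)
  define C where "C = \<bar>w T - 6 * T\<bar> + 8 / 5 * L * T powr (5 / 8)"
  have C: "C \<ge> 0" using L by (simp add: C_def)
  have est: "\<bar>w t / t - 6\<bar> \<le> C * t powr (- 1) + 8 / 5 * L * t powr (- 3 / 8)" if t: "t \<ge> T" for t
  proof -
    have t0: "t > 0" using t T by simp
    have "0 \<le> 8 / 5 * L * T powr (5 / 8)" using L by simp
    then have "\<bar>w t - 6 * t\<bar> \<le> C + 8 / 5 * L * t powr (5 / 8)"
      using up[OF t] dn[OF t] unfolding C_def by linarith
    then have "\<bar>w t - 6 * t\<bar> / t \<le> (C + 8 / 5 * L * t powr (5 / 8)) / t" using t0 by (intro divide_right_mono) auto
    moreover have "\<bar>w t - 6 * t\<bar> / t = \<bar>w t / t - 6\<bar>"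
      using t0 abs_divide[of "w t - 6 * t" t] by (simp add: diff_divide_distrib)
    moreover have "t powr (5 / 8) / t = t powr (- 3 / 8)"
      using t0 powr_diff[of t "5 / 8" 1] by simp
    moreover have "1 / t = t powr (- 1)" using t0 by (simp add: powr_minus_divide)
    moreover have "(C + 8 / 5 * L * t powr (5 / 8)) / t = C * (1 / t) + 8 / 5 * L * (t powr (5 / 8) / t)"
      by (simp add: add_divide_distrib)
    ultimately show ?thesis by (simp only:)
  qed
  have lim: "((\<lambda>t. C * t powr (- 1) + 8 / 5 * L * t powr (- 3 / 8)) \<longlongrightarrow> C * 0 + 8 / 5 * L * 0) at_top"
    by (intro tendsto_intros tendsto_neg_powr filterlim_ident) auto
  have "((\<lambda>t. w t / t - 6) \<longlongrightarrow> 0) at_top"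
  proof (rule Lim_null_comparison)
    show "\<forall>\<^sub>F t in at_top. norm (w t / t - 6) \<le> C * t powr (- 1) + 8 / 5 * L * t powr (- 3 / 8)"
      using eventually_ge_at_top[of T] by eventually_elim (simp only: est real_norm_def)
    show "((\<lambda>t. C * t powr (- 1) + 8 / 5 * L * t powr (- 3 / 8)) \<longlongrightarrow> 0) at_top"
      using lim by (simp only: mult_zero_right add_0)
  qed
  then have "((\<lambda>t. w t / t) \<longlongrightarrow> 6) at_top" by (simp add: LIM_zero_iff)
  then have "((\<lambda>t. sqrt (1 / (w t / t))) \<longlongrightarrow> sqrt (1 / 6)) at_top"
    by (intro tendsto_intros) auto
  moreover have "\<forall>\<^sub>F t in at_top. sqrt (1 / (w t / t)) = t powr (1 / 2) * y t"
    using eventually_ge_at_top[of T]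
  proof eventually_elim
    case (elim t)
    then have "t > 0" "y t > 0" using T pos by auto
    then show ?case by (simp add: w_def real_sqrt_mult powr_half_sqrt)
  qed
  ultimately show ?thesis by (rule Lim_transform_eventually)
qed

text \<open>
  Either \<open>\<surd>t y\<close> tends to \<open>0\<close>, or it exceeds some \<open>\<epsilon>\<close> in absolute value at arbitrarily late times, when the
  perturbation is already negligible; then \<open>y\<close> or \<open>- y\<close> starts above the barrier.
\<close>

lemma cubic_ode_limit:
  fixes y e :: "real \<Rightarrow> real"
  assumes y: "\<And>t. t \<ge> T \<Longrightarrow> (y has_real_derivative (- 3 * (y t) ^ 3 - e t)) (at t)"
    and e: "\<And>t. t \<ge> T \<Longrightarrow> \<bar>e t\<bar> \<le> K * t powr (- 15 / 8)" and T: "T \<ge> 1"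
  shows "\<exists>\<beta>. ((\<lambda>t. t powr (1 / 2) * y t) \<longlongrightarrow> \<beta>) at_top"
proof (cases "((\<lambda>t. t powr (1 / 2) * y t) \<longlongrightarrow> 0) at_top")
  case False
  then obtain \<epsilon>0 where \<epsilon>0: "\<epsilon>0 > 0" "\<not> (\<forall>\<^sub>F t in at_top. \<bar>t powr (1 / 2) * y t\<bar> < \<epsilon>0)"
    by (auto simp: tendsto_iff dist_real_def)
  \<comment> \<open>at most \<open>1/4\<close>, as the barrier requires\<close>
  define \<epsilon> where "\<epsilon> = min \<epsilon>0 (1 / 4)"
  have \<epsilon>: "0 < \<epsilon>" "\<epsilon> \<le> 1 / 4" "\<epsilon> \<le> \<epsilon>0" using \<epsilon>0 by (auto simp: \<epsilon>_def)
  have "((\<lambda>t::real. K * t powr (- 3 / 8)) \<longlongrightarrow> K * 0) at_top"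
    by (intro tendsto_intros tendsto_neg_powr filterlim_ident) auto
  then have "\<forall>\<^sub>F t in at_top. K * t powr (- 3 / 8) < \<epsilon> / 4"
    using \<epsilon> by (intro order_tendstoD(2)[where y = "K * 0"]) auto
  then obtain T1 where T1: "\<And>t. t \<ge> T1 \<Longrightarrow> K * t powr (- 3 / 8) < \<epsilon> / 4"
    by (auto simp: eventually_at_top_linorder)
  obtain t where t: "t \<ge> max T T1" "\<bar>t powr (1 / 2) * y t\<bar> \<ge> \<epsilon>0"
    using \<epsilon>0(2) unfolding eventually_at_top_linorder by (meson not_le)
  have t0: "t \<ge> 1" "t \<ge> T" using t T by auto
  have "t powr (- 1 / 2) * t powr (1 / 2) = 1" using t0 by (simp add: powr_add[symmetric])
  then have half: "t powr (- 1 / 2) * (t powr (1 / 2) * y t) = y t" by (simp add: mult.assoc[symmetric])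
  have big: "\<epsilon> * t powr (- 1 / 2) \<le> \<bar>y t\<bar>"
  proof -
    have "t powr (- 1 / 2) * \<epsilon> \<le> t powr (- 1 / 2) * \<bar>t powr (1 / 2) * y t\<bar>"
      using t \<epsilon> by (intro mult_left_mono) auto
    also have "\<dots> = \<bar>t powr (- 1 / 2) * (t powr (1 / 2) * y t)\<bar>" by (simp add: abs_mult)
    finally show ?thesis unfolding half by (simp add: mult.commute)
  qed
  show ?thesis
  proof (cases "y t \<ge> 0")
    case True
    have "((\<lambda>t. t powr (1 / 2) * y t) \<longlongrightarrow> sqrt (1 / 6)) at_top"
      by (rule cubic_ode_positive[of t y e K \<epsilon>]) (use y e t t0 \<epsilon> T1 big True in auto)
    then show ?thesis ..
  next
    case False
    have "((\<lambda>t. t powr (1 / 2) * (- y t)) \<longlongrightarrow> sqrt (1 / 6)) at_top"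
    proof (rule cubic_ode_positive[of t "\<lambda>t. - y t" "\<lambda>t. - e t" K \<epsilon>])
      fix s assume "s \<ge> t"
      then have "s \<ge> T" using t0 by simp
      then show "((\<lambda>t. - y t) has_real_derivative - 3 * (- y s) ^ 3 - - e s) (at s)"
        using DERIV_minus[OF y[of s]] by (simp add: add.commute)
    qed (use e t t0 \<epsilon> T1 big False in auto)
    then have "((\<lambda>t. - (t powr (1 / 2) * (- y t))) \<longlongrightarrow> - sqrt (1 / 6)) at_top" by (rule tendsto_minus)
    then show ?thesis by auto
  qed
qed blast

section \<open>High modes and the expansion for positive linear damping\<close>

text \<open>
  Bounds the norm of order \<open>10\<close> of every function whose coefficients are at most \<open>\<langle>k\<rangle>\<^sup>-\<^sup>1\<^sup>2\<close>.
\<close>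

definition sobolev_constant :: real where
  "sobolev_constant = sqrt (2 * pi * (LINT k|int_counting. \<langle>k\<rangle> powr (- 4)))"

lemma sobolev_summand_le:
  assumes "cmod z \<le> B * \<langle>k\<rangle> powr (- 12)" "B \<ge> 0"
  shows "(1 + (real_of_int k)\<^sup>2) ^ 10 * (cmod z)\<^sup>2 \<le> B\<^sup>2 * \<langle>k\<rangle> powr (- 4)"
proof -
  define x where "x = 1 + \<bar>real_of_int k\<bar>"
  have x: "x \<ge> 1" by (simp add: x_def)
  have "1 + (real_of_int k)\<^sup>2 \<le> x\<^sup>2" by (simp add: x_def power2_sum)
  then have "(1 + (real_of_int k)\<^sup>2) ^ 10 \<le> (x\<^sup>2) ^ 10" by (intro power_mono) auto
  also have "\<dots> = x powr 20" using x by (simp add: power_mult[symmetric] powr_numeral)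
  finally have 1: "(1 + (real_of_int k)\<^sup>2) ^ 10 \<le> x powr 20" .
  have "(cmod z)\<^sup>2 \<le> (B * x powr (- 12))\<^sup>2" using assms by (intro power_mono) (auto simp: x_def)
  also have "\<dots> = B\<^sup>2 * x powr (- 24)" using x by (simp add: power_mult_distrib powr_power)
  finally have 2: "(cmod z)\<^sup>2 \<le> B\<^sup>2 * x powr (- 24)" .
  have "(1 + (real_of_int k)\<^sup>2) ^ 10 * (cmod z)\<^sup>2 \<le> x powr 20 * (B\<^sup>2 * x powr (- 24))"
    using 1 2 by (intro mult_mono) auto
  also have "\<dots> = B\<^sup>2 * (x powr 20 * x powr (- 24))" by (simp only: mult_ac)
  also have "x powr 20 * x powr (- 24) = x powr (- 4)" by (simp only: powr_add[symmetric]) simp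
  finally show ?thesis by (simp add: x_def)
qed

text \<open>
  The exponent \<open>12\<close> leaves the summable weight \<open>\<bar>k\<bar>\<^sup>2\<^sup>0\<^sup>-\<^sup>2\<^sup>4\<close> in the norm of order \<open>10\<close>.
\<close>

lemma
  assumes B: "\<And>k. cmod (fourier_coeff f k) \<le> B * \<langle>k\<rangle> powr (- 12)" "B \<ge> 0"
  shows sobolev_summable: "(\<lambda>k. (1 + (of_int k)\<^sup>2) ^ 10 * (cmod (fourier_coeff f k))\<^sup>2 :: real) summable_on UNIV"
    and sobolev_norm_le: "sobolev_norm 10 f \<le> B * sobolev_constant"
proof -
  define F where "F k = (1 + (real_of_int k)\<^sup>2) ^ 10 * (cmod (fourier_coeff f k))\<^sup>2" for k
  have F0: "F k \<ge> 0" for k by (simp add: F_def)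
  have Fle: "F k \<le> B\<^sup>2 * \<langle>k\<rangle> powr (- 4)" for k
    unfolding F_def by (rule sobolev_summand_le[OF B])
  have int: "integrable int_counting F"
    by (rule integrable_int_bound[of 4 _ "B\<^sup>2"]) (use F0 Fle in auto)
  have "(\<lambda>k. norm (F k)) summable_on UNIV"
    using int unfolding abs_summable_equivalent Infinite_Set_Sum.abs_summable_on_def .
  then show "(\<lambda>k. (1 + (of_int k)\<^sup>2) ^ 10 * (cmod (fourier_coeff f k))\<^sup>2 :: real) summable_on UNIV"
    using F0 by (simp add: F_def)
  have "(\<Sum>\<^sub>\<infinity>k\<in>UNIV. F k) = (LINT k|int_counting. F k)"
    by (rule integrable_int_summable[OF int])
  also have "\<dots> \<le> (LINT k|int_counting. B\<^sup>2 * \<langle>k\<rangle> powr (- 4))"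
    by (intro integral_mono int integrable_mult_right integrable_int_powr Fle) auto
  finally have "sqrt (2 * pi * (\<Sum>\<^sub>\<infinity>k\<in>UNIV. F k)) \<le> sqrt (B\<^sup>2 * (2 * pi * (LINT k|int_counting. \<langle>k\<rangle> powr (- 4))))"
    by (intro real_sqrt_le_mono) simp
  also have "\<dots> = B * sobolev_constant"
    using B(2) by (simp add: sobolev_constant_def real_sqrt_mult)
  finally show "sobolev_norm 10 f \<le> B * sobolev_constant"
    by (simp add: sobolev_norm_def F_def)
qed

lemma sobolev_norm_nonneg: "sobolev_norm s f \<ge> 0"
  unfolding sobolev_norm_def by (intro real_sqrt_ge_zero mult_nonneg_nonneg infsum_nonneg) auto

lemma bdd_borel_cis_int: "bdd_borel (\<lambda>x. cis (of_int k * x))"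
  by (rule bdd_borel_cis)

lemma torus_coeff_sin_mult:
  "torus_coeff (\<lambda>x. of_real (sin (of_int m * x))) k = (- \<i> / 2) * ((if k = m then 1 else 0) - (if k = - m then 1 else 0))"
proof -
  have "complex_of_real (sin (of_int m * x)) = (- \<i> / 2) * (cis (of_int m * x) - cis (of_int (- m) * x))" for x
    by (simp add: complex_eq_iff)
  then have "torus_coeff (\<lambda>x. of_real (sin (of_int m * x))) k = (- \<i> / 2) * torus_coeff (\<lambda>x. cis (of_int m * x) - cis (of_int (- m) * x)) k"
    by (simp only: torus_coeff_cmult)
  also have "torus_coeff (\<lambda>x. cis (of_int m * x) - cis (of_int (- m) * x)) k = (if k = m then 1 else 0) - (if k = - m then 1 else 0)"
    by (simp only: torus_coeff_diff[OF bdd_borel_cis_int bdd_borel_cis_int] torus_coeff_cis)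
  finally show ?thesis .
qed

lemma smallo_of_tendsto_bound:
  fixes N g B :: "real \<Rightarrow> real"
  assumes N: "\<And>t. N t \<ge> 0" and le: "\<forall>\<^sub>F t in at_top. N t \<le> B t" and g: "\<forall>\<^sub>F t in at_top. g t > 0"
    and lim: "((\<lambda>t. B t / g t) \<longlongrightarrow> 0) at_top"
  shows "N \<in> o[at_top](g)"
proof (rule smalloI_tendsto)
  show "\<forall>\<^sub>F t in at_top. g t \<noteq> 0" using g by eventually_elim simp
  show "((\<lambda>t. N t / g t) \<longlongrightarrow> 0) at_top"
  proof (rule tendsto_sandwich[OF _ _ tendsto_const lim])
    show "\<forall>\<^sub>F t in at_top. 0 \<le> N t / g t" using g by eventually_elim (use N in auto)
    show "\<forall>\<^sub>F t in at_top. N t / g t \<le> B t / g t" using g le by eventually_elim (auto intro: divide_right_mono)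
  qed
qed

context bounded_mild
begin

text \<open>
  The number \<open>\<phi>\<close> is the amplitude of the leading term at time \<open>t\<close>.
\<close>

definition remainder :: "real \<Rightarrow> real \<Rightarrow> real \<Rightarrow> real" where
  "remainder \<phi> t x = u t x - \<phi> * sin x"

lemma fourier_coeff_remainder:
  assumes t: "t > 0"
  shows "fourier_coeff (remainder \<phi> t) k = a t k + \<phi> * (\<i> / 2) * ((if k = 1 then 1 else 0) - (if k = - 1 then 1 else 0))"
proof -
  have [measurable]: "u t \<in> borel_measurable borel" by (rule u_measurable[OF t])
  have bs: "bdd_borel (\<lambda>x. complex_of_real (sin (of_int 1 * x)))"
    by (rule bdd_borel_of_real[where B = 1]) auto
  have "fourier_coeff (remainder \<phi> t) k = torus_coeff (\<lambda>x. of_real (u t x) - of_real \<phi> * of_real (sin (of_int 1 * x))) k"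
    unfolding remainder_def by (subst fourier_coeff_eq_torus_coeff) auto
  also have "\<dots> = a t k - \<phi> * torus_coeff (\<lambda>x. of_real (sin (of_int 1 * x))) k"
    by (simp only: torus_coeff_diff[OF bdd_borel_u[OF t] bdd_borel_mult[OF bdd_borel_const bs]] torus_coeff_cmult a_def)
  finally show ?thesis unfolding torus_coeff_sin_mult by simp
qed

lemma remainder_sobolev:
  assumes t: "t \<ge> 1"
  shows "remainder \<phi> t \<in> sobolev_space 10"
proof -
  have t0: "t > 0" using t by simp
  have um [measurable]: "u t \<in> borel_measurable borel" by (rule u_measurable[OF t0])
  have rm [measurable]: "remainder \<phi> t \<in> borel_measurable borel" unfolding remainder_def by measurable
  have per: "torus_periodic (remainder \<phi> t)"
    using t by (simp add: torus_periodic_def remainder_def u_periodic)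
  have "norm ((remainder \<phi> t x)\<^sup>2) \<le> (sup_u + \<bar>\<phi>\<bar>)\<^sup>2" for x
  proof -
    have "\<bar>\<phi> * sin x\<bar> \<le> \<bar>\<phi>\<bar> * 1" unfolding abs_mult by (intro mult_left_mono) auto
    then have "\<bar>remainder \<phi> t x\<bar> \<le> sup_u + \<bar>\<phi>\<bar>"
      using u_le[of t x] t0 by (simp add: remainder_def)
    then have "\<bar>remainder \<phi> t x\<bar>\<^sup>2 \<le> (sup_u + \<bar>\<phi>\<bar>)\<^sup>2" by (intro power_mono) auto
    then show ?thesis by simp
  qed
  then have "integrable torus (\<lambda>x. (remainder \<phi> t x)\<^sup>2)" by (intro integrable_torus) auto
  then have int: "integrable (lebesgue_on {-pi..pi}) (\<lambda>x. (remainder \<phi> t x)\<^sup>2)"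
    using integral_lebesgue_on_eq_lborel(2)[of "\<lambda>x. (remainder \<phi> t x)\<^sup>2" "{-pi..pi}"] by (simp add: torus_def)
  obtain A where A: "A \<ge> 0" "\<And>s k. s \<ge> 1 \<Longrightarrow> cmod (a s k) \<le> A * \<langle>k\<rangle> powr (- 12)"
    using coeff_decay_obtain[of 1 12] by auto
  have "cmod (fourier_coeff (remainder \<phi> t) k) \<le> (A + \<bar>\<phi>\<bar> * 2 powr 12) * \<langle>k\<rangle> powr (- 12)" for k
  proof -
    have "cmod (\<phi> * (\<i> / 2) * ((if k = 1 then 1 else 0) - (if k = - 1 then 1 else 0))) \<le> \<bar>\<phi>\<bar> * 2 powr 12 * \<langle>k\<rangle> powr (- 12)"
    proof (cases "k = 1 \<or> k = - 1")
      case True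
      then have "\<bar>real_of_int k\<bar> = 1" by auto
      moreover have "(2::real) powr 12 * 2 powr (- 12) = 1" by (simp only: powr_add[symmetric]) simp
      ultimately show ?thesis using True by (auto simp: norm_mult mult.assoc)
    qed auto
    then show ?thesis
      unfolding fourier_coeff_remainder[OF t0] distrib_right
      using A(2)[OF t, of k] by (intro order_trans[OF norm_triangle_ineq] add_mono)
  qed
  then have "(\<lambda>k. (1 + (of_int k)\<^sup>2) ^ 10 * (cmod (fourier_coeff (remainder \<phi> t) k))\<^sup>2 :: real) summable_on UNIV"
    using A(1) by (intro sobolev_summable[where B = "A + \<bar>\<phi>\<bar> * 2 powr 12"]) auto
  then show ?thesis
    using per int rm by (simp add: sobolev_space_def measurable_completion)
qed

text \<open>
  Subtracting \<open>\<phi> sin x\<close> affects the modes \<open>\<plusminus> 1\<close> only, where \<open>y t 1 = - \<phi>/2\<close> would be an exact match.  The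
  factor \<open>2\<^sup>1\<^sup>2\<close> compensates the weight at \<open>\<bar>k\<bar> = 1\<close>.
\<close>

lemma remainder_norm_le:
  assumes t: "t > 0" and high: "\<And>k. \<bar>k\<bar> \<ge> 2 \<Longrightarrow> \<bar>y t k\<bar> \<le> B * \<langle>k\<rangle> powr (- 12)" and B: "B \<ge> 0"
  shows "sobolev_norm 10 (remainder \<phi> t) \<le> (2 powr 12 * \<bar>y t 1 + \<phi> / 2\<bar> + B) * sobolev_constant"
proof (rule sobolev_norm_le)
  fix k :: int
  show "cmod (fourier_coeff (remainder \<phi> t) k) \<le> (2 powr 12 * \<bar>y t 1 + \<phi> / 2\<bar> + B) * \<langle>k\<rangle> powr (- 12)"
  proof -
    consider "k = 0" | "\<bar>k\<bar> = 1" | "\<bar>k\<bar> \<ge> 2" by linarith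
    then show ?thesis
    proof cases
      case 1 then show ?thesis using B by (simp add: fourier_coeff_remainder[OF t] a_eq_y[OF t] y_zero)
    next
      case 2
      then have k: "k = 1 \<or> k = - 1" by auto
      then have "cmod (fourier_coeff (remainder \<phi> t) k) = \<bar>y t 1 + \<phi> / 2\<bar>"
      proof
        assume "k = 1"
        then have "fourier_coeff (remainder \<phi> t) k = \<i> * of_real (y t 1 + \<phi> / 2)"
          by (simp add: fourier_coeff_remainder[OF t] a_eq_y[OF t] algebra_simps)
        then show ?thesis by (simp only: norm_mult norm_of_real) simp
      next
        assume "k = - 1"
        then have "fourier_coeff (remainder \<phi> t) k = - \<i> * of_real (y t 1 + \<phi> / 2)"
          using y_minus[of t 1] by (simp add: fourier_coeff_remainder[OF t] a_eq_y[OF t] algebra_simps)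
        then show ?thesis by (simp only: norm_mult norm_of_real) simp
      qed
      also have "\<dots> = (2 powr 12 * \<bar>y t 1 + \<phi> / 2\<bar>) * 2 powr (- 12)"
      proof -
        have "(2::real) powr 12 * 2 powr (- 12) = 1" by (simp only: powr_add[symmetric]) simp
        then show ?thesis by (simp add: mult_ac)
      qed
      also have "\<dots> \<le> (2 powr 12 * \<bar>y t 1 + \<phi> / 2\<bar> + B) * 2 powr (- 12)"
        using B by (intro mult_right_mono) auto
      finally show ?thesis using k by auto
    next
      case 3
      then have "fourier_coeff (remainder \<phi> t) k = a t k"
        by (auto simp: fourier_coeff_remainder[OF t])
      then have "cmod (fourier_coeff (remainder \<phi> t) k) \<le> B * \<langle>k\<rangle> powr (- 12)"
        using high[OF 3] by (simp add: norm_a_y[OF t])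
      also have "\<dots> \<le> (2 powr 12 * \<bar>y t 1 + \<phi> / 2\<bar> + B) * \<langle>k\<rangle> powr (- 12)"
        by (intro mult_right_mono) auto
      finally show ?thesis .
    qed
  qed
qed (use B in auto)

text \<open>
  One supersolution \<open>z\<close> for the slowest of the modes \<open>\<bar>k\<bar> \<ge> 2\<close>, whose rate is \<open>\<nu> 2\<^sup>\<gamma> - 1\<close>, serves for all of them.
\<close>

lemma high_mode_bound:
  fixes z z' :: "real \<Rightarrow> real"
  assumes T: "T \<ge> 1" and z: "\<And>t. t \<ge> T \<Longrightarrow> (z has_real_derivative z' t) (at t)"
    and b: "\<And>t. t \<ge> T \<Longrightarrow> sup_u * energy t \<le> z' t + (\<nu> * 2 powr \<gamma> - 1) * z t"
    and z0: "\<And>t. t \<ge> T \<Longrightarrow> z t \<ge> 0" and init: "sup_u \<le> z T" and t: "t \<ge> T" and k: "\<bar>k\<bar> \<ge> 2"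
  shows "\<bar>y t k\<bar> \<le> z t"
proof (rule damped_comparison[where y = "\<lambda>t. y t k" and z = z and \<mu> = "lam k - 1" and T = T and b = "\<lambda>t. c t k" and z' = z'])
  fix s assume s: "s \<ge> T"
  then have s0: "s > 0" using T by simp
  show "((\<lambda>t. y t k) has_real_derivative - (lam k - 1) * y s k - c s k) (at s)"
    by (rule y_derivative[OF s0])
  have "2 \<le> \<bar>real_of_int k\<bar>" using k by linarith
  then have "2 powr \<gamma> \<le> \<bar>real_of_int k\<bar> powr \<gamma>" using \<gamma>_pos by (intro powr_mono2) auto
  then have "\<nu> * 2 powr \<gamma> - 1 \<le> lam k - 1" using \<nu>_pos by (simp add: lam_def)
  then have "(\<nu> * 2 powr \<gamma> - 1) * z s \<le> (lam k - 1) * z s" using z0[OF s] by (rule mult_right_mono)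
  then show "\<bar>c s k\<bar> \<le> z' s + (lam k - 1) * z s"
    using abs_c_le_energy[OF s0, of k] b[OF s] by linarith
next
  have "\<bar>y T k\<bar> \<le> sup_u" using norm_a_le[of T k] norm_a_y[of T k] T by simp
  then show "\<bar>y T k\<bar> \<le> z T" using init by simp
qed (use z t in auto)

text \<open>Interpolation between the decay in time and an arbitrarily fast decay in frequency.\<close>

lemma high_mode_interpolation:
  assumes T: "T \<ge> 1" and z: "\<And>t k. t \<ge> T \<Longrightarrow> \<bar>k\<bar> \<ge> 2 \<Longrightarrow> \<bar>y t k\<bar> \<le> z t" and \<theta>: "0 < \<theta>" "\<theta> < 1"
  obtains K where "K \<ge> 0" "\<And>t k. t \<ge> T \<Longrightarrow> \<bar>k\<bar> \<ge> 2 \<Longrightarrow> \<bar>y t k\<bar> \<le> K * z t powr (1 - \<theta>) * \<langle>k\<rangle> powr (- 12)"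
proof -
  obtain A where A: "A \<ge> 0" "\<And>s k. s \<ge> 1 \<Longrightarrow> cmod (a s k) \<le> A * \<langle>k\<rangle> powr (- (12 / \<theta>))"
    using coeff_decay_obtain[of 1 "12 / \<theta>"] by auto
  have "\<bar>y t k\<bar> \<le> A powr \<theta> * z t powr (1 - \<theta>) * \<langle>k\<rangle> powr (- 12)" if t: "t \<ge> T" and k: "\<bar>k\<bar> \<ge> 2" for t k
  proof (cases "y t k = 0")
    case False
    define x where "x = 1 + \<bar>real_of_int k\<bar>"
    have "\<bar>y t k\<bar> = \<bar>y t k\<bar> powr (\<theta> + (1 - \<theta>))" using False by simp
    also have "\<dots> = \<bar>y t k\<bar> powr \<theta> * \<bar>y t k\<bar> powr (1 - \<theta>)" by (rule powr_add)
    also have "\<dots> \<le> (A * x powr (- (12 / \<theta>))) powr \<theta> * z t powr (1 - \<theta>)"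
    proof (intro mult_mono powr_mono2)
      show "\<bar>y t k\<bar> \<le> A * x powr (- (12 / \<theta>))"
        using A(2)[of t k] t T norm_a_y[of t k] by (simp add: x_def)
      show "\<bar>y t k\<bar> \<le> z t" by (rule z[OF t k])
    qed (use \<theta> in auto)
    also have "(A * x powr (- (12 / \<theta>))) powr \<theta> = A powr \<theta> * x powr (- 12)"
      using A(1) \<theta> by (simp add: powr_mult powr_powr)
    finally show ?thesis by (simp add: x_def mult_ac)
  qed simp
  then show ?thesis using that[of "A powr \<theta>"] by simp
qed

text \<open>
  The high modes decay at a rate \<open>m\<close> chosen strictly between \<open>l = \<nu> - 1\<close> and the minimum of their linear
  rate and \<open>2 l\<close>, the rate of the forcing.  Interpolation keeps the rate \<open>m2 = (m + l)/2\<close>, which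
  still exceeds \<open>l\<close>.
\<close>

lemma supercritical_expansion:
  assumes \<kappa>: "\<kappa> > 1"
  shows "\<exists>\<alpha>. (\<lambda>t. sobolev_norm 10 (remainder (exp (- (\<kappa>\<^sup>2 - 1) * t) * \<alpha>) t)) \<in> o[at_top](\<lambda>t. exp (- (\<kappa>\<^sup>2 - 1) * t))"
proof -
  define l where "l = \<nu> - 1"
  have l: "l > 0" using \<kappa> by (simp add: l_def one_less_power)
  define C where "C = energy 1 * exp (2 * (\<nu> - 1))"
  have C: "C \<ge> 0" by (simp add: C_def energy_nonneg)
  have En: "energy t \<le> C * exp (- (2 * l * t))" if "t \<ge> 1" for t
  proof -
    have "- 2 * (\<nu> - 1) * t = - (2 * l * t)" by (simp add: l_def algebra_simps)
    then show ?thesis using energy_exponential_decay[OF that] by (simp only: C_def)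
  qed
  define m1 where "m1 = \<nu> * 2 powr \<gamma> - 1"
  have "2 powr \<gamma> > (1::real)" using \<gamma>_pos by simp
  then have "\<nu> * 2 powr \<gamma> > \<nu> * 1" using \<nu>_pos by (intro mult_strict_left_mono) auto
  then have m1: "m1 > l" by (simp add: m1_def l_def)
  define m where "m = (l + min m1 (2 * l)) / 2"
  have m: "l < m" "m < m1" "m < 2 * l" using m1 l by (auto simp: m_def)
  \<comment> \<open>the first value makes \<open>K exp (- m t)\<close> a supersolution, the second one dominates at time \<open>1\<close>\<close>
  define K where "K = max (sup_u * C / (m1 - m)) (sup_u * exp m)"
  have K0: "K \<ge> 0" using sup_u_nonneg by (simp add: K_def le_max_iff_disj)
  have K1: "sup_u * C \<le> (m1 - m) * K"
  proof -
    have "sup_u * C / (m1 - m) \<le> K" by (simp add: K_def)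
    then show ?thesis using m by (simp add: field_simps)
  qed
  have "\<bar>y t k\<bar> \<le> K * exp (- (m * t))" if "t \<ge> 1" "\<bar>k\<bar> \<ge> 2" for t k
  proof (rule high_mode_bound[where T = 1 and z' = "\<lambda>t. - m * (K * exp (- (m * t)))"])
    fix s :: real assume s: "s \<ge> 1"
    show "((\<lambda>t. K * exp (- (m * t))) has_real_derivative - m * (K * exp (- (m * s)))) (at s)"
      by (auto intro!: derivative_eq_intros)
    have "sup_u * energy s \<le> sup_u * (C * exp (- (2 * l * s)))"
      by (intro mult_left_mono En s sup_u_nonneg)
    also have "\<dots> \<le> sup_u * (C * exp (- (m * s)))"
      using m s C sup_u_nonneg by (intro mult_left_mono) auto
    also have "\<dots> = (sup_u * C) * exp (- (m * s))" by simp
    also have "\<dots> \<le> ((m1 - m) * K) * exp (- (m * s))" by (intro mult_right_mono K1) simp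
    finally show "sup_u * energy s \<le> - m * (K * exp (- (m * s))) + (\<nu> * 2 powr \<gamma> - 1) * (K * exp (- (m * s)))"
      by (simp add: m1_def algebra_simps)
    show "K * exp (- (m * s)) \<ge> 0" using K0 by simp
  next
    have "sup_u * exp m \<le> K" by (simp add: K_def)
    then show "sup_u \<le> K * exp (- (m * 1))" by (simp add: exp_minus field_simps)
  qed (use that in auto)
  note high = this
  \<comment> \<open>so that \<open>m (1 - \<theta>) = (m + l)/2\<close>\<close>
  define \<theta> where "\<theta> = (m - l) / (2 * m)"
  have \<theta>: "0 < \<theta>" "\<theta> < 1" using m l by (auto simp: \<theta>_def field_simps)
  define m2 where "m2 = m * (1 - \<theta>)"
  have m2: "m2 > l"
  proof -
    have "m2 = m - (m - l) / 2" using m l by (simp add: m2_def \<theta>_def field_simps)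
    moreover have "m - (m - l) / 2 = (m + l) / 2" by (simp add: field_simps)
    ultimately show ?thesis using m(1) by simp
  qed
  obtain K2 where K2: "K2 \<ge> 0" "\<And>t k. t \<ge> 1 \<Longrightarrow> \<bar>k\<bar> \<ge> 2 \<Longrightarrow> \<bar>y t k\<bar> \<le> K2 * (K * exp (- (m * t))) powr (1 - \<theta>) * \<langle>k\<rangle> powr (- 12)"
    using high_mode_interpolation[where T = 1 and z = "\<lambda>t. K * exp (- (m * t))", OF _ high \<theta>] by auto
  define K3 where "K3 = K2 * K powr (1 - \<theta>)"
  have K3: "K3 \<ge> 0" using K2 by (simp add: K3_def)
  have high2: "\<bar>y t k\<bar> \<le> (K3 * exp (- (m2 * t))) * \<langle>k\<rangle> powr (- 12)" if "t \<ge> 1" "\<bar>k\<bar> \<ge> 2" for t k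
  proof -
    have "(K * exp (- (m * t))) powr (1 - \<theta>) = K powr (1 - \<theta>) * exp (- (m2 * t))"
      using K0 by (simp add: powr_mult exp_powr_real m2_def mult_ac)
    then show ?thesis using K2(2)[OF that] by (simp add: K3_def mult_ac)
  qed
  define v where "v t = exp (l * t) * y t 1" for t
  have "\<exists>\<alpha>0. (v \<longlongrightarrow> \<alpha>0) at_top"
  proof (rule converges_of_exponential_derivative_bound[where T = 1 and v' = "\<lambda>t. - exp (l * t) * c t 1" and K = "sup_u * C" and \<delta> = l])
    fix t :: real assume t: "t \<ge> 1"
    have lam1: "lam 1 = \<nu>" by (simp add: lam_def)
    show "(v has_real_derivative - exp (l * t) * c t 1) (at t)"
      unfolding v_def using t
      by (auto intro!: derivative_eq_intros y_derivative simp: lam1 l_def algebra_simps)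
    have "\<bar>c t 1\<bar> \<le> sup_u * (C * exp (- (2 * l * t)))"
      using abs_c_le_energy[of t 1] mult_left_mono[OF En[OF t] sup_u_nonneg] t by simp
    then have "exp (l * t) * \<bar>c t 1\<bar> \<le> exp (l * t) * (sup_u * (C * exp (- (2 * l * t))))"
      by (rule mult_left_mono) simp
    also have "\<dots> = sup_u * C * (exp (l * t) * exp (- (2 * l * t)))" by (simp only: mult_ac)
    also have "exp (l * t) * exp (- (2 * l * t)) = exp (- (l * t))" by (simp flip: exp_add)
    finally show "\<bar>- exp (l * t) * c t 1\<bar> \<le> sup_u * C * exp (- (l * t))" by (simp add: abs_mult)
  qed (rule l)
  then obtain \<alpha>0 where \<alpha>0: "(v \<longlongrightarrow> \<alpha>0) at_top" by blast
  \<comment> \<open>\<open>\<i> y (cis x - cis (- x)) = - 2 y sin x\<close>\<close>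
  define \<alpha> where "\<alpha> = - 2 * \<alpha>0"
  define B where "B t = (2 powr 12 * \<bar>y t 1 + exp (- (l * t)) * \<alpha> / 2\<bar> + K3 * exp (- (m2 * t))) * sobolev_constant" for t
  have eq: "- (\<kappa>\<^sup>2 - 1) * t = - (l * t)" for t by (simp add: l_def algebra_simps)
  have "(\<lambda>t. sobolev_norm 10 (remainder (exp (- (l * t)) * \<alpha>) t)) \<in> o[at_top](\<lambda>t. exp (- (l * t)))"
  proof (rule smallo_of_tendsto_bound[where B = B])
    show "\<forall>\<^sub>F t in at_top. sobolev_norm 10 (remainder (exp (- (l * t)) * \<alpha>) t) \<le> B t"
      using eventually_ge_at_top[of 1]
    proof eventually_elim
      case (elim t)
      then show ?case
        unfolding B_def using K3 high2[of t] by (intro remainder_norm_le) auto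
    qed
    have Beq: "B t / exp (- (l * t)) = (2 powr 12 * \<bar>v t - \<alpha>0\<bar> + K3 * exp (- ((m2 - l) * t))) * sobolev_constant" for t
    proof -
      have "exp (l * t) * exp (- (l * t)) = 1" by (simp flip: exp_add)
      then have "y t 1 + exp (- (l * t)) * \<alpha> / 2 = (v t - \<alpha>0) * exp (- (l * t))"
        by (simp add: v_def \<alpha>_def algebra_simps)
      then have "\<bar>y t 1 + exp (- (l * t)) * \<alpha> / 2\<bar> = \<bar>v t - \<alpha>0\<bar> * exp (- (l * t))" by (simp add: abs_mult)
      moreover have "exp (- (m2 * t)) = exp (- ((m2 - l) * t)) * exp (- (l * t))"
        by (simp add: algebra_simps flip: exp_add)
      ultimately have "B t = ((2 powr 12 * \<bar>v t - \<alpha>0\<bar> + K3 * exp (- ((m2 - l) * t))) * sobolev_constant) * exp (- (l * t))"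
        by (simp add: B_def algebra_simps)
      then show ?thesis by simp
    qed
    have "filterlim (\<lambda>t. (m2 - l) * t) at_top at_top"
      using m2 by (intro filterlim_tendsto_pos_mult_at_top[OF tendsto_const]) (auto intro: filterlim_ident)
    then have e0: "((\<lambda>t. exp (- ((m2 - l) * t))) \<longlongrightarrow> 0) at_top"
      by (intro filterlim_compose[OF exp_at_bot]) (simp only: filterlim_uminus_at_bot minus_minus)
    have "((\<lambda>t. \<bar>v t - \<alpha>0\<bar>) \<longlongrightarrow> 0) at_top"
      using \<alpha>0 by (simp add: LIM_zero tendsto_rabs_zero)
    then have "((\<lambda>t. (2 powr 12 * \<bar>v t - \<alpha>0\<bar> + K3 * exp (- ((m2 - l) * t))) * sobolev_constant) \<longlongrightarrow> (2 powr 12 * 0 + K3 * 0) * sobolev_constant) at_top"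
      by (intro tendsto_intros e0)
    then show "((\<lambda>t. B t / exp (- (l * t))) \<longlongrightarrow> 0) at_top" unfolding Beq by simp
  qed (auto simp: sobolev_norm_nonneg)
  then show ?thesis unfolding eq by blast
qed

end

section \<open>Resonance of the first mode and the critical expansion\<close>

lemma
  fixes F :: "int \<Rightarrow> 'b :: {banach, second_countable_topology}"
  shows integral_int_delta: "(LINT k|int_counting. (if k = m then F k else 0)) = F m"
    and integrable_int_delta: "integrable int_counting (\<lambda>k. if k = m then F k else 0)"
proof -
  have one: "\<langle>m\<rangle> powr 2 * \<langle>m\<rangle> powr (- 2) = 1"
    by (simp only: powr_add[symmetric]) simp
  show "integrable int_counting (\<lambda>k. if k = m then F k else 0)"
  proof (rule integrable_int_bound[of 2 _ "norm (F m) * \<langle>m\<rangle> powr 2"])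
    fix k
    show "norm (if k = m then F k else 0) \<le> norm (F m) * \<langle>m\<rangle> powr 2 * \<langle>k\<rangle> powr (- 2)"
      using one by (cases "k = m") (simp_all add: mult.assoc)
  qed simp
  show "(LINT k|int_counting. (if k = m then F k else 0)) = F m"
    by (subst lebesgue_integral_count_space_finite_support) auto
qed

context bounded_mild
begin

lemma y_1_sq_le_energy:
  assumes t: "t > 0" shows "2 * (y t 1)\<^sup>2 \<le> energy t"
proof -
  have "(\<Sum>n\<in>{0}. 2 * (y t (int (Suc n)))\<^sup>2) \<le> (\<Sum>n. 2 * (y t (int (Suc n)))\<^sup>2)"
    by (rule sum_le_suminf[OF energy_summable[OF t]]) auto
  then show ?thesis by (simp add: energy_series[OF t])
qed

text \<open>
  The identity \<open>sin\<^sup>3 x = (3 sin x - sin 3x) / 4\<close> turns the cube of the first mode into \<open>3 y\<^sup>3\<close>;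
  the other modes contribute through \<open>u\<^sup>3 - \<phi>\<^sup>3 = (u - \<phi>)(u\<^sup>2 + u\<phi> + \<phi>\<^sup>2)\<close>.
\<close>

lemma cubic_resonance:
  assumes t: "t > 0"
  shows "\<bar>c t 1 - 3 * (y t 1) ^ 3\<bar> \<le> (LINT k|int_counting. (if \<bar>k\<bar> \<ge> 2 then \<bar>y t k\<bar> else 0)) * (9 / 2 * energy t)"
proof -
  define \<phi> where "\<phi> x = - 2 * y t 1 * sin x" for x
  have um [measurable]: "u t \<in> borel_measurable borel" by (rule u_measurable[OF t])
  note bu = bdd_borel_u[OF t]
  have b\<phi>: "bdd_borel (\<lambda>x. complex_of_real (\<phi> x))"
  proof (rule bdd_borel_of_real[where B = "2 * \<bar>y t 1\<bar>"])
    show "\<phi> \<in> borel_measurable borel" unfolding \<phi>_def by measurable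
    show "\<bar>\<phi> x\<bar> \<le> 2 * \<bar>y t 1\<bar>" for x
      using mult_left_mono[of "\<bar>sin x\<bar>" 1 "2 * \<bar>y t 1\<bar>"] by (simp add: \<phi>_def abs_mult)
  qed
  define h where "h x = (of_real ((u t x)\<^sup>2 + u t x * \<phi> x + (\<phi> x)\<^sup>2) :: complex) * cis (- (of_int 1 * x))" for x
  have bh: "bdd_borel h"
  proof -
    have "bdd_borel (\<lambda>x. (complex_of_real (u t x)) ^ 2 + complex_of_real (u t x) * complex_of_real (\<phi> x) + (complex_of_real (\<phi> x)) ^ 2)"
      by (intro bdd_borel_add bdd_borel_mult bdd_borel_power bu b\<phi>)
    from bdd_borel_mult[OF this bdd_borel_cis_minus[of "of_int 1"]] show ?thesis by (simp add: h_def[abs_def])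
  qed
  \<comment> \<open>the coefficients of \<open>\<phi>\<close>, the part of \<open>u t\<close> at \<open>\<bar>k\<bar> = 1\<close>\<close>
  define p where "p k = (if k = 1 then a t 1 else 0) + (if k = - 1 then a t (- 1) else 0)" for k :: int
  have ip: "integrable int_counting p"
    unfolding p_def by (intro Bochner_Integration.integrable_add integrable_int_delta)
  have p\<phi>: "(LINT k|int_counting. p k * cis (of_int k * x)) = complex_of_real (\<phi> x)" for x
  proof -
    have "(LINT k|int_counting. p k * cis (of_int k * x))
      = (LINT k|int_counting. (if k = 1 then a t 1 * cis (of_int k * x) else 0) + (if k = - 1 then a t (- 1) * cis (of_int k * x) else 0))"
      by (intro Bochner_Integration.integral_cong refl) (simp add: p_def)
    also have "\<dots> = a t 1 * cis (of_int 1 * x) + a t (- 1) * cis (of_int (- 1) * x)"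
      by (subst Bochner_Integration.integral_add[OF integrable_int_delta integrable_int_delta])
         (simp only: integral_int_delta)
    also have "\<dots> = complex_of_real (\<phi> x)"
      using y_minus[of t 1] by (simp add: a_eq_y[OF t] \<phi>_def complex_eq_iff)
    finally show ?thesis .
  qed
  have pair\<phi>: "(1 / (2 * pi)) *\<^sub>R (LINT x|torus. complex_of_real (\<phi> x) * h x) = (LINT k|int_counting. p k * torus_coeff h (- k))"
    using series_pairing[OF ip bh] unfolding p\<phi> by (simp add: scaleR_conv_of_real)
  have diff: "complex_of_real (u t x) * h x - complex_of_real (\<phi> x) * h x
       = (of_real ((u t x) ^ 3) - of_real ((\<phi> x) ^ 3)) * cis (- (of_int 1 * x))" for x
    by (simp add: h_def power2_eq_square power3_eq_cube algebra_simps)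
  have b\<phi>3: "bdd_borel (\<lambda>x. complex_of_real ((\<phi> x) ^ 3))"
    using bdd_borel_power[OF b\<phi>, of 3] by simp
  have "d t 1 - torus_coeff (\<lambda>x. of_real ((\<phi> x) ^ 3)) 1 = torus_coeff (\<lambda>x. of_real ((u t x) ^ 3) - of_real ((\<phi> x) ^ 3)) 1"
    unfolding d_def by (rule torus_coeff_diff[symmetric, OF bdd_borel_cube[OF t] b\<phi>3])
  also have "\<dots> = (1 / (2 * pi)) *\<^sub>R (LINT x|torus. complex_of_real (u t x) * h x - complex_of_real (\<phi> x) * h x)"
    unfolding diff torus_coeff_def ..
  also have "\<dots> = (1 / (2 * pi)) *\<^sub>R (LINT x|torus. complex_of_real (u t x) * h x) - (1 / (2 * pi)) *\<^sub>R (LINT x|torus. complex_of_real (\<phi> x) * h x)"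
    by (subst Bochner_Integration.integral_diff)
       (auto intro!: bdd_borel_integrable bdd_borel_mult bu b\<phi> bh simp: scaleR_diff_right)
  also have "\<dots> = (LINT k|int_counting. (a t k - p k) * torus_coeff h (- k))"
    unfolding u_pairing[OF t bh] pair\<phi> left_diff_distrib
    by (rule Bochner_Integration.integral_diff[symmetric, OF u_pairing_integrable[OF t bh] series_pairing_integrable[OF ip bh]])
  finally have "cmod (d t 1 - torus_coeff (\<lambda>x. of_real ((\<phi> x) ^ 3)) 1) \<le> (LINT k|int_counting. cmod (a t k - p k)) * ((1 / (2 * pi)) * (LINT x|torus. cmod (h x)))"
    using norm_pairing_le[OF Bochner_Integration.integrable_diff[OF integrable_a[OF t] ip] bh] by simp
  also have "(\<lambda>k. cmod (a t k - p k)) = (\<lambda>k. if \<bar>k\<bar> \<ge> 2 then \<bar>y t k\<bar> else 0)"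
  proof
    fix k :: int
    consider "k = 0" | "k = 1" | "k = - 1" | "\<bar>k\<bar> \<ge> 2" by linarith
    then show "cmod (a t k - p k) = (if \<bar>k\<bar> \<ge> 2 then \<bar>y t k\<bar> else 0)"
      by cases (auto simp: p_def norm_a_y[OF t] y_zero)
  qed
  also have "(LINT k|int_counting. (if \<bar>k\<bar> \<ge> 2 then \<bar>y t k\<bar> else 0)) * ((1 / (2 * pi)) * (LINT x|torus. cmod (h x)))
     \<le> (LINT k|int_counting. (if \<bar>k\<bar> \<ge> 2 then \<bar>y t k\<bar> else 0)) * (9 / 2 * energy t)"
  proof (intro mult_left_mono)
    have i2: "integrable torus (\<lambda>x. (u t x)\<^sup>2)" by (rule integrable_u_power[OF t])
    have ic: "integrable torus (\<lambda>x. 2 * energy t)" by (rule integrable_torus[of _ "\<bar>2 * energy t\<bar>"]) auto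
    have "(LINT x|torus. cmod (h x)) \<le> (LINT x|torus. 3 / 2 * ((u t x)\<^sup>2 + 2 * energy t))"
    proof (rule integral_mono)
      show "integrable torus (\<lambda>x. cmod (h x))" by (rule integrable_norm[OF bdd_borel_integrable[OF bh]])
      show "integrable torus (\<lambda>x. 3 / 2 * ((u t x)\<^sup>2 + 2 * energy t))"
        by (rule integrable_mult_right[OF Bochner_Integration.integrable_add[OF i2 ic]])
      fix x
      have "(\<phi> x)\<^sup>2 \<le> 4 * (y t 1)\<^sup>2 * 1"
        unfolding \<phi>_def power_mult_distrib using abs_sin_le_one[of x]
        by (intro mult_mono) (auto simp: abs_square_le_1)
      then have \<phi>2: "(\<phi> x)\<^sup>2 \<le> 2 * energy t" using y_1_sq_le_energy[OF t] by simp
      have "2 * \<bar>u t x * \<phi> x\<bar> \<le> (u t x)\<^sup>2 + (\<phi> x)\<^sup>2"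
        using mult_le_half_squares[of "\<bar>u t x\<bar>" "\<bar>\<phi> x\<bar>"] by (simp add: abs_mult)
      moreover have "\<bar>(u t x)\<^sup>2 + u t x * \<phi> x + (\<phi> x)\<^sup>2\<bar> \<le> (u t x)\<^sup>2 + \<bar>u t x * \<phi> x\<bar> + (\<phi> x)\<^sup>2"
        using abs_triangle_ineq[of "(u t x)\<^sup>2 + u t x * \<phi> x" "(\<phi> x)\<^sup>2"] abs_triangle_ineq[of "(u t x)\<^sup>2" "u t x * \<phi> x"]
        by simp
      moreover have "cmod (h x) = \<bar>(u t x)\<^sup>2 + u t x * \<phi> x + (\<phi> x)\<^sup>2\<bar>"
        unfolding h_def norm_mult norm_of_real by simp
      ultimately have "2 * cmod (h x) \<le> 3 * (u t x)\<^sup>2 + 6 * energy t" using \<phi>2 by linarith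
      then show "cmod (h x) \<le> 3 / 2 * ((u t x)\<^sup>2 + 2 * energy t)" by simp
    qed
    also have "\<dots> = 3 / 2 * ((LINT x|torus. (u t x)\<^sup>2) + 2 * pi * (2 * energy t))"
      using i2 ic by simp
    also have "\<dots> = 2 * pi * (9 / 2 * energy t)" by (simp add: energy_def field_simps)
    finally show "(1 / (2 * pi)) * (LINT x|torus. cmod (h x)) \<le> 9 / 2 * energy t" by (simp add: field_simps)
  qed (auto intro!: integral_nonneg_AE)
  finally have main: "cmod (d t 1 - torus_coeff (\<lambda>x. of_real ((\<phi> x) ^ 3)) 1) \<le> (LINT k|int_counting. (if \<bar>k\<bar> \<ge> 2 then \<bar>y t k\<bar> else 0)) * (9 / 2 * energy t)" .
  have "torus_coeff (\<lambda>x. of_real ((\<phi> x) ^ 3)) 1 = 3 * \<i> * of_real ((y t 1) ^ 3)"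
  proof -
    have bs: "bdd_borel (\<lambda>x. complex_of_real (sin (of_int m * x)))" for m :: int
      by (rule bdd_borel_of_real[where B = 1]) auto
    have sin3: "sin (3 * x) = 3 * sin x - 4 * (sin x) ^ 3" for x :: real
    proof -
      have "sin (3 * x) = sin (2 * x) * cos x + cos (2 * x) * sin x"
        using sin_add[of "2 * x" x] by simp
      also have "\<dots> = 2 * sin x * (cos x)\<^sup>2 + (1 - 2 * (sin x)\<^sup>2) * sin x"
        by (simp add: sin_double cos_double_sin power2_eq_square)
      also have "\<dots> = 3 * sin x - 4 * (sin x) ^ 3"
        unfolding cos_squared_eq by (simp add: algebra_simps power2_eq_square power3_eq_cube)
      finally show ?thesis .
    qed
    have "(\<phi> x) ^ 3 = 2 * (y t 1) ^ 3 * sin (of_int 3 * x) - 6 * (y t 1) ^ 3 * sin (of_int 1 * x)" for x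
    proof -
      have "sin (of_int 3 * x) = 3 * sin x - 4 * (sin x) ^ 3" using sin3[of x] by simp
      then show ?thesis by (simp only: \<phi>_def power_mult_distrib) (simp add: right_diff_distrib)
    qed
    then have "complex_of_real ((\<phi> x) ^ 3) = of_real (2 * (y t 1) ^ 3) * of_real (sin (of_int 3 * x)) - of_real (6 * (y t 1) ^ 3) * of_real (sin (of_int 1 * x))" for x
      by (simp only: of_real_diff of_real_mult)
    then have "torus_coeff (\<lambda>x. of_real ((\<phi> x) ^ 3)) 1 = of_real (2 * (y t 1) ^ 3) * torus_coeff (\<lambda>x. of_real (sin (of_int 3 * x))) 1 - of_real (6 * (y t 1) ^ 3) * torus_coeff (\<lambda>x. of_real (sin (of_int 1 * x))) 1"
      by (simp only: torus_coeff_diff[OF bdd_borel_mult[OF bdd_borel_const bs] bdd_borel_mult[OF bdd_borel_const bs]] torus_coeff_cmult)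
    then show ?thesis by (simp only: torus_coeff_sin_mult) simp
  qed
  then have "c t 1 - 3 * (y t 1) ^ 3 = Im (d t 1 - torus_coeff (\<lambda>x. of_real ((\<phi> x) ^ 3)) 1)"
    by (simp add: c_def)
  also have "\<bar>\<dots>\<bar> \<le> cmod (d t 1 - torus_coeff (\<lambda>x. of_real ((\<phi> x) ^ 3)) 1)" by (rule abs_Im_le_cmod)
  finally show ?thesis using main by linarith
qed

text \<open>
  The energy is \<open>O(1/t)\<close>, hence so are the high modes, and interpolation keeps \<open>O(t\<^sup>-\<^sup>7\<^sup>/\<^sup>8)\<close>.  The resonance
  lemma then perturbs the cubic equation for the first mode by the product \<open>O(t\<^sup>-\<^sup>1\<^sup>5\<^sup>/\<^sup>8)\<close>, which is of smaller
  order than \<open>t\<^sup>-\<^sup>3\<^sup>/\<^sup>2\<close>.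
\<close>

lemma critical_expansion:
  assumes \<kappa>: "\<kappa> = 1"
  shows "\<exists>\<beta>. (\<lambda>t. sobolev_norm 10 (remainder (t powr (- 1 / 2) * \<beta>) t)) \<in> o[at_top](\<lambda>t. t powr (- 1 / 2))"
proof -
  have \<nu>1: "\<nu> = 1" using \<kappa> by simp
  define m1 where "m1 = (2::real) powr \<gamma> - 1"
  have m1: "m1 > 0" using \<gamma>_pos by (simp add: m1_def)
  \<comment> \<open>beyond \<open>2 / m1\<close> the damping of \<open>K/t\<close> is at least twice its rate of decrease\<close>
  define T where "T = max 2 (2 / m1)"
  have T: "T \<ge> 2" "T \<ge> 1" "T * m1 \<ge> 2"
  proof -
    show "T \<ge> 2" "T \<ge> 1" by (auto simp: T_def)
    have "2 / m1 \<le> T" by (simp add: T_def)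
    then show "T * m1 \<ge> 2" using m1 by (simp add: field_simps)
  qed
  \<comment> \<open>the first value makes \<open>K/t\<close> a supersolution, the second one dominates at time \<open>T\<close>\<close>
  define K where "K = max (2 * sup_u / m1) (sup_u * T)"
  have K0: "K \<ge> 0" using sup_u_nonneg T by (simp add: K_def le_max_iff_disj)
  have K1: "sup_u \<le> m1 / 2 * K"
  proof -
    have "2 * sup_u / m1 \<le> K" by (simp add: K_def)
    then show ?thesis using m1 by (simp add: field_simps)
  qed
  have high: "\<bar>y t k\<bar> \<le> K / t" if "t \<ge> T" "\<bar>k\<bar> \<ge> 2" for t k
  proof (rule high_mode_bound[where T = T and z = "\<lambda>t. K / t" and z' = "\<lambda>t. - K / t\<^sup>2"])
    fix s :: real assume s: "s \<ge> T"
    then have s0: "s > 0" using T by simp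
    show "((\<lambda>t. K / t) has_real_derivative - K / s\<^sup>2) (at s)"
      using s0 by (auto intro!: derivative_eq_intros simp: power2_eq_square)
    have "sup_u * energy s \<le> sup_u * (1 / s)"
      using s T by (intro mult_left_mono energy_algebraic_decay sup_u_nonneg) auto
    also have "\<dots> \<le> (m1 / 2 * K) * (1 / s)" using s0 by (intro mult_right_mono K1) auto
    also have "\<dots> \<le> - K / s\<^sup>2 + m1 * (K / s)"
    proof -
      have "2 \<le> s * m1" using mult_right_mono[OF s, of m1] T m1 by linarith
      then have "K * 2 \<le> K * (s * m1)" using K0 by (intro mult_left_mono) auto
      then have "K / s\<^sup>2 \<le> m1 / 2 * K * (1 / s)" using s0 by (simp add: field_simps power2_eq_square)
      then show ?thesis by (simp add: field_simps)
    qed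
    finally show "sup_u * energy s \<le> - K / s\<^sup>2 + (\<nu> * 2 powr \<gamma> - 1) * (K / s)"
      by (simp add: m1_def \<nu>1)
    show "K / s \<ge> 0" using K0 s0 by simp
  next
    have "sup_u * T \<le> K" by (simp add: K_def)
    then show "sup_u \<le> K / T" using T by (simp add: field_simps)
  qed (use that T in auto)
  obtain K2 where K2: "K2 \<ge> 0" "\<And>t k. t \<ge> T \<Longrightarrow> \<bar>k\<bar> \<ge> 2 \<Longrightarrow> \<bar>y t k\<bar> \<le> K2 * (K / t) powr (1 - 1 / 8) * \<langle>k\<rangle> powr (- 12)"
    using high_mode_interpolation[where T = T and z = "\<lambda>t. K / t" and \<theta> = "1 / 8", OF T(2) high] by auto
  define K3 where "K3 = K2 * K powr (7 / 8)"
  have K3: "K3 \<ge> 0" using K2 by (simp add: K3_def)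
  have high2: "\<bar>y t k\<bar> \<le> (K3 * t powr (- 7 / 8)) * \<langle>k\<rangle> powr (- 12)" if "t \<ge> T" "\<bar>k\<bar> \<ge> 2" for t k
  proof -
    have "(K / t) powr (7 / 8) = K powr (7 / 8) * t powr (- 7 / 8)"
    proof -
      have "t powr (- 7 / 8) = inverse (t powr (7 / 8))" using powr_minus[of t "7 / 8"] by simp
      moreover have "(K / t) powr (7 / 8) = K powr (7 / 8) / t powr (7 / 8)"
        by (rule powr_divide)
      ultimately show ?thesis by (simp only: divide_inverse)
    qed
    then show ?thesis using K2(2)[OF that] by (simp add: K3_def mult_ac)
  qed
  define W where "W = (LINT k|int_counting. \<langle>k\<rangle> powr (- 12))"
  have "\<exists>\<beta>0. ((\<lambda>t. t powr (1 / 2) * y t 1) \<longlongrightarrow> \<beta>0) at_top"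
  proof (rule cubic_ode_limit[where e = "\<lambda>t. c t 1 - 3 * (y t 1) ^ 3" and K = "K3 * W * (9 / 2)" and T = T])
    fix t assume t: "t \<ge> T"
    then have t0: "t > 0" using T by simp
    have lam1: "lam 1 = 1" by (simp add: lam_def \<nu>1)
    show "((\<lambda>t. y t 1) has_real_derivative - 3 * (y t 1) ^ 3 - (c t 1 - 3 * (y t 1) ^ 3)) (at t)"
      using y_derivative[OF t0, of 1] by (simp add: lam1)
    have "(LINT k|int_counting. (if \<bar>k\<bar> \<ge> 2 then \<bar>y t k\<bar> else 0)) \<le> (LINT k|int_counting. (K3 * t powr (- 7 / 8)) * \<langle>k\<rangle> powr (- 12))"
    proof (rule integral_mono)
      show i: "integrable int_counting (\<lambda>k. (K3 * t powr (- 7 / 8)) * \<langle>k\<rangle> powr (- 12))"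
        by (intro integrable_mult_right integrable_int_powr) simp
      show le: "(if \<bar>k\<bar> \<ge> 2 then \<bar>y t k\<bar> else 0) \<le> (K3 * t powr (- 7 / 8)) * \<langle>k\<rangle> powr (- 12)" for k
        using high2[OF t, of k] K3 by auto
      show "integrable int_counting (\<lambda>k. if \<bar>k\<bar> \<ge> 2 then \<bar>y t k\<bar> else 0)"
      proof (rule Bochner_Integration.integrable_bound[OF i])
        show "AE k in int_counting. norm (if \<bar>k\<bar> \<ge> 2 then \<bar>y t k\<bar> else 0) \<le> norm ((K3 * t powr (- 7 / 8)) * \<langle>k\<rangle> powr (- 12))"
        proof (rule AE_I2)
          fix k :: int
          have "norm (if \<bar>k\<bar> \<ge> 2 then \<bar>y t k\<bar> else 0) = (if \<bar>k\<bar> \<ge> 2 then \<bar>y t k\<bar> else 0)" by simp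
          also note le[of k]
          also have "(K3 * t powr (- 7 / 8)) * \<langle>k\<rangle> powr (- 12) \<le> norm ((K3 * t powr (- 7 / 8)) * \<langle>k\<rangle> powr (- 12))"
            unfolding real_norm_def by (rule abs_ge_self)
          finally show "norm (if \<bar>k\<bar> \<ge> 2 then \<bar>y t k\<bar> else 0) \<le> norm ((K3 * t powr (- 7 / 8)) * \<langle>k\<rangle> powr (- 12))" .
        qed
      qed simp
    qed
    also have "\<dots> = K3 * t powr (- 7 / 8) * W" by (simp add: W_def)
    finally have S: "(LINT k|int_counting. (if \<bar>k\<bar> \<ge> 2 then \<bar>y t k\<bar> else 0)) \<le> K3 * t powr (- 7 / 8) * W" .
    have "\<bar>c t 1 - 3 * (y t 1) ^ 3\<bar> \<le> (LINT k|int_counting. (if \<bar>k\<bar> \<ge> 2 then \<bar>y t k\<bar> else 0)) * (9 / 2 * energy t)"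
      by (rule cubic_resonance[OF t0])
    also have "\<dots> \<le> (K3 * t powr (- 7 / 8) * W) * (9 / 2 * (1 / t))"
    proof (rule mult_mono[OF S])
      show "9 / 2 * energy t \<le> 9 / 2 * (1 / t)" using t T by (intro mult_left_mono energy_algebraic_decay) auto
    qed (use K3 energy_nonneg in \<open>auto simp: W_def\<close>)
    also have "\<dots> = K3 * W * (9 / 2) * (t powr (- 7 / 8) * (1 / t))" by (simp add: mult_ac)
    also have "t powr (- 7 / 8) * (1 / t) = t powr (- 15 / 8)"
      using t0 powr_diff[of t "- 7 / 8" 1] by simp
    finally show "\<bar>c t 1 - 3 * (y t 1) ^ 3\<bar> \<le> K3 * W * (9 / 2) * t powr (- 15 / 8)" .
  qed (rule T)
  then obtain \<beta>0 where \<beta>0: "((\<lambda>t. t powr (1 / 2) * y t 1) \<longlongrightarrow> \<beta>0) at_top" by blast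
  define \<beta> where "\<beta> = - 2 * \<beta>0"
  define B where "B t = (2 powr 12 * \<bar>y t 1 + t powr (- 1 / 2) * \<beta> / 2\<bar> + K3 * t powr (- 7 / 8)) * sobolev_constant" for t
  have "(\<lambda>t. sobolev_norm 10 (remainder (t powr (- 1 / 2) * \<beta>) t)) \<in> o[at_top](\<lambda>t. t powr (- 1 / 2))"
  proof (rule smallo_of_tendsto_bound[where B = B])
    show "\<forall>\<^sub>F t in at_top. sobolev_norm 10 (remainder (t powr (- 1 / 2) * \<beta>) t) \<le> B t"
      using eventually_ge_at_top[of T]
    proof eventually_elim
      case (elim t)
      then show ?case
        unfolding B_def using K3 high2[of t] T by (intro remainder_norm_le) auto
    qed
    show "\<forall>\<^sub>F t::real in at_top. 0 < t powr (- 1 / 2)"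
      using eventually_gt_at_top[of "0::real"] by eventually_elim simp
    have Beq: "B t / t powr (- 1 / 2) = (2 powr 12 * \<bar>t powr (1 / 2) * y t 1 - \<beta>0\<bar> + K3 * t powr (- 3 / 8)) * sobolev_constant" if "t > 0" for t
    proof -
      have one: "t powr (- 1 / 2) * t powr (1 / 2) = 1" using that by (simp add: powr_add[symmetric])
      have "(t powr (1 / 2) * y t 1 - \<beta>0) * t powr (- 1 / 2) = (t powr (- 1 / 2) * t powr (1 / 2)) * y t 1 + t powr (- 1 / 2) * \<beta> / 2"
        by (simp add: \<beta>_def algebra_simps)
      then have "y t 1 + t powr (- 1 / 2) * \<beta> / 2 = (t powr (1 / 2) * y t 1 - \<beta>0) * t powr (- 1 / 2)"
        unfolding one by simp
      then have 1: "\<bar>y t 1 + t powr (- 1 / 2) * \<beta> / 2\<bar> = \<bar>t powr (1 / 2) * y t 1 - \<beta>0\<bar> * t powr (- 1 / 2)" by (simp add: abs_mult)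
      have 2: "t powr (- 7 / 8) = t powr (- 3 / 8) * t powr (- 1 / 2)"
        by (simp add: powr_add[symmetric])
      have "B t = ((2 powr 12 * \<bar>t powr (1 / 2) * y t 1 - \<beta>0\<bar> + K3 * t powr (- 3 / 8)) * sobolev_constant) * t powr (- 1 / 2)"
        unfolding B_def 1 2 by (simp only: distrib_right distrib_left mult_ac)
      then show ?thesis using that by simp
    qed
    have p0: "((\<lambda>t::real. t powr (- 3 / 8)) \<longlongrightarrow> 0) at_top"
      by (intro tendsto_neg_powr filterlim_ident) auto
    have "((\<lambda>t. \<bar>t powr (1 / 2) * y t 1 - \<beta>0\<bar>) \<longlongrightarrow> 0) at_top"
      using \<beta>0 by (simp add: LIM_zero tendsto_rabs_zero)
    then have "((\<lambda>t. (2 powr 12 * \<bar>t powr (1 / 2) * y t 1 - \<beta>0\<bar> + K3 * t powr (- 3 / 8)) * sobolev_constant) \<longlongrightarrow> (2 powr 12 * 0 + K3 * 0) * sobolev_constant) at_top"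
      by (intro tendsto_intros p0)
    then have "((\<lambda>t. (2 powr 12 * \<bar>t powr (1 / 2) * y t 1 - \<beta>0\<bar> + K3 * t powr (- 3 / 8)) * sobolev_constant) \<longlongrightarrow> 0) at_top"
      by simp
    moreover have "\<forall>\<^sub>F t in at_top. (2 powr 12 * \<bar>t powr (1 / 2) * y t 1 - \<beta>0\<bar> + K3 * t powr (- 3 / 8)) * sobolev_constant = B t / t powr (- 1 / 2)"
      using eventually_gt_at_top[of 0] by eventually_elim (rule Beq[symmetric])
    ultimately show "((\<lambda>t. B t / t powr (- 1 / 2)) \<longlongrightarrow> 0) at_top" by (rule Lim_transform_eventually)
  qed (auto simp: sobolev_norm_nonneg)
  then show ?thesis by blast
qed

end

theorem theorem1p3:
  fixes \<kappa> \<gamma> :: real and u0 :: "real \<Rightarrow> real" and u :: "real \<Rightarrow> real \<Rightarrow> real"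
  assumes "\<kappa> \<ge> 1" and "0 < \<gamma>" and "\<gamma> \<le> 2"
    and "u0 \<in> borel_measurable lebesgue"
    and "torus_periodic u0"
    and "\<forall>x. u0 (- x) = - u0 x"
    and "bounded (range u0)"
    and "bounded_mild_solution \<kappa> \<gamma> u0 u"
  shows "(\<kappa> > 1 \<longrightarrow>
           (\<exists>\<alpha> :: real. \<exists>r :: real \<Rightarrow> real \<Rightarrow> real.
             (\<forall>t\<ge>1. \<forall>x. u t x = exp (- (\<kappa>\<^sup>2 - 1) * t) * \<alpha> * sin x + r t x) \<and>
             (\<forall>t\<ge>1. r t \<in> sobolev_space 10) \<and>
             (\<lambda>t. sobolev_norm 10 (r t)) \<in> o[at_top](\<lambda>t. exp (- (\<kappa>\<^sup>2 - 1) * t)))) \<and>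
         (\<kappa> = 1 \<longrightarrow>
           (\<exists>\<beta> :: real. \<exists>r\<^sub>1 :: real \<Rightarrow> real \<Rightarrow> real.
             (\<forall>t\<ge>1. \<forall>x. u t x = t powr (- 1 / 2) * \<beta> * sin x + r\<^sub>1 t x) \<and>
             (\<forall>t\<ge>1. r\<^sub>1 t \<in> sobolev_space 10) \<and>
             (\<lambda>t. sobolev_norm 10 (r\<^sub>1 t)) \<in> o[at_top](\<lambda>t. t powr (- 1 / 2))))"
proof -
  interpret bounded_mild \<kappa> \<gamma> u0 u
    using assms by unfold_locales auto
  show ?thesis
  proof (intro conjI impI)
    assume "\<kappa> > 1"
    then obtain \<alpha> where \<alpha>: "(\<lambda>t. sobolev_norm 10 (remainder (exp (- (\<kappa>\<^sup>2 - 1) * t) * \<alpha>) t)) \<in> o[at_top](\<lambda>t. exp (- (\<kappa>\<^sup>2 - 1) * t))"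
      using supercritical_expansion by blast
    show "\<exists>\<alpha> :: real. \<exists>r :: real \<Rightarrow> real \<Rightarrow> real.
             (\<forall>t\<ge>1. \<forall>x. u t x = exp (- (\<kappa>\<^sup>2 - 1) * t) * \<alpha> * sin x + r t x) \<and>
             (\<forall>t\<ge>1. r t \<in> sobolev_space 10) \<and>
             (\<lambda>t. sobolev_norm 10 (r t)) \<in> o[at_top](\<lambda>t. exp (- (\<kappa>\<^sup>2 - 1) * t))"
      by (intro exI[of _ \<alpha>] exI[of _ "\<lambda>t. remainder (exp (- (\<kappa>\<^sup>2 - 1) * t) * \<alpha>) t"] conjI allI impI remainder_sobolev \<alpha>)
         (auto simp: remainder_def)
  next
    assume "\<kappa> = 1"
    then obtain \<beta> where \<beta>: "(\<lambda>t. sobolev_norm 10 (remainder (t powr (- 1 / 2) * \<beta>) t)) \<in> o[at_top](\<lambda>t. t powr (- 1 / 2))"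
      using critical_expansion by blast
    show "\<exists>\<beta> :: real. \<exists>r\<^sub>1 :: real \<Rightarrow> real \<Rightarrow> real.
             (\<forall>t\<ge>1. \<forall>x. u t x = t powr (- 1 / 2) * \<beta> * sin x + r\<^sub>1 t x) \<and>
             (\<forall>t\<ge>1. r\<^sub>1 t \<in> sobolev_space 10) \<and>
             (\<lambda>t. sobolev_norm 10 (r\<^sub>1 t)) \<in> o[at_top](\<lambda>t. t powr (- 1 / 2))"
      by (intro exI[of _ \<beta>] exI[of _ "\<lambda>t. remainder (t powr (- 1 / 2) * \<beta>) t"] conjI allI impI remainder_sobolev \<beta>)
         (auto simp: remainder_def)
  qed
qed

end
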